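(* Under the standing assumptions below, for any strongly compressed set $A\subseteq V_G$ there exists a set $B\subseteq V_G$ that is both strongly compressed and slice-compressed, with $|B|=|A|$ and $|I_G(A)|\le |I_G(B)|$.
   Context: All graphs are finite and simple. For $G=(V,E)$ and $A,B\subseteq V$, $I_G(A,B)$ is the set of edges with one end in $A$ and the other in $B$, $I_G(A)=I_G(A,A)$, $I_G(m)=\max_{|S|=m}|I_G(S)|$. A total order on $G$ is a bijection $\mathcal O:V\to\{1,\dots,|V|\}$, $\mathcal O[k,l]=\mathcal O^{-1}(\{k,\dots,l\})$, $\mathcal O[k]=\mathcal O[1,k]$; it is optimal if $|I_G(\mathcal O[k])|=I_G(k)$ for all $k$; $G$ is isoperimetric if it has an optimal order. $\delta_G(1)=0$, $\delta_G(m)=I_G(m)-I_G(m-1)$ ($m\ge2$). Cartesian product $G_1\square\cdots\square G_d$: vertices are tuples, adjacent iff they differ in exactly one coordinate, where they are adjacent. Lexicographic order on $\mathbb R^k$: $x<y$ iff for some $i$, $x_1=y_1,\dots,x_i=y_i$, $x_{i+1}<y_{i+1}$. For $\pi\in\mathfrak S_k$, domination order $\mathcal D^{\pi,k}$: compare $(x_{\pi(1)},\dots,x_{\pi(k)})$ lexicographically. Orders on $\mathbb R^k$ induce orders on products of ordered sets by comparing the tuples of ranks. Isoperimetric partition of an isoperimetric $G$ with optimal order $\mathcal O_G$: partition $\{\mathcal O_G[a_1,b_1],\dots,\mathcal O_G[a_k,b_k]\}$ of $V$ into consecutive intervals such that each part induces an isoperimetric subgraph for which the restriction of $\mathcal O_G$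 is optimal, and for each $v\in\mathcal O_G[a_i,b_i]$, $|I_G(\mathcal O_G[a_1,b_{i-1}],\{v\})|=\delta_G(a_i)$. The first vertex of a part is its start. Non-decreasing: every part's induced subgraph has non-decreasing $\delta$-sequence. Regular: the first and last parts' induced subgraphs have equal $\delta$-sequences. Setup: $G_i$ ($i=1,\dots,d$) isoperimetric with fixed optimal orders $\mathcal O_{G_i}$ and isoperimetric partitions $\mathfrak P_{G_i}$; $G=G_1\square\cdots\square G_d$; for nonempty $S=\{i_1<\dots<i_k\}$, $G_S=G_{i_1}\square\cdots\square G_{i_k}$. A block of $G_S$ is $Z_{i_1}\times\cdots\times Z_{i_k}$ with $Z_{i_j}\in\mathfrak P_{G_{i_j}}$; its start is the tuple of starts. An order $\mathcal O$ on a product is consistent with an order $\mathcal O'$ on the subproduct over $S$ if $x<_{\mathcal O}y$ and $x_j=y_j$ ($j\notin S$) imply that the projections to $S$ satisfy the same inequality in $\mathcal O'$. Domination collection: to each block $B$ of each $G_S$ ($|S|=k$) is assigned $\pi_B\in\mathfrak S_k$ so that the order $\mathcal D_B$ induced on $B$ by $\mathcal D^{\pi_B,k}$ (coordinates ranked by the restrictions of the $\mathcal O_{G_{i_j}}$) is optimal for the subgraph induced by $B$, and for $S_1\subset S_2$, $\mathcal D_{B_2}$ is consistent with $\mathcal D_{B_1}$ whenever $B_1$ consists of the factors of $B_2$ indexed by $S_1$. Block-lexicographic order $\mathcal{BL}^k_{G_S}$: same block: compare by $\mathcal D_B$; different blocks: compare their starts lexicographically (coordinates ranked by $\mathcal O_{G_{i_j}}$).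 Regular domination collection: $\mathfrak P_{G_i}$ regular for $2\le i\le d-1$, and $\pi_{B_1}=\pi_{B_2}$ for $B_1$ (resp. $B_2$) the product of the first (resp. last) parts of $\mathfrak P_{G_2},\dots,\mathfrak P_{G_{d-1}}$. Standing assumptions: $d\ge3$; the $\mathfrak P_{G_i}$ form a regular domination collection; $\mathfrak P_{G_i}$ is non-decreasing for $i=1,\dots,d-1$; $\mathcal{BL}^2_{G_i\square G_j}$ is optimal for all $i<j$. Compression: for a nonempty proper $S\subset\{1,\dots,d\}$ with a total order on $G_S$, and $x\in V_{G_{\overline S}}$ ($\overline S$ the complement), the section $G_S(x)$ is the set of vertices of $G$ whose coordinates in $\overline S$ equal $x$, ordered via the isomorphism with $G_S$. The compression of $A\subseteq V_G$ replaces each $A\cap G_S(x)$ by the initial segment of $G_S(x)$ of the same size. $A$ is compressed if it is unchanged by compression for each $S=\{i\}$ (order $\mathcal O_{G_i}$); $A$ is strongly compressed if it is unchanged by compression for every nonempty proper $S$ with respect to $\mathcal{BL}^{|S|}_{G_S}$. Slices: let $s_1,s_2,\dots$ be the starts of the parts of $\mathfrak P_{G_1}$ in increasing $\mathcal O_{G_1}$-order; $\mathrm{Slice}_G(q)$ is the union of all blocks of $G$ whose start has first coordinate $s_q$. Blocks are ordered by $\mathcal{BL}^d_G$ applied to their starts. $A$ is slice-compressed if for every slice, listing its blocks $B_1<\dots<B_p$ and letting $r$ be the largest index with $A\cap B_r\ne\emptyset$, one has $B_i\subseteq A$ for all $i<r$. *)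

theory Defs
  imports "HOL-Library.FuncSet" "HOL-Library.Disjoint_Sets" "HOL-Combinatorics.Permutations"
begin

record 'a graph =
  verts :: "'a set"
  edges :: "'a set set"

definition simple_graph :: "'a graph \<Rightarrow> bool" where
  "simple_graph G \<longleftrightarrow>
     finite (verts G) \<and> (\<forall>e\<in>edges G. \<exists>u\<in>verts G. \<exists>v\<in>verts G. u \<noteq> v \<and> e = {u, v})"

definition induced :: "'a graph \<Rightarrow> 'a set \<Rightarrow> 'a graph" where
  "induced G U = \<lparr>verts = U, edges = {e \<in> edges G. e \<subseteq> U}\<rparr>"

definition I_edges :: "'a graph \<Rightarrow> 'a set \<Rightarrow> 'a set \<Rightarrow> 'a set set" where
  "I_edges G A B = {e \<in> edges G. \<exists>a\<in>A. \<exists>b\<in>B. e = {a, b}}"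

definition I_max :: "'a graph \<Rightarrow> nat \<Rightarrow> nat" where
  "I_max G m = Max ((\<lambda>S. card (I_edges G S S)) ` {S. S \<subseteq> verts G \<and> card S = m})"

definition delta :: "'a graph \<Rightarrow> nat \<Rightarrow> int" where
  "delta G m = (if m = 1 then 0 else int (I_max G m) - int (I_max G (m - 1)))"

definition delta_seq :: "'a graph \<Rightarrow> int list" where
  "delta_seq G = map (delta G) [1..<card (verts G) + 1]"

text \<open>A total order on a finite set is its ranking, a bijection onto an initial segment of the
  positive integers. The next two functions turn a strict order relation on \<open>X\<close>, respectively the
  restriction of a ranking to \<open>X\<close>, into the ranking of \<open>X\<close>.\<close>

definition ranking :: "'a set \<Rightarrow> ('a \<Rightarrow> 'a \<Rightarrow> bool) \<Rightarrow> 'a \<Rightarrow> nat" where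
  "ranking X lt x = card {y \<in> X. lt y x} + 1"

definition restrict_order :: "('a \<Rightarrow> nat) \<Rightarrow> 'a set \<Rightarrow> 'a \<Rightarrow> nat" where
  "restrict_order \<O> X = ranking X (\<lambda>u v. \<O> u < \<O> v)"

definition total_order :: "'a graph \<Rightarrow> ('a \<Rightarrow> nat) \<Rightarrow> bool" where
  "total_order G \<O> \<longleftrightarrow> bij_betw \<O> (verts G) {1..card (verts G)}"

definition interval :: "'a graph \<Rightarrow> ('a \<Rightarrow> nat) \<Rightarrow> nat \<Rightarrow> nat \<Rightarrow> 'a set" where
  "interval G \<O> k l = {v \<in> verts G. k \<le> \<O> v \<and> \<O> v \<le> l}"

definition optimal :: "'a graph \<Rightarrow> ('a \<Rightarrow> nat) \<Rightarrow> bool" where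
  "optimal G \<O> \<longleftrightarrow> total_order G \<O> \<and>
     (\<forall>k\<le>card (verts G). card (I_edges G (interval G \<O> 1 k) (interval G \<O> 1 k)) = I_max G k)"

text \<open>The parts preceding \<open>interval G \<O> a b\<close> together form \<open>interval G \<O> 1 (a - 1)\<close>.\<close>

definition isoperimetric_partition :: "'a graph \<Rightarrow> ('a \<Rightarrow> nat) \<Rightarrow> 'a set set \<Rightarrow> bool" where
  "isoperimetric_partition G \<O> P \<longleftrightarrow> partition_on (verts G) P \<and>
     (\<forall>Z\<in>P. \<exists>a b. 1 \<le> a \<and> a \<le> b \<and> b \<le> card (verts G) \<and> Z = interval G \<O> a b \<and>
        optimal (induced G Z) (restrict_order \<O> Z) \<and>
        (\<forall>v\<in>Z. int (card (I_edges G (interval G \<O> 1 (a - 1)) {v})) = delta G a))"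

definition start :: "('a \<Rightarrow> nat) \<Rightarrow> 'a set \<Rightarrow> 'a" where
  "start \<O> Z = arg_min_on \<O> Z"

definition is_first_part :: "('a \<Rightarrow> nat) \<Rightarrow> 'a set set \<Rightarrow> 'a set \<Rightarrow> bool" where
  "is_first_part \<O> P Z \<longleftrightarrow> Z \<in> P \<and> (\<forall>Z'\<in>P. \<O> (start \<O> Z) \<le> \<O> (start \<O> Z'))"

definition is_last_part :: "('a \<Rightarrow> nat) \<Rightarrow> 'a set set \<Rightarrow> 'a set \<Rightarrow> bool" where
  "is_last_part \<O> P Z \<longleftrightarrow> Z \<in> P \<and> (\<forall>Z'\<in>P. \<O> (start \<O> Z') \<le> \<O> (start \<O> Z))"

definition nondecreasing_partition :: "'a graph \<Rightarrow> 'a set set \<Rightarrow> bool" where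
  "nondecreasing_partition G P \<longleftrightarrow> (\<forall>Z\<in>P. sorted (delta_seq (induced G Z)))"

definition regular_partition :: "'a graph \<Rightarrow> ('a \<Rightarrow> nat) \<Rightarrow> 'a set set \<Rightarrow> bool" where
  "regular_partition G \<O> P \<longleftrightarrow>
     (\<forall>Z Z'. is_first_part \<O> P Z \<and> is_last_part \<O> P Z' \<longrightarrow>
        delta_seq (induced G Z) = delta_seq (induced G Z'))"

text \<open>A vertex of the product over \<open>S\<close> is a function in \<open>\<Pi>\<^sub>E i\<in>S. verts (G i)\<close>.\<close>

definition box_product :: "(nat \<Rightarrow> 'a graph) \<Rightarrow> nat set \<Rightarrow> (nat \<Rightarrow> 'a) graph" where
  "box_product G S =
     \<lparr>verts = (\<Pi>\<^sub>E i\<in>S. verts (G i)),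
      edges = {{x, y} | x y. x \<in> (\<Pi>\<^sub>E i\<in>S. verts (G i)) \<and> y \<in> (\<Pi>\<^sub>E i\<in>S. verts (G i)) \<and>
                (\<exists>i\<in>S. x i \<noteq> y i \<and> {x i, y i} \<in> edges (G i) \<and> (\<forall>j\<in>S - {i}. x j = y j))}\<rparr>"

text \<open>Points of a \<open>k\<close>-fold product of a linear order are functions of which only the values at
  \<open>1, \<dots>, k\<close> matter.\<close>

definition lex_less :: "nat \<Rightarrow> (nat \<Rightarrow> 'b::linorder) \<Rightarrow> (nat \<Rightarrow> 'b) \<Rightarrow> bool" where
  "lex_less k x y \<longleftrightarrow> (\<exists>i<k. (\<forall>j\<in>{1..i}. x j = y j) \<and> x (i + 1) < y (i + 1))"

definition dom_less :: "(nat \<Rightarrow> nat) \<Rightarrow> nat \<Rightarrow> (nat \<Rightarrow> 'b::linorder) \<Rightarrow> (nat \<Rightarrow> 'b) \<Rightarrow> bool" where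
  "dom_less p k x y \<longleftrightarrow> lex_less k (x \<circ> p) (y \<circ> p)"

text \<open>For \<open>S = {i\<^sub>1 < \<dots> < i\<^sub>k}\<close> this is the tuple of the \<open>f i\<^sub>j\<close>, \<open>1 \<le> j \<le> k\<close>.\<close>

definition tuple :: "nat set \<Rightarrow> (nat \<Rightarrow> 'b) \<Rightarrow> nat \<Rightarrow> 'b" where
  "tuple S f j = f (sorted_list_of_set S ! (j - 1))"

text \<open>A block of the product over \<open>S\<close> is given by its family of factors
  \<open>Z \<in> (\<Pi>\<^sub>E i\<in>S. P i)\<close>; as a vertex set it is \<open>PiE S Z\<close>. The permutation assigned to it is
  \<open>\<pi> S Z\<close>.\<close>

definition block_start :: "(nat \<Rightarrow> 'a \<Rightarrow> nat) \<Rightarrow> nat set \<Rightarrow> (nat \<Rightarrow> 'a set) \<Rightarrow> nat \<Rightarrow> 'a" where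
  "block_start \<O> S Z = (\<lambda>i\<in>S. start (\<O> i) (Z i))"

definition block_of :: "(nat \<Rightarrow> 'a set set) \<Rightarrow> nat set \<Rightarrow> (nat \<Rightarrow> 'a) \<Rightarrow> nat \<Rightarrow> 'a set" where
  "block_of P S x = (\<lambda>i\<in>S. THE Z. Z \<in> P i \<and> x i \<in> Z)"

type_synonym 'a perm_assignment = "nat set \<Rightarrow> (nat \<Rightarrow> 'a set) \<Rightarrow> nat \<Rightarrow> nat"

definition block_less ::
  "(nat \<Rightarrow> 'a \<Rightarrow> nat) \<Rightarrow> 'a perm_assignment \<Rightarrow> nat set \<Rightarrow> (nat \<Rightarrow> 'a set) \<Rightarrow>
     (nat \<Rightarrow> 'a) \<Rightarrow> (nat \<Rightarrow> 'a) \<Rightarrow> bool" where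
  "block_less \<O> \<pi> S Z x y \<longleftrightarrow>
     dom_less (\<pi> S Z) (card S)
       (tuple S (\<lambda>i. restrict_order (\<O> i) (Z i) (x i)))
       (tuple S (\<lambda>i. restrict_order (\<O> i) (Z i) (y i)))"

definition consistent ::
  "nat set \<Rightarrow> (nat \<Rightarrow> 'a) set \<Rightarrow> ((nat \<Rightarrow> 'a) \<Rightarrow> (nat \<Rightarrow> 'a) \<Rightarrow> bool) \<Rightarrow>
     nat set \<Rightarrow> ((nat \<Rightarrow> 'a) \<Rightarrow> (nat \<Rightarrow> 'a) \<Rightarrow> bool) \<Rightarrow> bool" where
  "consistent T X lt S lt' \<longleftrightarrow>
     (\<forall>x\<in>X. \<forall>y\<in>X. lt x y \<and> (\<forall>j\<in>T - S. x j = y j) \<longrightarrow> lt' (restrict x S) (restrict y S))"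

definition domination_collection ::
  "nat \<Rightarrow> (nat \<Rightarrow> 'a graph) \<Rightarrow> (nat \<Rightarrow> 'a \<Rightarrow> nat) \<Rightarrow> (nat \<Rightarrow> 'a set set) \<Rightarrow>
     'a perm_assignment \<Rightarrow> bool" where
  "domination_collection d G \<O> P \<pi> \<longleftrightarrow>
     (\<forall>S. S \<noteq> {} \<and> S \<subseteq> {1..d} \<longrightarrow>
        (\<forall>Z \<in> (\<Pi>\<^sub>E i\<in>S. P i).
           \<pi> S Z permutes {1..card S} \<and>
           optimal (induced (box_product G S) (PiE S Z))
             (ranking (PiE S Z) (block_less \<O> \<pi> S Z)))) \<and>
     (\<forall>S T. S \<noteq> {} \<and> S \<subset> T \<and> T \<subseteq> {1..d} \<longrightarrow>
        (\<forall>Z \<in> (\<Pi>\<^sub>E i\<in>T. P i).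
           consistent T (PiE T Z) (block_less \<O> \<pi> T Z)
             S (block_less \<O> \<pi> S (restrict Z S))))"

definition regular_domination_collection ::
  "nat \<Rightarrow> (nat \<Rightarrow> 'a graph) \<Rightarrow> (nat \<Rightarrow> 'a \<Rightarrow> nat) \<Rightarrow> (nat \<Rightarrow> 'a set set) \<Rightarrow>
     'a perm_assignment \<Rightarrow> bool" where
  "regular_domination_collection d G \<O> P \<pi> \<longleftrightarrow>
     domination_collection d G \<O> P \<pi> \<and>
     (\<forall>i\<in>{2..d - 1}. regular_partition (G i) (\<O> i) (P i)) \<and>
     (\<forall>Z \<in> (\<Pi>\<^sub>E i\<in>{2..d - 1}. P i). \<forall>Z' \<in> (\<Pi>\<^sub>E i\<in>{2..d - 1}. P i).
        (\<forall>i\<in>{2..d - 1}. is_first_part (\<O> i) (P i) (Z i) \<and> is_last_part (\<O> i) (P i) (Z' i)) \<longrightarrow>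
        \<pi> {2..d - 1} Z = \<pi> {2..d - 1} Z')"

definition BL_less ::
  "(nat \<Rightarrow> 'a \<Rightarrow> nat) \<Rightarrow> (nat \<Rightarrow> 'a set set) \<Rightarrow> 'a perm_assignment \<Rightarrow> nat set \<Rightarrow>
     (nat \<Rightarrow> 'a) \<Rightarrow> (nat \<Rightarrow> 'a) \<Rightarrow> bool" where
  "BL_less \<O> P \<pi> S x y \<longleftrightarrow>
     (if block_of P S x = block_of P S y then block_less \<O> \<pi> S (block_of P S x) x y
      else lex_less (card S)
             (tuple S (\<lambda>i. \<O> i (block_start \<O> S (block_of P S x) i)))
             (tuple S (\<lambda>i. \<O> i (block_start \<O> S (block_of P S y) i))))"

definition BL_order ::
  "(nat \<Rightarrow> 'a graph) \<Rightarrow> (nat \<Rightarrow> 'a \<Rightarrow> nat) \<Rightarrow> (nat \<Rightarrow> 'a set set) \<Rightarrow> 'a perm_assignment \<Rightarrow>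
     nat set \<Rightarrow> (nat \<Rightarrow> 'a) \<Rightarrow> nat" where
  "BL_order G \<O> P \<pi> S = ranking (verts (box_product G S)) (BL_less \<O> P \<pi> S)"

definition section_at ::
  "nat \<Rightarrow> (nat \<Rightarrow> 'a graph) \<Rightarrow> nat set \<Rightarrow> (nat \<Rightarrow> 'a) \<Rightarrow> (nat \<Rightarrow> 'a) set" where
  "section_at d G S x = {v \<in> verts (box_product G {1..d}). \<forall>i\<in>{1..d} - S. v i = x i}"

definition compression ::
  "nat \<Rightarrow> (nat \<Rightarrow> 'a graph) \<Rightarrow> nat set \<Rightarrow> ((nat \<Rightarrow> 'a) \<Rightarrow> nat) \<Rightarrow>
     (nat \<Rightarrow> 'a) set \<Rightarrow> (nat \<Rightarrow> 'a) set" where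
  "compression d G S ordS A =
     (\<Union>x\<in>verts (box_product G ({1..d} - S)).
        {v \<in> section_at d G S x. ordS (restrict v S) \<le> card (A \<inter> section_at d G S x)})"

definition strongly_compressed ::
  "nat \<Rightarrow> (nat \<Rightarrow> 'a graph) \<Rightarrow> (nat \<Rightarrow> 'a \<Rightarrow> nat) \<Rightarrow> (nat \<Rightarrow> 'a set set) \<Rightarrow>
     'a perm_assignment \<Rightarrow> (nat \<Rightarrow> 'a) set \<Rightarrow> bool" where
  "strongly_compressed d G \<O> P \<pi> A \<longleftrightarrow>
     (\<forall>S. S \<noteq> {} \<and> S \<subset> {1..d} \<longrightarrow> compression d G S (BL_order G \<O> P \<pi> S) A = A)"

text \<open>The start of the \<open>q\<close>-th part, for \<open>1 \<le> q \<le> card P\<close>.\<close>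

definition nth_start :: "('a \<Rightarrow> nat) \<Rightarrow> 'a set set \<Rightarrow> nat \<Rightarrow> 'a" where
  "nth_start \<O> P q = inv_into (start \<O> ` P) (restrict_order \<O> (start \<O> ` P)) q"

text \<open>The factor families of the blocks whose union is the \<open>q\<close>-th slice.\<close>

definition slice_blocks ::
  "nat \<Rightarrow> (nat \<Rightarrow> 'a \<Rightarrow> nat) \<Rightarrow> (nat \<Rightarrow> 'a set set) \<Rightarrow> nat \<Rightarrow> (nat \<Rightarrow> 'a set) set" where
  "slice_blocks d \<O> P q =
     {Z \<in> (\<Pi>\<^sub>E i\<in>{1..d}. P i). block_start \<O> {1..d} Z 1 = nth_start (\<O> 1) (P 1) q}"

text \<open>Below, \<open>Z\<close> is the last block of the slice that meets \<open>A\<close>; there is none if \<open>A\<close> misses the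
  slice.\<close>

definition slice_compressed ::
  "nat \<Rightarrow> (nat \<Rightarrow> 'a \<Rightarrow> nat) \<Rightarrow> (nat \<Rightarrow> 'a set set) \<Rightarrow>
     'a perm_assignment \<Rightarrow> (nat \<Rightarrow> 'a) set \<Rightarrow> bool" where
  "slice_compressed d \<O> P \<pi> A \<longleftrightarrow>
     (let before = (\<lambda>Y Z. BL_less \<O> P \<pi> {1..d} (block_start \<O> {1..d} Y) (block_start \<O> {1..d} Z))
      in \<forall>q\<in>{1..card (P 1)}. \<forall>Z\<in>slice_blocks d \<O> P q.
           A \<inter> PiE {1..d} Z \<noteq> {} \<and>
           (\<forall>Y\<in>slice_blocks d \<O> P q. before Z Y \<longrightarrow> A \<inter> PiE {1..d} Y = {}) \<longrightarrow>
           (\<forall>Y\<in>slice_blocks d \<O> P q. before Y Z \<longrightarrow> PiE {1..d} Y \<subseteq> A))"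

end

theory Submission
  imports Defs
begin

text \<open>
Let the weight of a vertex \<open>v\<close> of the product be the sum over the coordinates \<open>e\<close> of the number of
neighbours of \<open>v e\<close> in \<open>G e\<close> that precede it. A set that is compressed in every single coordinate
spans as many edges as the total weight of its vertices, so counting edges becomes summing weights.

Strong compression says that \<open>A\<close> is closed under passing to a smaller vertex of the block-lexicographic
order that shares a coordinate with the given one. Replacing \<open>A\<close> in each slice by the initial segment
of the same size preserves this: if \<open>a < b\<close> lie in one slice and share no coordinate, then raising
two coordinates of \<open>a\<close> to those of \<open>b\<close>, one of them prescribed and one that decides the comparison of
\<open>a\<close> and \<open>b\<close>, gives a vertex above \<open>a\<close> which, as \<open>d \<ge> 3\<close>, still shares a coordinate with \<open>a\<close>.

In a slice, a block \<open>Y\<close> not contained in \<open>A\<close> that precedes the last block \<open>X\<close> meeting \<open>A\<close> is its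
immediate predecessor: the two agree before a coordinate \<open>k\<close>, have consecutive parts at \<open>k\<close>, and
beyond \<open>k\<close> consist of the last and the first parts. So it suffices to move points of \<open>A\<close> from \<open>X\<close>
to \<open>Y\<close> without losing weight. For the two coordinates \<open>k, d\<close> (or \<open>1, d\<close> if \<open>k = d\<close>) this is the
optimality of the block-lexicographic order on a product of two factors; the other coordinates are added
one at a time, cutting both blocks into layers. There regularity and monotonicity of the
\<open>\<delta>\<close>-sequences say that weight is not lost when points are moved from a layer of \<open>X\<close> to the same or a
later layer of \<open>Y\<close>.
\<close>

section \<open>Initial segments of finite linear orders\<close>

text \<open>The optimality hypotheses compare sets only inside one block or inside a product of at
  most two factors, never across two blocks of the full product. In two coordinates, initial
  segments of both blocks together with everything below them may compete with a true initial
  segment only if lowering one coordinate of a point of the upper block cannot reach a missing point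
  of the lower one. Strong compression supplies this: a point of \<open>A\<close> and a smaller
  point outside \<open>A\<close> differ in every coordinate. The induction carries along the share
  of this fact that survives in layers: disagreement in the two base coordinates.

  The base pair has to contain \<open>k\<close>, since no hypothesis directly compares degrees in
  two consecutive parts, and \<open>d\<close>, since monotonicity stops at \<open>d - 1\<close> and
  regularity covers only \<open>2\<close> to \<open>d - 1\<close>.

  Inside a block, \<open>A\<close> need not be initial, because strong compression relates only
  vertices that share a coordinate. Only its layers are initial, so the step that adds a coordinate
  is proved for sets of that kind.\<close>

definition strict_linear_on :: "'b set \<Rightarrow> ('b \<Rightarrow> 'b \<Rightarrow> bool) \<Rightarrow> bool" where
  "strict_linear_on X lt \<longleftrightarrow> (\<forall>x\<in>X. \<not> lt x x) \<and>
     (\<forall>x\<in>X. \<forall>y\<in>X. \<forall>z\<in>X. lt x y \<longrightarrow> lt y z \<longrightarrow> lt x z) \<and>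
     (\<forall>x\<in>X. \<forall>y\<in>X. x \<noteq> y \<longrightarrow> lt x y \<or> lt y x)"

definition initial :: "'b set \<Rightarrow> ('b \<Rightarrow> 'b \<Rightarrow> bool) \<Rightarrow> 'b set \<Rightarrow> bool" where
  "initial X lt N \<longleftrightarrow> N \<subseteq> X \<and> (\<forall>x\<in>N. \<forall>y\<in>X. lt y x \<longrightarrow> y \<in> N)"

text \<open>Counting strict predecessors makes membership the same as
  \<open>ranking X lt x \<le> k\<close>, the condition that occurs in compressions.\<close>

definition seg :: "'b set \<Rightarrow> ('b \<Rightarrow> 'b \<Rightarrow> bool) \<Rightarrow> nat \<Rightarrow> 'b set" where
  "seg X lt k = {x \<in> X. card {y \<in> X. lt y x} < k}"

lemma strict_linear_on_subset:
  "strict_linear_on X lt \<Longrightarrow> Y \<subseteq> X \<Longrightarrow> strict_linear_on Y lt"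
  unfolding strict_linear_on_def by blast

lemma strict_linear_on_asym:
  "strict_linear_on X lt \<Longrightarrow> x \<in> X \<Longrightarrow> y \<in> X \<Longrightarrow> lt x y \<Longrightarrow> \<not> lt y x"
  unfolding strict_linear_on_def by blast

lemma card_below_less:
  assumes "finite X" "strict_linear_on X lt" "x \<in> X" "y \<in> X" "lt x y"
  shows "card {z \<in> X. lt z x} < card {z \<in> X. lt z y}"
proof (rule psubset_card_mono)
  show "finite {z \<in> X. lt z y}" using assms by simp
  have "{z \<in> X. lt z x} \<subseteq> {z \<in> X. lt z y}"
    using assms unfolding strict_linear_on_def by blast
  moreover have "x \<in> {z \<in> X. lt z y} - {z \<in> X. lt z x}"
    using assms unfolding strict_linear_on_def by blast
  ultimately show "{z \<in> X. lt z x} \<subset> {z \<in> X. lt z y}" by blast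
qed

lemma card_below_less_iff:
  assumes "finite X" "strict_linear_on X lt" "x \<in> X" "y \<in> X"
  shows "card {z \<in> X. lt z x} < card {z \<in> X. lt z y} \<longleftrightarrow> lt x y"
proof
  assume *: "card {z \<in> X. lt z x} < card {z \<in> X. lt z y}"
  show "lt x y"
  proof (rule ccontr)
    assume "\<not> lt x y"
    then have "x = y \<or> lt y x" using assms unfolding strict_linear_on_def by blast
    then show False using * card_below_less[OF assms(1,2,4,3)] by auto
  qed
qed (use card_below_less[OF assms] in blast)

lemma bij_betw_card_below:
  assumes "finite X" "strict_linear_on X lt"
  shows "bij_betw (\<lambda>x. card {y \<in> X. lt y x}) X {..<card X}"
proof -
  have inj: "inj_on (\<lambda>x. card {y \<in> X. lt y x}) X"
  proof (rule inj_onI)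
    fix x y assume xy: "x \<in> X" "y \<in> X" "card {z \<in> X. lt z x} = card {z \<in> X. lt z y}"
    then have "\<not> lt x y" "\<not> lt y x"
      using card_below_less[OF assms xy(1,2)] card_below_less[OF assms xy(2,1)] by auto
    then show "x = y" using assms xy unfolding strict_linear_on_def by blast
  qed
  moreover have "(\<lambda>x. card {y \<in> X. lt y x}) ` X \<subseteq> {..<card X}"
  proof clarsimp
    fix x assume "x \<in> X"
    then have "{y \<in> X. lt y x} \<subset> X" using assms unfolding strict_linear_on_def by blast
    then show "card {y \<in> X. lt y x} < card X" using assms(1) by (simp add: psubset_card_mono)
  qed
  ultimately show ?thesis
    unfolding bij_betw_def using card_subset_eq[OF finite_lessThan] by (simp add: card_image)
qed

lemma bij_betw_ranking:
  assumes "finite X" "strict_linear_on X lt"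
  shows "bij_betw (ranking X lt) X {1..card X}"
proof -
  have "bij_betw Suc {..<card X} {1..card X}"
    by (simp add: bij_betw_def image_Suc_lessThan)
  then have "bij_betw (Suc \<circ> (\<lambda>x. card {y \<in> X. lt y x})) X {1..card X}"
    by (rule bij_betw_trans[OF bij_betw_card_below[OF assms]])
  then show ?thesis by (simp add: ranking_def[abs_def] comp_def)
qed

lemma seg_subset: "seg X lt k \<subseteq> X"
  unfolding seg_def by blast

lemma seg_mono: "k \<le> l \<Longrightarrow> seg X lt k \<subseteq> seg X lt l"
  unfolding seg_def by auto

lemma seg_0 [simp]: "seg X lt 0 = {}"
  unfolding seg_def by simp

lemma card_seg:
  assumes "finite X" "strict_linear_on X lt" "k \<le> card X"
  shows "card (seg X lt k) = k"
proof -
  let ?r = "\<lambda>x. card {y \<in> X. lt y x}"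
  have bij: "bij_betw ?r X {..<card X}" by (rule bij_betw_card_below[OF assms(1,2)])
  have "?r ` seg X lt k = {..<k}"
  proof
    show "{..<k} \<subseteq> ?r ` seg X lt k"
    proof
      fix i assume "i \<in> {..<k}"
      then have "i \<in> ?r ` X" using bij assms(3) by (simp add: bij_betw_def)
      then show "i \<in> ?r ` seg X lt k" using \<open>i \<in> {..<k}\<close> unfolding seg_def by auto
    qed
  qed (auto simp: seg_def)
  moreover have "inj_on ?r (seg X lt k)"
    using bij seg_subset[of X lt k] by (metis bij_betw_def inj_on_subset)
  ultimately show ?thesis by (metis card_image card_lessThan)
qed

lemma initial_seg:
  assumes "finite X" "strict_linear_on X lt"
  shows "initial X lt (seg X lt k)"
  unfolding initial_def seg_def using card_below_less[OF assms] less_trans by blast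

lemma initial_eq_seg:
  assumes "finite X" "strict_linear_on X lt" "initial X lt N"
  shows "N = seg X lt (card N)"
proof -
  have NX: "N \<subseteq> X" and fN: "finite N" using assms finite_subset unfolding initial_def by auto
  have "N \<subseteq> seg X lt (card N)"
  proof
    fix x assume x: "x \<in> N"
    then have "{y \<in> X. lt y x} \<subset> N" using assms unfolding initial_def strict_linear_on_def by blast
    then show "x \<in> seg X lt (card N)"
      using psubset_card_mono[OF fN] x NX unfolding seg_def by blast
  qed
  moreover have "card (seg X lt (card N)) = card N"
    by (rule card_seg[OF assms(1,2)]) (use NX assms(1) card_mono in blast)
  moreover have "finite (seg X lt (card N))" using assms(1) seg_subset finite_subset by metis
  ultimately show ?thesis by (metis card_subset_eq)
qed

lemma seg_card:
  assumes "finite X" "strict_linear_on X lt"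
  shows "seg X lt (card X) = X"
  using initial_eq_seg[OF assms, of X] unfolding initial_def by simp

lemma initial_eqI:
  assumes "finite X" "strict_linear_on X lt" "initial X lt M" "initial X lt N" "card M = card N"
  shows "M = N"
  by (metis assms initial_eq_seg)

text \<open>Every point of an initial set lies below every point outside it, and equal sizes make
  \<open>M - N\<close> and \<open>N - M\<close> equally large, so one is nonempty as soon as the
  other is.\<close>

lemma initial_exchange:
  assumes "finite X" "strict_linear_on X lt" "initial X lt N" "M \<subseteq> X" "card M = card N"
  shows "b \<in> M - N \<Longrightarrow> \<exists>a\<in>N - M. lt a b"
    and "a \<in> N - M \<Longrightarrow> \<exists>b\<in>M - N. lt a b"
proof -
  have fin: "finite M" "finite N" using assms finite_subset unfolding initial_def by auto
  have key: "lt a b" if "a \<in> N" "b \<in> X - N" for a b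
    using that assms(2,3) unfolding initial_def strict_linear_on_def
    by (metis DiffD1 DiffD2 subsetD)
  have c: "card (M - N) = card (N - M)"
    using assms(5) fin
    by (metis add_left_cancel card_Diff_subset_Int finite_Int inf_commute)
  show "\<exists>a\<in>N - M. lt a b" if b: "b \<in> M - N"
  proof -
    have "card (N - M) > 0" using c b fin by (metis card_gt_0_iff empty_iff finite_Diff)
    then obtain a where "a \<in> N - M" by (metis card_gt_0_iff ex_in_conv)
    then show ?thesis using key[of a b] b assms(4) by blast
  qed
  show "\<exists>b\<in>M - N. lt a b" if a: "a \<in> N - M"
  proof -
    have "card (M - N) > 0" using c a fin by (metis card_gt_0_iff empty_iff finite_Diff)
    then obtain b where "b \<in> M - N" by (metis card_gt_0_iff ex_in_conv)
    then show ?thesis using key[of a b] a assms(4) by blast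
  qed
qed

text \<open>In the next two lemmas layer \<open>u\<close> of the lower block holds \<open>m u\<close> of at most \<open>y\<close> points and
  layer \<open>u\<close> of the upper block holds \<open>n u\<close> points.\<close>

definition redistribution ::
  "nat \<Rightarrow> nat \<Rightarrow> (nat \<Rightarrow> nat) \<Rightarrow> (nat \<Rightarrow> nat) \<Rightarrow> (nat \<Rightarrow> nat) \<Rightarrow> (nat \<Rightarrow> nat) \<Rightarrow>
     (nat \<Rightarrow> nat) \<Rightarrow> (nat \<Rightarrow> nat) \<Rightarrow> (nat \<Rightarrow> nat) \<Rightarrow> (nat \<Rightarrow> nat) \<Rightarrow> bool" where
  "redistribution z y GY GX \<phi> \<psi> m n m' n' \<longleftrightarrow>
     (\<forall>u\<in>{1..z}. m' u \<le> y \<and> n' u \<le> n u) \<and>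
     (\<forall>u v. 1 \<le> u \<and> u \<le> v \<and> v \<le> z \<longrightarrow> m' v \<le> m' u \<and> n' v \<le> n' u) \<and>
     (\<Sum>u\<in>{1..z}. m' u + n' u) = (\<Sum>u\<in>{1..z}. m u + n u) \<and>
     ((\<forall>u\<in>{1..z}. n' u = 0) \<or> (\<forall>u\<in>{1..z}. m' u = y)) \<and>
     (\<Sum>u\<in>{1..z}. GY (m u) + \<phi> u * m u + GX (n u) + \<psi> u * n u) \<le>
     (\<Sum>u\<in>{1..z}. GY (m' u) + \<phi> u * m' u + GX (n' u) + \<psi> u * n' u)"

text \<open>The last assumption describes the state after every layer has been filled from its own
  counterpart. Then all remaining points of the upper block sit in layers that precede the deficient
  layers of the lower block, so each move goes to a later layer, where \<open>\<phi>_mono\<close>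
  and \<open>\<psi>_le\<close> make the weight of the new coordinate at least as large. The licence
  \<open>R\<close> for using \<open>gain\<close> is never lost, since lower layers only grow and
  upper layers only shrink.\<close>

lemma shift_disjoint_layers:
  fixes GY GX \<phi> \<psi> m n :: "nat \<Rightarrow> nat"
  assumes gain: "\<And>a b. a \<le> y \<Longrightarrow> R a b \<Longrightarrow>
      GY a + GX b \<le> GY (a + min b (y - a)) + GX (b - min b (y - a))"
    and R_mono: "\<And>a b a' b'. R a b \<Longrightarrow> a \<le> a' \<Longrightarrow> b' \<le> b \<Longrightarrow> R a' b'"
    and \<phi>_mono: "\<And>u v. 1 \<le> u \<Longrightarrow> u \<le> v \<Longrightarrow> v \<le> z \<Longrightarrow> \<phi> u \<le> \<phi> v"
    and \<psi>_le: "\<And>u. 1 \<le> u \<Longrightarrow> u \<le> z \<Longrightarrow> \<psi> u \<le> \<phi> u"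
    and "\<And>u. u \<in> {1..z} \<Longrightarrow> m u \<le> y"
    and "\<And>u v. 1 \<le> u \<Longrightarrow> u \<le> v \<Longrightarrow> v \<le> z \<Longrightarrow> m v \<le> m u"
    and "\<And>u v. 1 \<le> u \<Longrightarrow> u \<le> v \<Longrightarrow> v \<le> z \<Longrightarrow> n v \<le> n u"
    and "\<And>u v. u \<in> {1..z} \<Longrightarrow> v \<in> {1..z} \<Longrightarrow> R (m u) (n v)"
    and "\<And>u. u \<in> {1..z} \<Longrightarrow> n u > 0 \<Longrightarrow> m u = y"
  shows "\<exists>m' n'. redistribution z y GY GX \<phi> \<psi> m n m' n'"
  using assms(5-9)
proof (induction "\<Sum>u\<in>{1..z}. n u" arbitrary: m n rule: less_induct)
  case less
  show ?case
  proof (cases "(\<forall>u\<in>{1..z}. n u = 0) \<or> (\<forall>u\<in>{1..z}. m u = y)")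
    case True
    moreover have "\<forall>u v. 1 \<le> u \<and> u \<le> v \<and> v \<le> z \<longrightarrow> m v \<le> m u \<and> n v \<le> n u"
      using less.prems(2,3) by meson
    moreover have "\<forall>u\<in>{1..z}. m u \<le> y \<and> n u \<le> n u" using less.prems(1) by simp
    ultimately have "redistribution z y GY GX \<phi> \<psi> m n m n"
      unfolding redistribution_def by blast
    then show ?thesis by blast
  next
    case False
    define U where "U = {u \<in> {1..z}. n u > 0}"
    define W where "W = {u \<in> {1..z}. m u < y}"
    have "finite U" "finite W" unfolding U_def W_def by auto
    have "U \<noteq> {}" using False unfolding U_def by auto
    obtain w where "w \<in> {1..z}" "m w \<noteq> y" using False by blast
    then have "w \<in> W" using less.prems(1)[of w] unfolding W_def by simp
    then have "W \<noteq> {}" by blast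
    \<comment> \<open>Taking from the last nonempty upper layer and giving to the first deficient
      lower layer is what keeps both sequences nonincreasing.\<close>
    define u where "u = Max U"
    define v where "v = Min W"
    have uU: "u \<in> U" and vW: "v \<in> W"
      using Max_in[OF \<open>finite U\<close> \<open>U \<noteq> {}\<close>] Min_in[OF \<open>finite W\<close> \<open>W \<noteq> {}\<close>]
      unfolding u_def v_def by auto
    then have uz: "u \<in> {1..z}" "n u > 0" and vz: "v \<in> {1..z}" "m v < y"
      unfolding U_def W_def by auto
    have u_max: "n w = 0" if "w \<in> {1..z}" "u < w" for w
    proof (rule ccontr)
      assume "n w \<noteq> 0"
      then have "w \<le> u" unfolding u_def by (intro Max_ge \<open>finite U\<close>) (use that in \<open>simp add: U_def\<close>)
      then show False using that by simp
    qed
    have v_min: "m w = y" if "w \<in> {1..z}" "w < v" for w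
    proof (rule ccontr)
      assume "m w \<noteq> y"
      then have "w \<in> W" using that less.prems(1)[of w] unfolding W_def by simp
      then have "v \<le> w" unfolding v_def by (intro Min_le \<open>finite W\<close>)
      then show False using that by simp
    qed
    have mu: "m u = y" using less.prems(5) uz by blast
    have uv: "u < v"
    proof (rule ccontr)
      assume "\<not> u < v"
      then have "m u \<le> m v" using less.prems(2) uz vz by auto
      then show False using mu vz by simp
    qed
    have nv: "n v = 0" using u_max vz uv by simp
    define s where "s = min (n u) (y - m v)"
    have s0: "s > 0" "s \<le> n u" "s \<le> y - m v" using uz vz unfolding s_def by auto
    define m1 where "m1 = m(v := m v + s)"
    define n1 where "n1 = n(u := n u - s)"
    have m1_simps: "m1 u = m u" "m1 v = m v + s" "n1 u = n u - s" "n1 v = n v"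
      using uv unfolding m1_def n1_def by auto
    have rest: "m1 w = m w \<and> n1 w = n w" if "w \<noteq> u" "w \<noteq> v" for w
      using that unfolding m1_def n1_def by auto
    have le: "m w \<le> m1 w" "n1 w \<le> n w" for w unfolding m1_def n1_def by auto
    have split: "(\<Sum>w\<in>{1..z}. h w) = h u + h v + (\<Sum>w\<in>{1..z} - {u, v}. h w)" for h :: "nat \<Rightarrow> nat"
    proof -
      have "{1..z} - {u, v} = {1..z} - {u} - {v}" by auto
      then show ?thesis
        using sum.remove[of "{1..z}" u h] sum.remove[of "{1..z} - {u}" v h] uz vz uv by simp
    qed
    have sum_rest: "(\<Sum>w\<in>{1..z} - {u, v}. h (m1 w) (n1 w) w) = (\<Sum>w\<in>{1..z} - {u, v}. h (m w) (n w) w)"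
      for h :: "nat \<Rightarrow> nat \<Rightarrow> nat \<Rightarrow> nat"
      by (rule sum.cong) (use rest in auto)
    have dec: "(\<Sum>w\<in>{1..z}. n1 w) < (\<Sum>w\<in>{1..z}. n w)"
      unfolding split[of n1] split[of n] using sum_rest[of "\<lambda>a b c. b"] m1_simps s0 by simp
    have tot: "(\<Sum>w\<in>{1..z}. m1 w + n1 w) = (\<Sum>w\<in>{1..z}. m w + n w)"
      unfolding split[of "\<lambda>w. m1 w + n1 w"] split[of "\<lambda>w. m w + n w"]
      using sum_rest[of "\<lambda>a b c. a + b"] m1_simps s0 by simp
    have g: "GY (m v) + GX (n u) \<le> GY (m v + s) + GX (n u - s)"
      using gain[of "m v" "n u"] less.prems(4) uz vz unfolding s_def by auto
    have "\<psi> u \<le> \<phi> v" using \<psi>_le[of u] \<phi>_mono[of u v] uz vz uv by auto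
    then have "\<psi> u * s \<le> \<phi> v * s" by (rule mult_right_mono) simp
    moreover have "\<psi> u * n u = \<psi> u * (n u - s) + \<psi> u * s"
      using s0 by (metis add_mult_distrib2 le_add_diff_inverse2)
    ultimately have val: "(\<Sum>w\<in>{1..z}. GY (m w) + \<phi> w * m w + GX (n w) + \<psi> w * n w) \<le>
        (\<Sum>w\<in>{1..z}. GY (m1 w) + \<phi> w * m1 w + GX (n1 w) + \<psi> w * n1 w)"
      unfolding split[of "\<lambda>w. GY (m1 w) + \<phi> w * m1 w + GX (n1 w) + \<psi> w * n1 w"]
        split[of "\<lambda>w. GY (m w) + \<phi> w * m w + GX (n w) + \<psi> w * n w"]
      using sum_rest[of "\<lambda>a b c. GY a + \<phi> c * a + GX b + \<psi> c * b"] g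
      unfolding m1_simps add_mult_distrib2 by linarith
    have p1: "\<And>w. w \<in> {1..z} \<Longrightarrow> m1 w \<le> y"
      using less.prems(1) s0 unfolding m1_def by auto
    \<comment> \<open>Only the entry at \<open>v\<close> has been raised, and every layer before
      \<open>v\<close> is already full.\<close>
    have p2: "m1 b \<le> m1 a" if "1 \<le> a" "a \<le> b" "b \<le> z" for a b
    proof (cases "b = v \<and> a \<noteq> v")
      case True
      then have "m a = y" using v_min that by auto
      then show ?thesis using p1[of b] le(1)[of a] that by auto
    next
      case False
      then show ?thesis using less.prems(2)[OF that] that le(1)[of a] unfolding m1_def by auto
    qed
    have p3: "n1 b \<le> n1 a" if "1 \<le> a" "a \<le> b" "b \<le> z" for a b
    proof (cases "a = u \<and> b \<noteq> u")
      case True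
      then have "n b = 0" using u_max that by auto
      then show ?thesis using le(2)[of b] by simp
    next
      case False
      then show ?thesis using less.prems(3)[OF that] that le(2)[of b] unfolding n1_def by auto
    qed
    have p4: "\<And>a b. a \<in> {1..z} \<Longrightarrow> b \<in> {1..z} \<Longrightarrow> R (m1 a) (n1 b)"
      using R_mono[OF less.prems(4)] le by blast
    have p5: "m1 w = y" if "w \<in> {1..z}" "n1 w > 0" for w
    proof -
      have "n w > 0" using le(2)[of w] that by simp
      then have "m w = y" using less.prems(5) that by blast
      then show ?thesis using le(1)[of w] p1[of w] that by simp
    qed
    have "\<exists>m' n'. redistribution z y GY GX \<phi> \<psi> m1 n1 m' n'"
      by (rule less.hyps[OF dec]) (fact p1 p2 p3 p4 p5)+
    then obtain m' n' where *: "redistribution z y GY GX \<phi> \<psi> m1 n1 m' n'" by blast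
    have "redistribution z y GY GX \<phi> \<psi> m n m' n'"
      using * tot val le(2) order_trans unfolding redistribution_def by (smt (verit))
    then show ?thesis by blast
  qed
qed

text \<open>A move within layer \<open>u\<close> costs nothing by \<open>\<psi>_le\<close>. It
  leaves the layer full below or empty above, which is the situation of the preceding lemma.\<close>

lemma shift_layers:
  fixes GY GX \<phi> \<psi> m n :: "nat \<Rightarrow> nat"
  assumes gain: "\<And>a b. a \<le> y \<Longrightarrow> R a b \<Longrightarrow>
      GY a + GX b \<le> GY (a + min b (y - a)) + GX (b - min b (y - a))"
    and R_mono: "\<And>a b a' b'. R a b \<Longrightarrow> a \<le> a' \<Longrightarrow> b' \<le> b \<Longrightarrow> R a' b'"
    and \<phi>_mono: "\<And>u v. 1 \<le> u \<Longrightarrow> u \<le> v \<Longrightarrow> v \<le> z \<Longrightarrow> \<phi> u \<le> \<phi> v"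
    and \<psi>_le: "\<And>u. 1 \<le> u \<Longrightarrow> u \<le> z \<Longrightarrow> \<psi> u \<le> \<phi> u"
    and m_le: "\<And>u. u \<in> {1..z} \<Longrightarrow> m u \<le> y"
    and m_dec: "\<And>u v. 1 \<le> u \<Longrightarrow> u \<le> v \<Longrightarrow> v \<le> z \<Longrightarrow> m v \<le> m u"
    and n_dec: "\<And>u v. 1 \<le> u \<Longrightarrow> u \<le> v \<Longrightarrow> v \<le> z \<Longrightarrow> n v \<le> n u"
    and R: "\<And>u v. u \<in> {1..z} \<Longrightarrow> v \<in> {1..z} \<Longrightarrow> R (m u) (n v)"
  shows "\<exists>m' n'. redistribution z y GY GX \<phi> \<psi> m n m' n'"
proof -
  \<comment> \<open>As much as fits: the new sizes are the minimum of \<open>m u + n u\<close> and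
    \<open>y\<close>, and the excess over \<open>y\<close>. Both are nonincreasing because
    \<open>m u + n u\<close> is.\<close>
  define s where "s u = min (n u) (y - m u)" for u
  define m1 where "m1 u = m u + s u" for u
  define n1 where "n1 u = n u - s u" for u
  have tot: "(\<Sum>u\<in>{1..z}. m1 u + n1 u) = (\<Sum>u\<in>{1..z}. m u + n u)"
    by (rule sum.cong) (auto simp: m1_def n1_def s_def)
  have val: "(\<Sum>u\<in>{1..z}. GY (m u) + \<phi> u * m u + GX (n u) + \<psi> u * n u) \<le>
     (\<Sum>u\<in>{1..z}. GY (m1 u) + \<phi> u * m1 u + GX (n1 u) + \<psi> u * n1 u)"
  proof (rule sum_mono)
    fix u assume u: "u \<in> {1..z}"
    have "GY (m u) + GX (n u) \<le> GY (m1 u) + GX (n1 u)"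
      using gain[OF m_le[OF u] R[OF u u]] unfolding m1_def n1_def s_def by simp
    moreover have "\<psi> u * s u \<le> \<phi> u * s u" by (rule mult_right_mono) (use \<psi>_le[of u] u in auto)
    moreover have "\<psi> u * n u = \<psi> u * n1 u + \<psi> u * s u"
      unfolding n1_def s_def by (metis add_mult_distrib2 le_add_diff_inverse2 min.cobounded1)
    ultimately show "GY (m u) + \<phi> u * m u + GX (n u) + \<psi> u * n u \<le>
        GY (m1 u) + \<phi> u * m1 u + GX (n1 u) + \<psi> u * n1 u"
      unfolding m1_def add_mult_distrib2 by linarith
  qed
  have m1_dec: "m1 v \<le> m1 u" and n1_dec: "n1 v \<le> n1 u" if "1 \<le> u" "u \<le> v" "v \<le> z" for u v
    using m_dec[OF that] n_dec[OF that] m_le[of u] that unfolding m1_def n1_def s_def by auto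
  have p1: "\<And>u. u \<in> {1..z} \<Longrightarrow> m1 u \<le> y"
    using m_le unfolding m1_def s_def by fastforce
  have p4: "R (m1 u) (n1 v)" if "u \<in> {1..z}" "v \<in> {1..z}" for u v
    by (rule R_mono[OF R[OF that]]) (auto simp: m1_def n1_def)
  have p5: "\<And>u. u \<in> {1..z} \<Longrightarrow> n1 u > 0 \<Longrightarrow> m1 u = y"
    using m_le unfolding m1_def n1_def s_def by fastforce
  have "\<exists>m' n'. redistribution z y GY GX \<phi> \<psi> m1 n1 m' n'"
    by (rule shift_disjoint_layers[where R = R])
      (fact gain R_mono \<phi>_mono \<psi>_le p1 m1_dec n1_dec p4 p5)+
  then obtain m' n' where *: "redistribution z y GY GX \<phi> \<psi> m1 n1 m' n'" by blast
  have "n1 u \<le> n u" for u unfolding n1_def by simp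
  then have "redistribution z y GY GX \<phi> \<psi> m n m' n'"
    using * tot val order_trans unfolding redistribution_def by (smt (verit))
  then show ?thesis by blast
qed

lemma strict_linear_on_max:
  assumes "finite X" "X \<noteq> {}" "strict_linear_on X lt"
  shows "\<exists>x\<in>X. \<forall>y\<in>X. y \<noteq> x \<longrightarrow> lt y x"
proof -
  let ?r = "\<lambda>x. card {y \<in> X. lt y x}"
  have "Max (?r ` X) \<in> ?r ` X" using assms by (intro Max_in) auto
  then obtain x where x: "x \<in> X" "?r x = Max (?r ` X)" by auto
  have "lt y x" if y: "y \<in> X" "y \<noteq> x" for y
  proof (rule ccontr)
    assume "\<not> lt y x"
    then have "lt x y" using assms(3) x(1) y unfolding strict_linear_on_def by blast
    then have "?r x < ?r y" by (rule card_below_less[OF assms(1,3) x(1) y(1)])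
    moreover have "?r y \<le> Max (?r ` X)" using assms(1) y(1) by (intro Max_ge) auto
    ultimately show False using x(2) by simp
  qed
  then show ?thesis using x(1) by blast
qed

section \<open>Products of partitioned orders\<close>

text \<open>The lexicographic order on the coordinates in \<open>T\<close>, stated without numbering
  them, so that passing to a subset of \<open>T\<close> needs no renumbering.\<close>

definition key_less :: "nat set \<Rightarrow> (nat \<Rightarrow> nat) \<Rightarrow> (nat \<Rightarrow> nat) \<Rightarrow> bool" where
  "key_less T s t \<longleftrightarrow> (\<exists>k\<in>T. (\<forall>e\<in>T. e < k \<longrightarrow> s e = t e) \<and> s k < t k)"

lemma key_lessI: "k \<in> T \<Longrightarrow> (\<And>e. e \<in> T \<Longrightarrow> e < k \<Longrightarrow> s e = t e) \<Longrightarrow> s k < t k \<Longrightarrow> key_less T s t"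
  unfolding key_less_def by blast

lemma key_less_irrefl: "(\<And>e. e \<in> T \<Longrightarrow> s e = t e) \<Longrightarrow> \<not> key_less T s t"
  unfolding key_less_def by fastforce

lemma key_less_trans:
  assumes "key_less T s t" "key_less T t r"
  shows "key_less T s r"
proof -
  obtain k l where k: "k \<in> T" "\<And>e. e \<in> T \<Longrightarrow> e < k \<Longrightarrow> s e = t e" "s k < t k"
    and l: "l \<in> T" "\<And>e. e \<in> T \<Longrightarrow> e < l \<Longrightarrow> t e = r e" "t l < r l"
    using assms unfolding key_less_def by blast
  show ?thesis
  proof (rule key_lessI[where k = "min k l"])
    show "min k l \<in> T" using k l by (simp add: min_def)
    show "s e = r e" if "e \<in> T" "e < min k l" for e using that k(2) l(2) by simp
    show "s (min k l) < r (min k l)"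
      using k l by (cases k l rule: linorder_cases) (auto simp: min_def)
  qed
qed

lemma key_less_total:
  assumes "finite T" "e \<in> T" "s e \<noteq> t e"
  shows "key_less T s t \<or> key_less T t s"
proof -
  define K where "K = {e \<in> T. s e \<noteq> t e}"
  have K: "finite K" "K \<noteq> {}" using assms unfolding K_def by auto
  have "Min K \<in> T" "s (Min K) \<noteq> t (Min K)" using Min_in[OF K] unfolding K_def by auto
  moreover have "s e = t e" if "e \<in> T" "e < Min K" for e
    using Min_le[OF K(1), of e] that unfolding K_def by fastforce
  ultimately show ?thesis unfolding key_less_def by (metis linorder_neqE_nat)
qed

lemma key_less_cong:
  "(\<And>e. e \<in> T \<Longrightarrow> s e = s' e) \<Longrightarrow> (\<And>e. e \<in> T \<Longrightarrow> t e = t' e) \<Longrightarrow> key_less T s t = key_less T s' t'"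
  unfolding key_less_def by simp

lemma key_less_pair:
  "i < j \<Longrightarrow> key_less {i, j} s t \<longleftrightarrow> s i < t i \<or> s i = t i \<and> s j < t j"
  unfolding key_less_def by auto

text \<open>These are the properties of the block-lexicographic orders that the argument relies on.
  \<open>st e v\<close> stands for the rank of the start of the part containing \<open>v\<close>,
  and \<open>f e v\<close> for the number of earlier neighbours of \<open>v\<close>.
  \<open>L_restrict\<close> is consistency, and \<open>L_first\<close> says that inside a block one
  coordinate has top priority.\<close>

locale block_system =
  fixes d :: nat
    and V :: "nat \<Rightarrow> 'a set"
    and ord :: "nat \<Rightarrow> 'a \<Rightarrow> nat"
    and st :: "nat \<Rightarrow> 'a \<Rightarrow> nat"
    and L :: "nat set \<Rightarrow> (nat \<Rightarrow> 'a) \<Rightarrow> (nat \<Rightarrow> 'a) \<Rightarrow> bool"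
    and f :: "nat \<Rightarrow> 'a \<Rightarrow> nat"
  assumes d3: "3 \<le> d"
    and fin_V: "e \<in> {1..d} \<Longrightarrow> finite (V e)"
    and inj_ord: "e \<in> {1..d} \<Longrightarrow> inj_on (ord e) (V e)"
    and linear: "T \<noteq> {} \<Longrightarrow> T \<subseteq> {1..d} \<Longrightarrow> strict_linear_on (PiE T V) (L T)"
    and L_restrict: "S \<noteq> {} \<Longrightarrow> S \<subseteq> T \<Longrightarrow> T \<subseteq> {1..d} \<Longrightarrow> x \<in> PiE T V \<Longrightarrow> y \<in> PiE T V \<Longrightarrow>
          (\<And>e. e \<in> T - S \<Longrightarrow> x e = y e) \<Longrightarrow> L T x y \<Longrightarrow> L S (restrict x S) (restrict y S)"
    and L_key: "T \<subseteq> {1..d} \<Longrightarrow> x \<in> PiE T V \<Longrightarrow> y \<in> PiE T V \<Longrightarrow>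
          key_less T (\<lambda>e. st e (x e)) (\<lambda>e. st e (y e)) \<Longrightarrow> L T x y"
    and L_coord: "T \<subseteq> {1..d} \<Longrightarrow> x \<in> PiE T V \<Longrightarrow> e \<in> T \<Longrightarrow> u \<in> V e \<Longrightarrow> ord e u < ord e (x e) \<Longrightarrow>
          L T (x(e := u)) x"
    and L_first: "z \<in> PiE {1..d} V \<Longrightarrow> \<exists>k\<in>{1..d}. \<forall>x\<in>PiE {1..d} V. \<forall>y\<in>PiE {1..d} V.
          (\<forall>e\<in>{1..d}. st e (x e) = st e (z e) \<and> st e (y e) = st e (z e)) \<longrightarrow>
          ord k (x k) < ord k (y k) \<longrightarrow> L {1..d} x y"
begin

definition part :: "nat \<Rightarrow> nat \<Rightarrow> 'a set" where
  "part e c = {v \<in> V e. st e v = c}"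

definition block :: "nat set \<Rightarrow> (nat \<Rightarrow> nat) \<Rightarrow> (nat \<Rightarrow> 'a) set" where
  "block T c = (\<Pi>\<^sub>E e\<in>T. part e (c e))"

definition key :: "(nat \<Rightarrow> 'a) \<Rightarrow> nat \<Rightarrow> nat" where
  "key x e = st e (x e)"

definition down_closed :: "nat set \<Rightarrow> (nat \<Rightarrow> 'a) set \<Rightarrow> (nat \<Rightarrow> 'a) set \<Rightarrow> bool" where
  "down_closed T X M \<longleftrightarrow> M \<subseteq> X \<and>
     (\<forall>x\<in>M. \<forall>e\<in>T. \<forall>u\<in>V e. ord e u < ord e (x e) \<longrightarrow> x(e := u) \<in> X \<longrightarrow> x(e := u) \<in> M)"

definition weight :: "nat set \<Rightarrow> (nat \<Rightarrow> 'a) set \<Rightarrow> nat" where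
  "weight T M = (\<Sum>x\<in>M. \<Sum>e\<in>T. f e (x e))"

definition slice :: "nat \<Rightarrow> (nat \<Rightarrow> 'a) set" where
  "slice c = {x \<in> PiE {1..d} V. st 1 (x 1) = c}"

definition strongly_closed :: "(nat \<Rightarrow> 'a) set \<Rightarrow> bool" where
  "strongly_closed A \<longleftrightarrow> A \<subseteq> PiE {1..d} V \<and>
     (\<forall>x\<in>A. \<forall>y\<in>PiE {1..d} V. L {1..d} y x \<longrightarrow> (\<exists>e\<in>{1..d}. y e = x e) \<longrightarrow> y \<in> A)"

definition slice_fill :: "(nat \<Rightarrow> 'a) set \<Rightarrow> (nat \<Rightarrow> 'a) set" where
  "slice_fill A = {x \<in> PiE {1..d} V.
     x \<in> seg (slice (st 1 (x 1))) (L {1..d}) (card (A \<inter> slice (st 1 (x 1))))}"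

lemma one_le_d: "1 \<in> {1..d}" using d3 by simp

lemma fin_PiE: "T \<subseteq> {1..d} \<Longrightarrow> finite (PiE T V)"
  using fin_V by (intro finite_PiE) (auto intro: finite_subset)

lemma asym:
  "T \<noteq> {} \<Longrightarrow> T \<subseteq> {1..d} \<Longrightarrow> x \<in> PiE T V \<Longrightarrow> y \<in> PiE T V \<Longrightarrow> L T x y \<Longrightarrow> \<not> L T y x"
  by (rule strict_linear_on_asym[OF linear])

lemma L_total:
  "T \<noteq> {} \<Longrightarrow> T \<subseteq> {1..d} \<Longrightarrow> x \<in> PiE T V \<Longrightarrow> y \<in> PiE T V \<Longrightarrow> x \<noteq> y \<Longrightarrow> L T x y \<or> L T y x"
  using linear[of T] unfolding strict_linear_on_def by blast

lemma L_key':
  "T \<subseteq> {1..d} \<Longrightarrow> x \<in> PiE T V \<Longrightarrow> y \<in> PiE T V \<Longrightarrow> key_less T (key x) (key y) \<Longrightarrow> L T x y"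
  using L_key by (simp add: key_def[abs_def])

lemma L_iff_key_less:
  assumes "T \<subseteq> {1..d}" "x \<in> PiE T V" "y \<in> PiE T V" "e \<in> T" "key x e \<noteq> key y e"
  shows "L T x y \<longleftrightarrow> key_less T (key x) (key y)"
proof
  assume "L T x y"
  then have "\<not> key_less T (key y) (key x)"
    using asym[OF _ assms(1-3)] L_key'[OF assms(1,3,2)] assms(4) by blast
  moreover have "finite T" using assms(1) finite_subset by auto
  ultimately show "key_less T (key x) (key y)"
    using key_less_total[of T e "key x" "key y"] assms(4,5) by blast
qed (use L_key' assms in blast)

text \<open>Consistency is an implication; totality on \<open>T\<close> together with asymmetry on
  \<open>S\<close> turns it into an equivalence.\<close>

lemma L_restrict_iff:
  assumes "S \<noteq> {}" "S \<subseteq> T" "T \<subseteq> {1..d}" "x \<in> PiE T V" "y \<in> PiE T V"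
    "\<And>e. e \<in> T - S \<Longrightarrow> x e = y e"
  shows "L T x y \<longleftrightarrow> L S (restrict x S) (restrict y S)"
proof
  assume L: "L S (restrict x S) (restrict y S)"
  have S: "S \<subseteq> {1..d}" and T: "T \<noteq> {}" using assms by auto
  have r: "restrict x S \<in> PiE S V" "restrict y S \<in> PiE S V" using assms by auto
  have "restrict x S \<noteq> restrict y S" using L linear[OF assms(1) S] r unfolding strict_linear_on_def by metis
  then have "x \<noteq> y" by auto
  moreover have "\<not> L T y x"
  proof
    assume "L T y x"
    then have "L S (restrict y S) (restrict x S)"
      using L_restrict[OF assms(1-3,5,4)] assms(6) by metis
    then show False using L asym[OF assms(1) S] r by blast
  qed
  ultimately show "L T x y" using L_total[OF T assms(3-5)] by blast
qed (use L_restrict[OF assms(1-5)] assms(6) in blast)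

lemma down_closed_initial:
  assumes "T \<subseteq> {1..d}" "X \<subseteq> PiE T V" "initial X (L T) N"
  shows "down_closed T X N"
  using assms L_coord[OF assms(1)] unfolding down_closed_def initial_def by blast

lemma part_subset: "part e c \<subseteq> V e" unfolding part_def by blast

lemma block_subset: "block T c \<subseteq> PiE T V"
  unfolding block_def using part_subset by (intro PiE_mono) auto

lemma mem_block_iff: "x \<in> block T c \<longleftrightarrow> x \<in> PiE T V \<and> (\<forall>e\<in>T. key x e = c e)"
  unfolding block_def part_def key_def PiE_def Pi_def by auto

lemma update_PiE: "x \<in> PiE T V \<Longrightarrow> e \<in> T \<Longrightarrow> u \<in> V e \<Longrightarrow> x(e := u) \<in> PiE T V"
  by (auto simp: PiE_iff extensional_def)

lemma update2_PiE:
  "x \<in> PiE T V \<Longrightarrow> y \<in> PiE T V \<Longrightarrow> k \<in> T \<Longrightarrow> j \<in> T \<Longrightarrow> x(k := y k, j := y j) \<in> PiE T V"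
  by (metis update_PiE PiE_mem)

section \<open>Slices and their filling by initial segments\<close>

lemma slice_subset: "slice c \<subseteq> PiE {1..d} V"
  unfolding slice_def by blast

lemma fin_slice: "finite (slice c)"
  using finite_subset[OF slice_subset fin_PiE] by blast

lemma linear_slice: "strict_linear_on (slice c) (L {1..d})"
  using strict_linear_on_subset[OF linear slice_subset] one_le_d by blast

text \<open>The choice of \<open>k\<close> does not depend on \<open>j\<close>. If the blocks of
  \<open>a\<close> and \<open>b\<close> differ, \<open>k\<close> is the first coordinate where their
  parts differ; altering \<open>j\<close> as well does no harm, since before \<open>k\<close> the
  parts agree. In a common block \<open>k\<close> is the coordinate of top priority, where
  \<open>a\<close> and \<open>b\<close> differ by assumption, so it alone decides.\<close>

lemma deciding_coordinate:
  assumes a: "a \<in> PiE {1..d} V" and b: "b \<in> PiE {1..d} V" and ab: "L {1..d} a b"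
    and ne: "\<And>e. e \<in> {1..d} \<Longrightarrow> a e \<noteq> b e" and j: "j \<in> {1..d}"
  shows "\<exists>k\<in>{1..d}. L {1..d} a (a(k := b k, j := b j)) \<and> L {1..d} (b(k := a k, j := a j)) b"
proof -
  have mem: "a(k := b k, j := b j) \<in> PiE {1..d} V" "b(k := a k, j := a j) \<in> PiE {1..d} V"
    if "k \<in> {1..d}" for k
    by (rule update2_PiE[OF a b that j], rule update2_PiE[OF b a that j])
  show ?thesis
  proof (cases "\<exists>e\<in>{1..d}. key a e \<noteq> key b e")
    case True
    then have "key_less {1..d} (key a) (key b)"
      using L_iff_key_less[OF subset_refl a b] ab by blast
    then obtain k where k: "k \<in> {1..d}" "\<And>e. e \<in> {1..d} \<Longrightarrow> e < k \<Longrightarrow> key a e = key b e"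
      "key a k < key b k"
      unfolding key_less_def by blast
    have "key_less {1..d} (key a) (key (a(k := b k, j := b j)))"
      by (rule key_lessI[OF k(1)]) (use k j in \<open>auto simp: key_def\<close>)
    moreover have "key_less {1..d} (key (b(k := a k, j := a j))) (key b)"
      by (rule key_lessI[OF k(1)]) (use k j in \<open>auto simp: key_def\<close>)
    ultimately show ?thesis
      using L_key'[OF subset_refl a mem(1)[OF k(1)]] L_key'[OF subset_refl mem(2)[OF k(1)] b] k(1)
      by blast
  next
    case False
    then have same: "\<And>e. e \<in> {1..d} \<Longrightarrow> st e (a e) = st e (b e)" by (auto simp: key_def)
    obtain k where k: "k \<in> {1..d}" "\<And>x y. x \<in> PiE {1..d} V \<Longrightarrow> y \<in> PiE {1..d} V \<Longrightarrow>
        (\<forall>e\<in>{1..d}. st e (x e) = st e (a e) \<and> st e (y e) = st e (a e)) \<Longrightarrow>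
        ord k (x k) < ord k (y k) \<Longrightarrow> L {1..d} x y"
      using L_first[OF a] by blast
    have "\<not> ord k (b k) < ord k (a k)"
      using k(2)[OF b a] same asym[OF _ _ a b] ab one_le_d by auto
    moreover have "ord k (a k) \<noteq> ord k (b k)"
      using inj_ord[OF k(1)] ne[OF k(1)] a b k(1) by (auto simp: inj_on_def PiE_def Pi_def)
    ultimately have lt: "ord k (a k) < ord k (b k)" by simp
    have "L {1..d} a (a(k := b k, j := b j))"
      by (rule k(2)[OF a mem(1)[OF k(1)]]) (use same lt j k(1) in auto)
    moreover have "L {1..d} (b(k := a k, j := a j)) b"
      by (rule k(2)[OF mem(2)[OF k(1)] b]) (use same lt j k(1) in auto)
    ultimately show ?thesis using k(1) by blast
  qed
qed

lemma third_coordinate: "\<exists>e\<in>{1..d}. e \<noteq> k \<and> e \<noteq> j"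
proof -
  have "{1, 2, 3} \<subseteq> {1..d}" using d3 by auto
  moreover have "\<exists>e\<in>{1, 2, 3::nat}. e \<noteq> k \<and> e \<noteq> j" by simp presburger
  ultimately show ?thesis by blast
qed

lemma between_up:
  assumes "a \<in> slice c" "b \<in> slice c" "L {1..d} a b"
    and "\<And>e. e \<in> {1..d} \<Longrightarrow> a e \<noteq> b e" "j \<in> {1..d}"
  shows "\<exists>w\<in>slice c. w j = b j \<and> L {1..d} a w \<and> (\<exists>e\<in>{1..d}. a e = w e)"
proof -
  have ab: "a \<in> PiE {1..d} V" "b \<in> PiE {1..d} V" using assms slice_subset by auto
  obtain k where k: "k \<in> {1..d}" "L {1..d} a (a(k := b k, j := b j))"
    using deciding_coordinate[OF ab assms(3-5)] by blast
  have "a(k := b k, j := b j) \<in> PiE {1..d} V"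
    by (rule update2_PiE[OF ab k(1) assms(5)])
  then have "a(k := b k, j := b j) \<in> slice c"
    using assms(1,2) unfolding slice_def by auto
  then show ?thesis
    using third_coordinate[of k j] k(2) by (intro bexI[of _ "a(k := b k, j := b j)"]) auto
qed

lemma between_down:
  assumes "a \<in> slice c" "b \<in> slice c" "L {1..d} a b"
    and "\<And>e. e \<in> {1..d} \<Longrightarrow> a e \<noteq> b e" "j \<in> {1..d}"
  shows "\<exists>w\<in>slice c. w j = a j \<and> L {1..d} w b \<and> (\<exists>e\<in>{1..d}. w e = b e)"
proof -
  have ab: "a \<in> PiE {1..d} V" "b \<in> PiE {1..d} V" using assms slice_subset by auto
  obtain k where k: "k \<in> {1..d}" "L {1..d} (b(k := a k, j := a j)) b"
    using deciding_coordinate[OF ab assms(3-5)] by blast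
  have "b(k := a k, j := a j) \<in> PiE {1..d} V"
    by (rule update2_PiE[OF ab(2,1) k(1) assms(5)])
  then have "b(k := a k, j := a j) \<in> slice c"
    using assms(1,2) unfolding slice_def by auto
  then show ?thesis
    using third_coordinate[of k j] k(2) by (intro bexI[of _ "b(k := a k, j := a j)"]) auto
qed

lemma slice_fill_subset: "slice_fill A \<subseteq> PiE {1..d} V"
  unfolding slice_fill_def by blast

lemma slice_fill_Int_slice:
  "slice_fill A \<inter> slice c = seg (slice c) (L {1..d}) (card (A \<inter> slice c))"
proof -
  have "x \<in> PiE {1..d} V \<and> st 1 (x 1) = c" if "x \<in> seg (slice c) lt k" for x lt k
    using that seg_subset[of "slice c"] unfolding slice_def by blast
  then show ?thesis unfolding slice_fill_def slice_def by blast
qed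

lemma card_slice_fill_Int: "card (slice_fill A \<inter> slice c) = card (A \<inter> slice c)"
  unfolding slice_fill_Int_slice
  by (rule card_seg[OF fin_slice linear_slice]) (simp add: card_mono fin_slice)

lemma initial_slice_fill: "initial (slice c) (L {1..d}) (slice_fill A \<inter> slice c)"
  unfolding slice_fill_Int_slice by (rule initial_seg[OF fin_slice linear_slice])

lemma slice_less:
  assumes "x \<in> PiE {1..d} V" "y \<in> PiE {1..d} V" "st 1 (x 1) < st 1 (y 1)"
  shows "L {1..d} x y"
  by (rule L_key'[OF subset_refl assms(1,2) key_lessI[OF one_le_d]]) (use assms(3) in \<open>auto simp: key_def\<close>)

lemma sum_slices:
  fixes h :: "(nat \<Rightarrow> 'a) \<Rightarrow> nat"
  assumes "A \<subseteq> PiE {1..d} V"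
  shows "(\<Sum>x\<in>A. h x) = (\<Sum>c\<in>st 1 ` V 1. \<Sum>x\<in>A \<inter> slice c. h x)"
proof -
  have "(\<Sum>c\<in>st 1 ` V 1. sum h {x \<in> A. st 1 (x 1) = c}) = (\<Sum>x\<in>A. h x)"
  proof (rule sum.group)
    show "finite A" using finite_subset[OF assms fin_PiE] by blast
    show "finite (st 1 ` V 1)" using fin_V one_le_d by blast
    show "(\<lambda>x. st 1 (x 1)) ` A \<subseteq> st 1 ` V 1" using assms PiE_mem one_le_d by blast
  qed
  moreover have "A \<inter> slice c = {x \<in> A. st 1 (x 1) = c}" for c
    using assms unfolding slice_def by blast
  ultimately show ?thesis by simp
qed

lemma card_slice_fill:
  assumes "A \<subseteq> PiE {1..d} V"
  shows "card (slice_fill A) = card A"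
  using sum_slices[OF assms, of "\<lambda>_. 1"] sum_slices[OF slice_fill_subset, of "\<lambda>_. 1" A]
  by (simp add: card_slice_fill_Int)

text \<open>Within one slice the filling is initial. For \<open>x\<close> and \<open>y\<close> in
  different slices the common coordinate \<open>j\<close> links the two: all of the earlier slice
  lies below all of the later one, so a single point of \<open>A\<close> in the later slice with the
  right coordinate \<open>j\<close> puts into \<open>A\<close> every point of the earlier slice with
  that coordinate.\<close>

lemma strongly_closed_slice_fill:
  assumes A: "strongly_closed A"
  shows "strongly_closed (slice_fill A)"
proof -
  let ?D = "{1..d}" and ?B = "slice_fill A"
  have AV: "A \<subseteq> PiE ?D V" using A unfolding strongly_closed_def by blast
  have scA: "y \<in> A" if "x \<in> A" "y \<in> PiE ?D V" "L ?D y x" "e \<in> ?D" "y e = x e" for x y e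
    using A that unfolding strongly_closed_def by blast
  have exch: "\<exists>a\<in>slice c. a \<in> ?B \<and> a \<notin> A \<and> L ?D a b" if "b \<in> A" "b \<notin> ?B" "b \<in> slice c" for b c
    using initial_exchange(1)[OF fin_slice linear_slice initial_slice_fill,
        of "A \<inter> slice c" c A b] that card_slice_fill_Int[of A c] by auto
  have exch': "\<exists>b\<in>slice c. b \<in> A \<and> b \<notin> ?B \<and> L ?D a b" if "a \<in> ?B" "a \<notin> A" "a \<in> slice c" for a c
    using initial_exchange(2)[OF fin_slice linear_slice initial_slice_fill,
        of "A \<inter> slice c" c A a] that card_slice_fill_Int[of A c] by auto
  have "x \<in> ?B" if y: "y \<in> ?B" and x: "x \<in> PiE ?D V" and xy: "L ?D x y" and j: "j \<in> ?D" "x j = y j"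
    for x y j
  proof -
    have yV: "y \<in> PiE ?D V" using y slice_fill_subset by blast
    define c c' where "c = st 1 (x 1)" and "c' = st 1 (y 1)"
    have xc: "x \<in> slice c" and yc: "y \<in> slice c'" using x yV unfolding c_def c'_def slice_def by auto
    show ?thesis
    proof (cases "c = c'")
      case True
      then show ?thesis
        using initial_slice_fill[of c A] xc yc y xy unfolding initial_def by blast
    next
      case False
      have "\<not> c' < c"
        using slice_less[OF yV x] asym[OF _ _ x yV xy] one_le_d unfolding c_def c'_def by blast
      then have cc: "c < c'" using False by simp
      have less: "L ?D u w" if "u \<in> slice c" "w \<in> slice c'" for u w
        using that cc slice_less unfolding slice_def by auto
      \<comment> \<open>The linking point is \<open>y\<close> itself unless \<open>y\<close> entered
        by the filling. In that case a larger \<open>y0\<close> has left, it shares no coordinate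
        with \<open>y\<close>, and a point below \<open>y0\<close> inherits coordinate
        \<open>j\<close> from \<open>y\<close>.\<close>
      obtain w where w: "w \<in> A" "w \<in> slice c'" "w j = x j"
      proof (cases "y \<in> A")
        case True
        then show ?thesis using that yc j by simp
      next
        case False
        then obtain y0 where y0: "y0 \<in> slice c'" "y0 \<in> A" "L ?D y y0"
          using exch'[OF y] yc by blast
        have "y e \<noteq> y0 e" if "e \<in> ?D" for e
          using scA[OF y0(2) yV y0(3) that] False by blast
        then obtain w where "w \<in> slice c'" "w j = y j" "L ?D w y0" "\<exists>e\<in>?D. w e = y0 e"
          using between_down[OF yc y0(1,3) _ j(1)] by blast
        then show ?thesis using that scA[OF y0(2)] slice_subset j(2) by force
      qed
      have xA: "x \<in> A" using scA[OF w(1) x less[OF xc w(2)] j(1)] w(3) by simp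
      show ?thesis
      \<comment> \<open>If \<open>x\<close> had left, a smaller \<open>a\<close> would have entered
        in its place. A point \<open>v\<close> above \<open>a\<close> with the coordinate
        \<open>j\<close> of \<open>x\<close> is in \<open>A\<close> because of \<open>w\<close>, and
        \<open>v\<close> shares a coordinate with \<open>a\<close>, which would force
        \<open>a\<close> into \<open>A\<close>.\<close>
      proof (rule ccontr)
        assume "x \<notin> ?B"
        then obtain a where a: "a \<in> slice c" "a \<notin> A" "L ?D a x" using exch[OF xA] xc by blast
        have aV: "a \<in> PiE ?D V" using a slice_subset by blast
        have "a e \<noteq> x e" if "e \<in> ?D" for e
          using scA[OF xA aV a(3) that] a(2) by blast
        then obtain v where v: "v \<in> slice c" "v j = x j" "L ?D a v" "\<exists>e\<in>?D. a e = v e"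
          using between_up[OF a(1) xc a(3) _ j(1)] by blast
        have "v \<in> A" using scA[OF w(1) _ less[OF v(1) w(2)] j(1)] v(1,2) w(3) slice_subset by auto
        then show False using scA[OF _ aV v(3)] v(4) a(2) by blast
      qed
    qed
  qed
  then show ?thesis unfolding strongly_closed_def using slice_fill_subset by blast
qed

section \<open>Strong compression as closure under smaller vertices with a common coordinate\<close>

definition fibre :: "nat set \<Rightarrow> (nat \<Rightarrow> 'a) \<Rightarrow> (nat \<Rightarrow> 'a) set" where
  "fibre S v = {w \<in> PiE {1..d} V. \<forall>e\<in>{1..d} - S. w e = v e}"

text \<open>Completing a point of the subproduct by the coordinates of \<open>v\<close> outside
  \<open>S\<close> is an order isomorphism onto the fibre. Ranks in a section can therefore be read
  off the order of the full product.\<close>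

lemma card_below_fibre:
  assumes S: "S \<noteq> {}" "S \<subseteq> {1..d}" and v: "v \<in> PiE {1..d} V"
  shows "card {y \<in> PiE S V. L S y (restrict v S)} = card {w \<in> fibre S v. L {1..d} w v}"
proof -
  have iff: "L {1..d} w v \<longleftrightarrow> L S (restrict w S) (restrict v S)" if "w \<in> fibre S v" for w
    by (rule L_restrict_iff[OF S subset_refl _ v]) (use that in \<open>auto simp: fibre_def\<close>)
  have "bij_betw (\<lambda>w. restrict w S) {w \<in> fibre S v. L {1..d} w v} {y \<in> PiE S V. L S y (restrict v S)}"
  proof (rule bij_betw_byWitness[where f' = "\<lambda>y e. if e \<in> S then y e else v e"])
    show "\<forall>w\<in>{w \<in> fibre S v. L {1..d} w v}. (\<lambda>e. if e \<in> S then restrict w S e else v e) = w"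
    proof
      fix w assume "w \<in> {w \<in> fibre S v. L {1..d} w v}"
      then have w: "w \<in> PiE {1..d} V" "\<And>e. e \<in> {1..d} - S \<Longrightarrow> w e = v e"
        unfolding fibre_def by auto
      have "w e = v e" if "e \<notin> S" for e
        using w v that by (cases "e \<in> {1..d}") (auto simp: PiE_iff extensional_def)
      then show "(\<lambda>e. if e \<in> S then restrict w S e else v e) = w" by auto
    qed
    show "\<forall>y\<in>{y \<in> PiE S V. L S y (restrict v S)}. restrict (\<lambda>e. if e \<in> S then y e else v e) S = y"
      by (auto simp: fun_eq_iff PiE_iff extensional_def)
    show "(\<lambda>w. restrict w S) ` {w \<in> fibre S v. L {1..d} w v} \<subseteq> {y \<in> PiE S V. L S y (restrict v S)}"
      using iff S by (auto simp: fibre_def)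
    show "(\<lambda>y e. if e \<in> S then y e else v e) ` {y \<in> PiE S V. L S y (restrict v S)} \<subseteq>
        {w \<in> fibre S v. L {1..d} w v}"
    proof clarify
      fix y assume y: "y \<in> PiE S V" "L S y (restrict v S)"
      let ?w = "\<lambda>e. if e \<in> S then y e else v e"
      have "?w \<in> PiE {1..d} V" using y(1) v S(2) by (auto simp: PiE_iff extensional_def)
      then have w: "?w \<in> fibre S v" unfolding fibre_def by auto
      moreover have "restrict ?w S = y" using y(1) by (auto simp: fun_eq_iff PiE_iff extensional_def)
      ultimately show "?w \<in> fibre S v \<and> L {1..d} ?w v" using iff[OF w] y(2) by simp
    qed
  qed
  then show ?thesis by (simp add: bij_betw_same_card)
qed

text \<open>The right side says that \<open>A\<close> meets every fibre in an initial segment. A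
  proper \<open>S\<close> misses some coordinate, which is then common to the whole fibre;
  conversely, two vertices with a common coordinate \<open>e\<close> lie in one fibre over the
  complement of \<open>e\<close>.\<close>

lemma strongly_closed_iff:
  assumes A: "A \<subseteq> PiE {1..d} V"
  shows "strongly_closed A \<longleftrightarrow> (\<forall>S. S \<noteq> {} \<and> S \<subset> {1..d} \<longrightarrow> (\<forall>v\<in>PiE {1..d} V.
    v \<in> A \<longleftrightarrow> ranking (PiE S V) (L S) (restrict v S) \<le> card (A \<inter> fibre S v)))"
    (is "_ \<longleftrightarrow> ?R")
proof
  have sub: "fibre S v \<subseteq> PiE {1..d} V" for S v unfolding fibre_def by blast
  have fin: "finite (fibre S v)" for S v using finite_subset[OF sub fin_PiE] by blast
  have lin: "strict_linear_on (fibre S v) (L {1..d})" for S v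
    using strict_linear_on_subset[OF linear sub] one_le_d by blast
  {
    assume sc: "strongly_closed A"
    show ?R
    proof (intro allI impI ballI)
      fix S v assume S: "S \<noteq> {} \<and> S \<subset> {1..d}" and v: "v \<in> PiE {1..d} V"
      obtain e where e: "e \<in> {1..d}" "e \<notin> S" using S by blast
      have "initial (fibre S v) (L {1..d}) (A \<inter> fibre S v)"
        unfolding initial_def
      proof (intro conjI ballI impI)
        fix x y assume x: "x \<in> A \<inter> fibre S v" and y: "y \<in> fibre S v" "L {1..d} y x"
        have "y e = x e" using x y e unfolding fibre_def by simp
        then show "y \<in> A \<inter> fibre S v"
          using sc x y e(1) subsetD[OF sub y(1)] unfolding strongly_closed_def by blast
      qed blast
      then have "A \<inter> fibre S v = seg (fibre S v) (L {1..d}) (card (A \<inter> fibre S v))"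
        by (rule initial_eq_seg[OF fin lin])
      moreover have "v \<in> fibre S v" using v unfolding fibre_def by blast
      ultimately have "v \<in> A \<longleftrightarrow> card {w \<in> fibre S v. L {1..d} w v} < card (A \<inter> fibre S v)"
        unfolding seg_def by blast
      then show "v \<in> A \<longleftrightarrow> ranking (PiE S V) (L S) (restrict v S) \<le> card (A \<inter> fibre S v)"
        using card_below_fibre[of S v] S v unfolding ranking_def by auto
    qed
  next
    assume R: ?R
    show "strongly_closed A"
      unfolding strongly_closed_def
    proof (intro conjI A ballI impI)
      fix x y assume x: "x \<in> A" and y: "y \<in> PiE {1..d} V" "L {1..d} y x" and "\<exists>e\<in>{1..d}. y e = x e"
      then obtain e where e: "e \<in> {1..d}" "y e = x e" by blast
      define S where "S = {1..d} - {e}"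
      obtain e' where "e' \<in> {1..d}" "e' \<noteq> e" using third_coordinate[of e e] by blast
      then have S: "S \<noteq> {}" "S \<subset> {1..d}" using e(1) unfolding S_def by blast+
      have xV: "x \<in> PiE {1..d} V" using x A by blast
      have DS: "{1..d} - S = {e}" using e(1) unfolding S_def by blast
      have same: "fibre S y = fibre S x" unfolding fibre_def DS using e(2) by simp
      have mem: "x \<in> fibre S x" "y \<in> fibre S x"
        using xV y(1) e(2) unfolding fibre_def DS by auto
      have "card {w \<in> fibre S x. L {1..d} w y} < card {w \<in> fibre S x. L {1..d} w x}"
        by (rule card_below_less[OF fin lin mem(2,1)]) (rule y(2))
      then have "ranking (PiE S V) (L S) (restrict y S) < ranking (PiE S V) (L S) (restrict x S)"
        using card_below_fibre[OF S(1) _ y(1)] card_below_fibre[OF S(1) _ xV] S(2) same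
        unfolding ranking_def by simp
      moreover have "ranking (PiE S V) (L S) (restrict x S) \<le> card (A \<inter> fibre S x)"
        using R S x xV by blast
      ultimately show "y \<in> A" using R S y(1) same by (metis less_imp_le order_trans)
    qed
  }
qed

lemma down_closed_strongly_closed:
  assumes "strongly_closed A"
  shows "down_closed {1..d} (PiE {1..d} V) A"
  unfolding down_closed_def
proof (intro conjI ballI impI)
  show A: "A \<subseteq> PiE {1..d} V" using assms unfolding strongly_closed_def by blast
  fix x e u assume x: "x \<in> A" and e: "e \<in> {1..d}" "u \<in> V e" "ord e u < ord e (x e)"
    and mem: "x(e := u) \<in> PiE {1..d} V"
  obtain e' where "e' \<in> {1..d}" "e' \<noteq> e" using third_coordinate[of e e] by blast
  moreover have "L {1..d} (x(e := u)) x" using L_coord[of "{1..d}" x e u] e x A by blast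
  ultimately show "x(e := u) \<in> A"
    using assms x mem unfolding strongly_closed_def by (metis fun_upd_other)
qed

end

section \<open>Moving weight between consecutive blocks\<close>

text \<open>Optimality is required in terms of weight and only against sets closed under lowering a
  coordinate: for those the weight differs from the number of edges by a quantity that depends on
  the size alone. \<open>f_mono\<close> stops at \<open>d - 1\<close>, as the hypothesis on
  non-decreasing partitions does.\<close>

locale optimal_block_system = block_system +
  assumes block_optimal: "T \<noteq> {} \<Longrightarrow> T \<subseteq> {1..d} \<Longrightarrow> down_closed T (block T c) M \<Longrightarrow>
        initial (block T c) (L T) N \<Longrightarrow> card M = card N \<Longrightarrow> weight T M \<le> weight T N"
    and pair_optimal: "1 \<le> i \<Longrightarrow> i < j \<Longrightarrow> j \<le> d \<Longrightarrow> down_closed {i, j} (PiE {i, j} V) M \<Longrightarrow>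
        initial (PiE {i, j} V) (L {i, j}) N \<Longrightarrow> card M = card N \<Longrightarrow> weight {i, j} M \<le> weight {i, j} N"
    and f_mono: "e \<in> {1..d - 1} \<Longrightarrow> u \<in> V e \<Longrightarrow> v \<in> V e \<Longrightarrow> st e u = st e v \<Longrightarrow>
        ord e u \<le> ord e v \<Longrightarrow> f e u \<le> f e v"
begin

section \<open>Layers of a block along one coordinate\<close>

definition rk :: "nat \<Rightarrow> nat \<Rightarrow> 'a \<Rightarrow> nat" where
  "rk e c = ranking (part e c) (\<lambda>u v. ord e u < ord e v)"

definition nth_in_part :: "nat \<Rightarrow> nat \<Rightarrow> nat \<Rightarrow> 'a" where
  "nth_in_part e c r = inv_into (part e c) (rk e c) r"

definition best :: "nat set \<Rightarrow> (nat \<Rightarrow> nat) \<Rightarrow> nat \<Rightarrow> nat" where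
  "best T c k = weight T (seg (block T c) (L T) k)"

text \<open>Here \<open>sy\<close> is the lower and \<open>sx\<close> the upper block, and
  \<open>s\<close> is the largest number of points that can be moved down. The premise keeps, of the
  fact that points of \<open>A\<close> and smaller points outside \<open>A\<close> share no
  coordinate, only what concerns \<open>i\<close> and \<open>j\<close>; these two belong to every
  subproduct met in the induction.\<close>

definition transferable :: "nat set \<Rightarrow> nat \<Rightarrow> nat \<Rightarrow> (nat \<Rightarrow> nat) \<Rightarrow> (nat \<Rightarrow> nat) \<Rightarrow> bool" where
  "transferable T i j sy sx \<longleftrightarrow> (\<forall>a b. a \<le> card (block T sy) \<longrightarrow> b \<le> card (block T sx) \<longrightarrow>
     (\<forall>x\<in>seg (block T sx) (L T) b. \<forall>y\<in>block T sy - seg (block T sy) (L T) a.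
        x i \<noteq> y i \<and> x j \<noteq> y j) \<longrightarrow>
     (let s = min b (card (block T sy) - a)
      in best T sy a + best T sx b \<le> best T sy (a + s) + best T sx (b - s)))"

text \<open>A layer is a set of points of the product over \<open>T\<close> rather than a subset of
  \<open>M\<close>, so that layers at different heights, and in different blocks, can be compared
  with each other.\<close>

definition layer :: "nat \<Rightarrow> nat set \<Rightarrow> (nat \<Rightarrow> 'a) set \<Rightarrow> 'a \<Rightarrow> (nat \<Rightarrow> 'a) set" where
  "layer e T M u = {w \<in> PiE T V. w(e := u) \<in> M}"

text \<open>Weaker than being initial in the block over \<open>insert e T\<close>: two points that
  differ both at \<open>e\<close> and on \<open>T\<close> may be in the wrong order. Strong closure
  gives exactly this much for the trace of \<open>A\<close> on a block.\<close>

definition layered :: "nat \<Rightarrow> nat set \<Rightarrow> (nat \<Rightarrow> nat) \<Rightarrow> (nat \<Rightarrow> 'a) set \<Rightarrow> bool" where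
  "layered e T c M \<longleftrightarrow> M \<subseteq> block (insert e T) c \<and>
     (\<forall>u\<in>part e (c e). initial (block T c) (L T) (layer e T M u)) \<and>
     (\<forall>u\<in>part e (c e). \<forall>v\<in>part e (c e). ord e u \<le> ord e v \<longrightarrow> layer e T M v \<subseteq> layer e T M u)"

lemma fin_block: "T \<subseteq> {1..d} \<Longrightarrow> finite (block T c)"
  using finite_subset[OF block_subset fin_PiE] by blast

lemma linear_block: "T \<noteq> {} \<Longrightarrow> T \<subseteq> {1..d} \<Longrightarrow> strict_linear_on (block T c) (L T)"
  using strict_linear_on_subset[OF linear block_subset] by blast

lemma linear_part: "e \<in> {1..d} \<Longrightarrow> strict_linear_on (part e c) (\<lambda>u v. ord e u < ord e v)"
  using inj_ord part_subset[of e c] unfolding strict_linear_on_def inj_on_def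
  by (metis less_irrefl less_trans linorder_neqE_nat subsetD)

lemma fin_part: "e \<in> {1..d} \<Longrightarrow> finite (part e c)"
  using finite_subset[OF part_subset fin_V] by blast

lemma bij_rk: "e \<in> {1..d} \<Longrightarrow> bij_betw (rk e c) (part e c) {1..card (part e c)}"
  unfolding rk_def by (rule bij_betw_ranking[OF fin_part linear_part])

lemma rk_less_iff:
  "e \<in> {1..d} \<Longrightarrow> u \<in> part e c \<Longrightarrow> v \<in> part e c \<Longrightarrow> rk e c u < rk e c v \<longleftrightarrow> ord e u < ord e v"
  unfolding rk_def ranking_def using card_below_less_iff[OF fin_part linear_part] by simp

lemma rk_range: "e \<in> {1..d} \<Longrightarrow> u \<in> part e c \<Longrightarrow> rk e c u \<in> {1..card (part e c)}"
  using bij_rk unfolding bij_betw_def by blast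

lemma bij_nth: "e \<in> {1..d} \<Longrightarrow> bij_betw (nth_in_part e c) {1..card (part e c)} (part e c)"
  unfolding nth_in_part_def[abs_def] using bij_betw_inv_into[OF bij_rk] .

lemma nth_part: "e \<in> {1..d} \<Longrightarrow> r \<in> {1..card (part e c)} \<Longrightarrow> nth_in_part e c r \<in> part e c"
  using bij_nth unfolding bij_betw_def by blast

lemma rk_nth: "e \<in> {1..d} \<Longrightarrow> r \<in> {1..card (part e c)} \<Longrightarrow> rk e c (nth_in_part e c r) = r"
  unfolding nth_in_part_def using bij_betw_inv_into_right[OF bij_rk] .

lemma nth_rk: "e \<in> {1..d} \<Longrightarrow> u \<in> part e c \<Longrightarrow> nth_in_part e c (rk e c u) = u"
  unfolding nth_in_part_def using bij_betw_inv_into_left[OF bij_rk] .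

lemma ord_nth_mono:
  assumes "e \<in> {1..d}" "1 \<le> r" "r \<le> q" "q \<le> card (part e c)"
  shows "ord e (nth_in_part e c r) \<le> ord e (nth_in_part e c q)"
proof -
  have rq: "r \<in> {1..card (part e c)}" "q \<in> {1..card (part e c)}" using assms by auto
  have "\<not> rk e c (nth_in_part e c q) < rk e c (nth_in_part e c r)"
    unfolding rk_nth[OF assms(1) rq(1)] rk_nth[OF assms(1) rq(2)] using assms by simp
  then show ?thesis
    using rk_less_iff[OF assms(1) nth_part[OF assms(1) rq(2)] nth_part[OF assms(1) rq(1)]] by simp
qed

lemma update_block:
  assumes "w \<in> block T c" "u \<in> part e (c e)"
  shows "w(e := u) \<in> block (insert e T) c"
  using assms unfolding block_def by (auto simp: PiE_iff extensional_def)

lemma update_block_iff: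
  assumes "w \<in> PiE T V" "e \<notin> T"
  shows "w(e := u) \<in> block (insert e T) c \<longleftrightarrow> w \<in> block T c \<and> u \<in> part e (c e)"
proof
  assume w: "w(e := u) \<in> block (insert e T) c"
  have "w k \<in> part k (c k)" if "k \<in> T" for k
  proof -
    have "(w(e := u)) k \<in> part k (c k)" using w that unfolding block_def by (simp add: PiE_iff)
    then show ?thesis using that assms(2) by (auto split: if_splits)
  qed
  moreover have "u \<in> part e (c e)"
    using w unfolding block_def by (auto simp: PiE_iff dest: bspec[of _ _ e])
  ultimately show "w \<in> block T c \<and> u \<in> part e (c e)"
    using assms unfolding block_def by (auto simp: PiE_iff)
qed (use update_block in blast)

lemma restrict_block: "x \<in> block T' c \<Longrightarrow> T \<subseteq> T' \<Longrightarrow> restrict x T \<in> block T c"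
  unfolding block_def by auto

lemma restrict_update_eq: "x \<in> PiE (insert e T) V \<Longrightarrow> (restrict x T)(e := x e) = x"
  by (auto simp: fun_eq_iff PiE_iff extensional_def)

lemma restrict_update: "w \<in> PiE T V \<Longrightarrow> e \<notin> T \<Longrightarrow> restrict (w(e := u)) T = w"
  by (auto simp: fun_eq_iff PiE_iff extensional_def)

lemma L_update_iff:
  assumes "T \<noteq> {}" "insert e T \<subseteq> {1..d}" "e \<notin> T" "w \<in> PiE T V" "w' \<in> PiE T V" "u \<in> V e"
  shows "L (insert e T) (w(e := u)) (w'(e := u)) \<longleftrightarrow> L T w w'"
proof -
  have "w(e := u) \<in> PiE (insert e T) V" "w'(e := u) \<in> PiE (insert e T) V"
    using assms by (auto intro: fun_upd_in_PiE simp: PiE_iff extensional_def)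
  then have "L (insert e T) (w(e := u)) (w'(e := u)) \<longleftrightarrow>
      L T (restrict (w(e := u)) T) (restrict (w'(e := u)) T)"
    by (intro L_restrict_iff[OF assms(1) _ assms(2)]) auto
  then show ?thesis using restrict_update assms by simp
qed

lemma layer_subset:
  assumes "M \<subseteq> block (insert e T) c" "e \<notin> T"
  shows "layer e T M u \<subseteq> block T c"
  using assms update_block_iff unfolding layer_def by blast

lemma layeredI:
  assumes T: "T \<noteq> {}" "insert e T \<subseteq> {1..d}" "e \<notin> T"
    and M: "M \<subseteq> block (insert e T) c"
    and closed: "\<And>x y. x \<in> M \<Longrightarrow> y \<in> block (insert e T) c \<Longrightarrow> L (insert e T) y x \<Longrightarrow>
        y e = x e \<or> (\<forall>k\<in>T. y k = x k) \<Longrightarrow> y \<in> M"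
  shows "layered e T c M"
  unfolding layered_def
proof (intro conjI ballI impI)
  show "M \<subseteq> block (insert e T) c" by fact
  fix u assume u: "u \<in> part e (c e)"
  then have uV: "u \<in> V e" using part_subset by blast
  show "initial (block T c) (L T) (layer e T M u)"
    unfolding initial_def
  proof (intro conjI ballI impI)
    show "layer e T M u \<subseteq> block T c" using layer_subset[OF M T(3)] .
    fix x y assume x: "x \<in> layer e T M u" and y: "y \<in> block T c" and "L T y x"
    have xT: "x \<in> PiE T V" "x(e := u) \<in> M" using x unfolding layer_def by auto
    have yT: "y \<in> PiE T V" using y block_subset by blast
    have "y(e := u) \<in> M"
      using closed[OF xT(2) update_block[where u = u, OF y u]]
        L_update_iff[OF T yT xT(1) uV] \<open>L T y x\<close> by simp
    then show "y \<in> layer e T M u" using yT unfolding layer_def by simp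
  qed
next
  fix u v assume u: "u \<in> part e (c e)" and v: "v \<in> part e (c e)" and uv: "ord e u \<le> ord e v"
  show "layer e T M v \<subseteq> layer e T M u"
  proof
    fix x assume x: "x \<in> layer e T M v"
    then have xT: "x \<in> PiE T V" "x(e := v) \<in> M" unfolding layer_def by auto
    show "x \<in> layer e T M u"
    proof (cases "u = v")
      case False
      have "u \<in> V e" "v \<in> V e" using u v part_subset by auto
      then have "ord e u < ord e v"
        using uv False inj_ord[of e] T(2) unfolding inj_on_def by (metis insert_subset le_neq_implies_less)
      then have "L (insert e T) ((x(e := v))(e := u)) (x(e := v))"
        using L_coord[OF T(2) subsetD[OF block_subset subsetD[OF M xT(2)]], of e u] \<open>u \<in> V e\<close>
        by simp
      moreover have "x(e := u) \<in> block (insert e T) c"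
        by (rule update_block[of x T c u e, OF _ u]) (use x layer_subset[OF M T(3)] in blast)
      ultimately have "x(e := u) \<in> M"
        using closed[OF xT(2), of "x(e := u)"] T(3) by simp
      then show ?thesis using xT unfolding layer_def by simp
    qed (use x in simp)
  qed
qed

lemma sum_layers:
  fixes h :: "(nat \<Rightarrow> 'a) \<Rightarrow> nat"
  assumes T: "insert e T \<subseteq> {1..d}" "e \<notin> T" and M: "M \<subseteq> block (insert e T) c"
  shows "(\<Sum>x\<in>M. h x) = (\<Sum>r\<in>{1..card (part e (c e))}.
      \<Sum>w\<in>layer e T M (nth_in_part e (c e) r). h (w(e := nth_in_part e (c e) r)))"
proof -
  have e: "e \<in> {1..d}" using T by auto
  have MV: "M \<subseteq> PiE (insert e T) V" using M block_subset by blast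
  have fin: "finite M" using finite_subset[OF M fin_block[OF T(1)]] .
  have inner: "(\<Sum>w\<in>layer e T M u. h (w(e := u))) = (\<Sum>x\<in>{x \<in> M. x e = u}. h x)" for u
  proof (rule sum.reindex_bij_witness[where i = "\<lambda>x. restrict x T" and j = "\<lambda>w. w(e := u)"])
    fix w assume w: "w \<in> layer e T M u"
    then show "restrict (w(e := u)) T = w" using restrict_update T(2) unfolding layer_def by blast
    show "w(e := u) \<in> {x \<in> M. x e = u}" using w unfolding layer_def by simp
  next
    fix x assume x: "x \<in> {x \<in> M. x e = u}"
    then show eq: "(restrict x T)(e := u) = x" using restrict_update_eq MV by blast
    have "restrict x T \<in> PiE T V" using x MV by (auto simp: PiE_iff)
    then show "restrict x T \<in> layer e T M u" using eq x unfolding layer_def by simp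
  qed simp
  have "(\<Sum>r\<in>{1..card (part e (c e))}. \<Sum>w\<in>layer e T M (nth_in_part e (c e) r). h (w(e := nth_in_part e (c e) r)))
      = (\<Sum>u\<in>part e (c e). \<Sum>w\<in>layer e T M u. h (w(e := u)))"
    by (rule sum.reindex_bij_betw[OF bij_nth[OF e]])
  also have "\<dots> = (\<Sum>u\<in>part e (c e). \<Sum>x\<in>{x \<in> M. x e = u}. h x)"
    unfolding inner ..
  also have "\<dots> = (\<Sum>x\<in>M. h x)"
  proof (rule sum.group[OF fin fin_part[OF e]])
    show "(\<lambda>x. x e) ` M \<subseteq> part e (c e)" using M unfolding block_def by auto
  qed
  finally show ?thesis by simp
qed

text \<open>On one layer the coordinate \<open>e\<close> is constant and contributes its degree once
  per point; the rest is the weight of an initial segment over \<open>T\<close>.\<close>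

lemma card_weight_layers:
  assumes T: "T \<noteq> {}" "insert e T \<subseteq> {1..d}" "e \<notin> T" and M: "M \<subseteq> block (insert e T) c"
    and layers: "\<And>u. u \<in> part e (c e) \<Longrightarrow> layer e T M u = seg (block T c) (L T) (m (rk e (c e) u))"
    and m: "\<And>r. r \<in> {1..card (part e (c e))} \<Longrightarrow> m r \<le> card (block T c)"
  shows "card M = (\<Sum>r\<in>{1..card (part e (c e))}. m r)"
    and "weight (insert e T) M =
      (\<Sum>r\<in>{1..card (part e (c e))}. best T c (m r) + f e (nth_in_part e (c e) r) * m r)"
proof -
  have e: "e \<in> {1..d}" and TD: "T \<subseteq> {1..d}" using T by auto
  have lay: "layer e T M (nth_in_part e (c e) r) = seg (block T c) (L T) (m r)"
    if "r \<in> {1..card (part e (c e))}" for r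
    using layers[OF nth_part[OF e that]] rk_nth[OF e that] by simp
  have cd: "card (layer e T M (nth_in_part e (c e) r)) = m r" if "r \<in> {1..card (part e (c e))}" for r
    unfolding lay[OF that] by (rule card_seg[OF fin_block[OF TD] linear_block[OF T(1) TD] m[OF that]])
  have "card M = (\<Sum>r\<in>{1..card (part e (c e))}. card (layer e T M (nth_in_part e (c e) r)))"
    using sum_layers[OF T(2,3) M, of "\<lambda>_. 1"] by simp
  then show "card M = (\<Sum>r\<in>{1..card (part e (c e))}. m r)" using cd by simp
  have fT: "finite T" using finite_subset[OF TD] by simp
  have "weight (insert e T) M = (\<Sum>r\<in>{1..card (part e (c e))}.
      \<Sum>w\<in>layer e T M (nth_in_part e (c e) r). \<Sum>k\<in>insert e T. f k ((w(e := nth_in_part e (c e) r)) k))"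
    unfolding weight_def by (rule sum_layers[OF T(2,3) M])
  also have "\<dots> = (\<Sum>r\<in>{1..card (part e (c e))}. best T c (m r) + f e (nth_in_part e (c e) r) * m r)"
  proof (rule sum.cong[OF refl])
    fix r assume r: "r \<in> {1..card (part e (c e))}"
    have "(\<Sum>k\<in>insert e T. f k ((w(e := u)) k)) = (\<Sum>k\<in>T. f k (w k)) + f e u" for w u
    proof -
      have "(\<Sum>k\<in>T. f k ((w(e := u)) k)) = (\<Sum>k\<in>T. f k (w k))"
        by (rule sum.cong) (use T(3) in auto)
      then show ?thesis using fT T(3) by simp
    qed
    then have "(\<Sum>w\<in>layer e T M (nth_in_part e (c e) r). \<Sum>k\<in>insert e T. f k ((w(e := nth_in_part e (c e) r)) k))
        = weight T (layer e T M (nth_in_part e (c e) r)) + f e (nth_in_part e (c e) r) * card (layer e T M (nth_in_part e (c e) r))"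
      unfolding weight_def by (simp add: sum.distrib)
    then show "(\<Sum>w\<in>layer e T M (nth_in_part e (c e) r). \<Sum>k\<in>insert e T. f k ((w(e := nth_in_part e (c e) r)) k))
        = best T c (m r) + f e (nth_in_part e (c e) r) * m r"
      unfolding cd[OF r] unfolding lay[OF r] best_def .
  qed
  finally show "weight (insert e T) M =
      (\<Sum>r\<in>{1..card (part e (c e))}. best T c (m r) + f e (nth_in_part e (c e) r) * m r)" .
qed

lemma card_block_insert:
  assumes T: "T \<noteq> {}" "insert e T \<subseteq> {1..d}" "e \<notin> T"
  shows "card (block (insert e T) c) = card (part e (c e)) * card (block T c)"
proof -
  have TD: "T \<subseteq> {1..d}" using T by auto
  have "layer e T (block (insert e T) c) u = seg (block T c) (L T) (card (block T c))"
    if "u \<in> part e (c e)" for u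
    unfolding seg_card[OF fin_block[OF TD] linear_block[OF T(1) TD]] layer_def
    using update_block_iff[OF _ T(3), of _ u c] that block_subset[of T c] by auto
  then have "card (block (insert e T) c) = (\<Sum>r\<in>{1..card (part e (c e))}. card (block T c))"
    by (intro card_weight_layers(1)[OF T subset_refl, where m = "\<lambda>_. card (block T c)"]) auto
  then show ?thesis by simp
qed

text \<open>Initial segments of nonincreasing sizes, piled up along \<open>e\<close>, form a set
  that is in general not initial but is closed under lowering a coordinate.
  \<open>block_optimal\<close> therefore bounds its weight by that of the initial segment of the
  same size.\<close>

lemma stack:
  assumes T: "T \<noteq> {}" "insert e T \<subseteq> {1..d}" "e \<notin> T"
    and m: "\<And>r. r \<in> {1..card (part e (c e))} \<Longrightarrow> m r \<le> card (block T c)"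
    and dec: "\<And>r q. 1 \<le> r \<Longrightarrow> r \<le> q \<Longrightarrow> q \<le> card (part e (c e)) \<Longrightarrow> m q \<le> m r"
  shows "(\<Sum>r\<in>{1..card (part e (c e))}. best T c (m r) + f e (nth_in_part e (c e) r) * m r) \<le>
      best (insert e T) c (\<Sum>r\<in>{1..card (part e (c e))}. m r)"
    and "(\<Sum>r\<in>{1..card (part e (c e))}. m r) \<le> card (block (insert e T) c)"
proof -
  have e: "e \<in> {1..d}" and TD: "T \<subseteq> {1..d}" using T by auto
  define M where "M = {x \<in> block (insert e T) c.
      restrict x T \<in> seg (block T c) (L T) (m (rk e (c e) (x e)))}"
  have MB: "M \<subseteq> block (insert e T) c" unfolding M_def by blast
  have lay: "layer e T M u = seg (block T c) (L T) (m (rk e (c e) u))" if u: "u \<in> part e (c e)" for u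
  proof (rule set_eqI)
    fix w
    have "w \<in> PiE T V \<Longrightarrow> restrict w T = w" by (rule PiE_restrict)
    moreover have "seg (block T c) (L T) k \<subseteq> PiE T V" for k
      using seg_subset block_subset by (rule subset_trans)
    ultimately show "w \<in> layer e T M u \<longleftrightarrow> w \<in> seg (block T c) (L T) (m (rk e (c e) u))"
      using seg_subset[of "block T c" "L T"] block_subset[of T c] u
        update_block_iff[of w T e u c] restrict_update[of w T e u] T(3)
      unfolding layer_def M_def mem_Collect_eq fun_upd_same by (metis subsetD)
  qed
  note cw = card_weight_layers[OF T MB lay m]
  have seg_init: "initial (block T c) (L T) (seg (block T c) (L T) k)" for k
    by (rule initial_seg[OF fin_block[OF TD] linear_block[OF T(1) TD]])
  have "down_closed (insert e T) (block (insert e T) c) M"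
    unfolding down_closed_def
  proof (intro conjI MB ballI impI)
    fix x k u assume x: "x \<in> M" and k: "k \<in> insert e T" and u: "u \<in> V k"
      and less: "ord k u < ord k (x k)" and mem: "x(k := u) \<in> block (insert e T) c"
    have xB: "x \<in> block (insert e T) c"
      and xs: "restrict x T \<in> seg (block T c) (L T) (m (rk e (c e) (x e)))"
      using x unfolding M_def by auto
    show "x(k := u) \<in> M"
    proof (cases "k = e")
      case True
      have xe: "x e \<in> part e (c e)" using xB unfolding block_def by auto
      have "(x(k := u)) e \<in> part e (c e)" using mem unfolding block_def by (meson PiE_mem insertI1)
      then have ue: "u \<in> part e (c e)" using True by simp
      have "rk e (c e) u < rk e (c e) (x e)"
        using rk_less_iff[OF e ue xe] less True by simp
      then have "m (rk e (c e) (x e)) \<le> m (rk e (c e) u)"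
        by (intro dec) (use rk_range[OF e ue] rk_range[OF e xe] in auto)
      then have "restrict x T \<in> seg (block T c) (L T) (m (rk e (c e) u))"
        by (rule subsetD[OF seg_mono xs])
      moreover have "restrict (x(k := u)) T = restrict x T"
        using True T(3) by (auto simp: fun_eq_iff)
      ultimately show ?thesis using mem True unfolding M_def by simp
    next
      case False
      then have kT: "k \<in> T" using k by simp
      have "restrict x T \<in> PiE T V" using restrict_block[OF xB, of T] block_subset[of T c] by blast
      then have "L T ((restrict x T)(k := u)) (restrict x T)"
        using L_coord[OF TD _ kT u] less kT by simp
      moreover have eq: "(restrict x T)(k := u) = restrict (x(k := u)) T"
        using kT by (auto simp: fun_eq_iff)
      moreover have "restrict (x(k := u)) T \<in> block T c" using restrict_block[OF mem] by blast
      ultimately have "restrict (x(k := u)) T \<in> seg (block T c) (L T) (m (rk e (c e) (x e)))"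
        using seg_init[of "m (rk e (c e) (x e))"] xs unfolding initial_def by metis
      then show ?thesis using mem False unfolding M_def by simp
    qed
  qed
  then have dc: "down_closed (insert e T) (block (insert e T) c) M" .
  have "card M \<le> card (block (insert e T) c)"
    by (rule card_mono[OF fin_block[OF T(2)] MB])
  note lin' = fin_block[OF T(2)] linear_block[OF insert_not_empty T(2)]
  have "card M = card (seg (block (insert e T) c) (L (insert e T)) (card M))"
    by (rule card_seg[OF lin' \<open>card M \<le> card (block (insert e T) c)\<close>, symmetric])
  then have "weight (insert e T) M \<le> best (insert e T) c (card M)"
    unfolding best_def
    by (intro block_optimal[OF insert_not_empty T(2) dc initial_seg[OF lin']])
  then show "(\<Sum>r\<in>{1..card (part e (c e))}. best T c (m r) + f e (nth_in_part e (c e) r) * m r) \<le>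
      best (insert e T) c (\<Sum>r\<in>{1..card (part e (c e))}. m r)"
    using cw by simp
  show "(\<Sum>r\<in>{1..card (part e (c e))}. m r) \<le> card (block (insert e T) c)"
    using cw \<open>card M \<le> card (block (insert e T) c)\<close> by simp
qed

text \<open>\<open>shift_layers\<close> is applied to the sizes of the layers along
  \<open>e\<close>: \<open>tr\<close> provides the gain inside a pair of layers, \<open>f_le\<close>
  and \<open>f_mono\<close> compare the degrees at coordinate \<open>e\<close>. The resulting sizes
  are nonincreasing, so \<open>stack\<close> replaces each pile by an initial segment. The lemma
  serves twice: for initial segments in the induction on coordinates, and in the last step for the
  traces of \<open>A\<close>, which are only layered.\<close>

lemma transfer_layers:
  assumes T: "T \<noteq> {}" "insert e T \<subseteq> {1..d}" "e \<notin> T" and ij: "i \<in> T" "j \<in> T"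
    and z: "card (part e (sx e)) = card (part e (sy e))"
    and f_le: "\<And>u v. u \<in> part e (sx e) \<Longrightarrow> v \<in> part e (sy e) \<Longrightarrow>
        rk e (sx e) u = rk e (sy e) v \<Longrightarrow> f e u \<le> f e v"
    and e_less: "e \<le> d - 1"
    and tr: "transferable T i j sy sx"
    and M: "layered e T sy M" and N: "layered e T sx N"
    and disj: "\<And>x y. x \<in> N \<Longrightarrow> y \<in> block (insert e T) sy - M \<Longrightarrow> x i \<noteq> y i \<and> x j \<noteq> y j"
  defines "s \<equiv> min (card N) (card (block (insert e T) sy) - card M)"
  shows "weight (insert e T) M + weight (insert e T) N \<le>
      best (insert e T) sy (card M + s) + best (insert e T) sx (card N - s)"
proof -
  have e: "e \<in> {1..d}" and TD: "T \<subseteq> {1..d}" using T by auto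
  define z where "z = card (part e (sy e))"
  define y where "y = card (block T sy)"
  define m where "m r = card (layer e T M (nth_in_part e (sy e) r))" for r
  define n where "n r = card (layer e T N (nth_in_part e (sx e) r))" for r
  \<comment> \<open>The premise of \<open>transferable\<close> as a relation between layer sizes. It
    becomes weaker when \<open>a\<close> grows or \<open>b\<close> shrinks, as
    \<open>shift_layers\<close> demands, and it must hold for layers at different heights because
    points may change their height.\<close>
  define R where "R a b \<longleftrightarrow> b \<le> card (block T sx) \<and>
     (\<forall>x\<in>seg (block T sx) (L T) b. \<forall>y\<in>block T sy - seg (block T sy) (L T) a. x i \<noteq> y i \<and> x j \<noteq> y j)"
    for a b
  have zx: "card (part e (sx e)) = z" using z unfolding z_def by simp
  have MB: "M \<subseteq> block (insert e T) sy" and NB: "N \<subseteq> block (insert e T) sx"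
    using M N unfolding layered_def by auto
  have layM: "layer e T M u = seg (block T sy) (L T) (card (layer e T M u))" if "u \<in> part e (sy e)" for u
    using initial_eq_seg[OF fin_block[OF TD] linear_block[OF T(1) TD]] M that unfolding layered_def by blast
  have layN: "layer e T N u = seg (block T sx) (L T) (card (layer e T N u))" if "u \<in> part e (sx e)" for u
    using initial_eq_seg[OF fin_block[OF TD] linear_block[OF T(1) TD]] N that unfolding layered_def by blast
  have layM': "layer e T M u = seg (block T sy) (L T) (m (rk e (sy e) u))" if "u \<in> part e (sy e)" for u
    using layM[OF that] nth_rk[OF e that] unfolding m_def by simp
  have layN': "layer e T N u = seg (block T sx) (L T) (n (rk e (sx e) u))" if "u \<in> part e (sx e)" for u
    using layN[OF that] nth_rk[OF e that] unfolding n_def by simp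
  have m_le: "m r \<le> card (block T sy)" and n_le: "n r \<le> card (block T sx)" for r
    unfolding m_def n_def
    using card_mono[OF fin_block[OF TD] layer_subset[OF MB T(3)]]
      card_mono[OF fin_block[OF TD] layer_subset[OF NB T(3)]] by auto
  have cwM: "card M = (\<Sum>r\<in>{1..z}. m r)"
      "weight (insert e T) M = (\<Sum>r\<in>{1..z}. best T sy (m r) + f e (nth_in_part e (sy e) r) * m r)"
    unfolding z_def
    using card_weight_layers[OF T MB, where m = m] layM' m_le by blast+
  have cwN: "card N = (\<Sum>r\<in>{1..z}. n r)"
      "weight (insert e T) N = (\<Sum>r\<in>{1..z}. best T sx (n r) + f e (nth_in_part e (sx e) r) * n r)"
    unfolding zx[symmetric]
    using card_weight_layers[OF T NB, where m = n] layN' n_le by blast+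
  have finl: "finite (layer e T K u)" for K u
    by (rule finite_subset[OF _ fin_PiE[OF TD]]) (auto simp: layer_def)
  have "\<exists>m' n'. redistribution z y (best T sy) (best T sx) (\<lambda>r. f e (nth_in_part e (sy e) r))
      (\<lambda>r. f e (nth_in_part e (sx e) r)) m n m' n'"
  proof (rule shift_layers[where R = R])
    show "best T sy a + best T sx b \<le>
        best T sy (a + min b (y - a)) + best T sx (b - min b (y - a))" if "a \<le> y" "R a b" for a b
      using tr that unfolding transferable_def R_def y_def Let_def by blast
    show "R a' b'" if "R a b" "a \<le> a'" "b' \<le> b" for a b a' b'
      using that seg_mono[of b' b "block T sx" "L T"] seg_mono[of a a' "block T sy" "L T"]
      unfolding R_def by (meson Diff_iff le_trans subsetD)
    fix r q assume r: "1 \<le> r" "r \<le> q" "q \<le> z"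
    have ry: "nth_in_part e (sy e) r \<in> part e (sy e)" "nth_in_part e (sy e) q \<in> part e (sy e)"
      using nth_part[OF e] r unfolding z_def by auto
    have rx: "nth_in_part e (sx e) r \<in> part e (sx e)" "nth_in_part e (sx e) q \<in> part e (sx e)"
      using nth_part[OF e, of _ "sx e"] r unfolding zx by auto
    have oy: "ord e (nth_in_part e (sy e) r) \<le> ord e (nth_in_part e (sy e) q)"
      using ord_nth_mono[OF e r(1,2), of "sy e"] r(3) unfolding z_def by simp
    have ox: "ord e (nth_in_part e (sx e) r) \<le> ord e (nth_in_part e (sx e) q)"
      using ord_nth_mono[OF e r(1,2), of "sx e"] r(3) zx by simp
    show "f e (nth_in_part e (sy e) r) \<le> f e (nth_in_part e (sy e) q)"
      by (rule f_mono[OF _ _ _ _ oy]) (use e e_less ry in \<open>auto simp: part_def\<close>)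
    show "m q \<le> m r" unfolding m_def
      by (rule card_mono[OF finl]) (use M ry oy in \<open>auto simp: layered_def\<close>)
    show "n q \<le> n r" unfolding n_def
      by (rule card_mono[OF finl]) (use N rx ox in \<open>auto simp: layered_def\<close>)
  next
    fix r assume r: "1 \<le> r" "r \<le> z"
    have ry: "r \<in> {1..card (part e (sy e))}" and rx: "r \<in> {1..card (part e (sx e))}"
      using r zx unfolding z_def by auto
    show "f e (nth_in_part e (sx e) r) \<le> f e (nth_in_part e (sy e) r)"
      by (rule f_le[OF nth_part[OF e rx] nth_part[OF e ry]]) (simp only: rk_nth[OF e rx] rk_nth[OF e ry])
  next
    show "m r \<le> y" for r using m_le unfolding y_def .
    fix r q assume r: "r \<in> {1..z}" and q: "q \<in> {1..z}"
    define u where "u = nth_in_part e (sy e) r"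
    define v where "v = nth_in_part e (sx e) q"
    have u: "u \<in> part e (sy e)" and v: "v \<in> part e (sx e)"
      using nth_part[OF e] r q zx unfolding u_def v_def z_def by auto
    \<comment> \<open>Two points over \<open>T\<close> are lifted to the heights \<open>v\<close>
      and \<open>u\<close>. Since \<open>e\<close> is neither \<open>i\<close> nor \<open>j\<close>,
      the disagreement of the lifted points is one of the original points.\<close>
    show "R (m r) (n q)" unfolding R_def
    proof (intro conjI n_le ballI)
      fix x w assume x: "x \<in> seg (block T sx) (L T) (n q)"
        and w: "w \<in> block T sy - seg (block T sy) (L T) (m r)"
      have "x \<in> layer e T N v" using layN[OF v] x unfolding n_def v_def[symmetric] by simp
      then have "x(e := v) \<in> N" unfolding layer_def by simp
      moreover have "w \<notin> layer e T M u" using layM[OF u] w unfolding m_def u_def[symmetric] by simp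
      then have "w(e := u) \<notin> M" using w block_subset[of T sy] unfolding layer_def by auto
      moreover have "w(e := u) \<in> block (insert e T) sy" using update_block[of w T sy u e, OF _ u] w by blast
      ultimately have "(x(e := v)) i \<noteq> (w(e := u)) i \<and> (x(e := v)) j \<noteq> (w(e := u)) j"
        using disj by blast
      then show "x i \<noteq> w i" "x j \<noteq> w j" using ij T(3) by (auto split: if_splits)
    qed
  qed
  then obtain m' n' where red: "redistribution z y (best T sy) (best T sx) (\<lambda>r. f e (nth_in_part e (sy e) r))
      (\<lambda>r. f e (nth_in_part e (sx e) r)) m n m' n'" by blast
  define a where "a = (\<Sum>r\<in>{1..z}. m' r)"
  define b where "b = (\<Sum>r\<in>{1..z}. n' r)"
  have m': "m' r \<le> y" and n': "n' r \<le> n r" if "r \<in> {1..z}" for r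
    using red that unfolding redistribution_def by blast+
  have m'_dec: "m' q \<le> m' r" and n'_dec: "n' q \<le> n' r" if "1 \<le> r" "r \<le> q" "q \<le> z" for r q
    using red that unfolding redistribution_def by blast+
  have m'y: "m' r \<le> card (block T sy)" if "r \<in> {1..card (part e (sy e))}" for r
    using m' that unfolding z_def y_def by blast
  have n'x: "n' r \<le> card (block T sx)" if "r \<in> {1..card (part e (sx e))}" for r
    using n'[of r] n_le[of r] that zx by simp
  have a1: "(\<Sum>r\<in>{1..z}. best T sy (m' r) + f e (nth_in_part e (sy e) r) * m' r) \<le> best (insert e T) sy a"
    and a2: "a \<le> card (block (insert e T) sy)"
    using stack[OF T m'y m'_dec[unfolded z_def]] unfolding a_def z_def by auto
  have b1: "(\<Sum>r\<in>{1..z}. best T sx (n' r) + f e (nth_in_part e (sx e) r) * n' r) \<le> best (insert e T) sx b"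
    using stack(1)[OF T n'x n'_dec[folded zx]] unfolding b_def zx by auto
  have tot: "a + b = card M + card N"
    using red unfolding redistribution_def cwM(1) cwN(1) a_def b_def sum.distrib by blast
  \<comment> \<open>Since either the upper block is emptied or the lower one is filled, and the
    total is kept, the final sizes can only be those of moving \<open>s\<close> points.\<close>
  have ends: "b = 0 \<or> a = card (block (insert e T) sy)"
  proof -
    have "(\<forall>r\<in>{1..z}. n' r = 0) \<or> (\<forall>r\<in>{1..z}. m' r = y)"
      using red unfolding redistribution_def by (elim conjE) assumption
    then show ?thesis
    proof
      assume "\<forall>r\<in>{1..z}. m' r = y"
      then have "a = z * y" unfolding a_def by simp
      then show ?thesis using card_block_insert[OF T, of sy] unfolding z_def y_def by simp
    qed (simp add: b_def)
  qed
  have cM: "card M \<le> card (block (insert e T) sy)" by (rule card_mono[OF fin_block[OF T(2)] MB])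
  have "a = card M + s" "b = card N - s" using ends tot a2 cM unfolding s_def by auto
  moreover have "weight (insert e T) M + weight (insert e T) N \<le>
      best (insert e T) sy a + best (insert e T) sx b"
  proof -
    have "weight (insert e T) M + weight (insert e T) N =
      (\<Sum>r\<in>{1..z}. best T sy (m r) + f e (nth_in_part e (sy e) r) * m r + best T sx (n r) + f e (nth_in_part e (sx e) r) * n r)"
      unfolding cwM(2) cwN(2) sum.distrib by simp
    also have "\<dots> \<le> (\<Sum>r\<in>{1..z}. best T sy (m' r) + f e (nth_in_part e (sy e) r) * m' r + best T sx (n' r) +
        f e (nth_in_part e (sx e) r) * n' r)"
      using red unfolding redistribution_def by blast
    also have "\<dots> = (\<Sum>r\<in>{1..z}. best T sy (m' r) + f e (nth_in_part e (sy e) r) * m' r) +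
        (\<Sum>r\<in>{1..z}. best T sx (n' r) + f e (nth_in_part e (sx e) r) * n' r)"
      by (simp add: sum.distrib)
    also have "\<dots> \<le> best (insert e T) sy a + best (insert e T) sx b" using a1 b1 by simp
    finally show ?thesis .
  qed
  ultimately show ?thesis by simp
qed

text \<open>Read with \<open>c\<close> in the upper and \<open>c'\<close> in the lower block:
  replacing the part while keeping the rank inside it does not lower the degree at this
  coordinate.\<close>

definition comparable :: "nat \<Rightarrow> nat \<Rightarrow> nat \<Rightarrow> bool" where
  "comparable e c c' \<longleftrightarrow> card (part e c) = card (part e c') \<and>
     (\<forall>u\<in>part e c. \<forall>v\<in>part e c'. rk e c u = rk e c' v \<longrightarrow> f e u \<le> f e v)"

lemma comparable_refl: "e \<in> {1..d} \<Longrightarrow> comparable e c c"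
  unfolding comparable_def using bij_rk[of e c] by (auto simp: bij_betw_def inj_on_def)

lemma transferable_insert:
  assumes T: "T \<noteq> {}" "insert e T \<subseteq> {1..d}" "e \<notin> T" and ij: "i \<in> T" "j \<in> T"
    and cmp: "comparable e (sx e) (sy e)" and e_less: "e \<le> d - 1"
    and tr: "transferable T i j sy sx"
  shows "transferable (insert e T) i j sy sx"
  unfolding transferable_def Let_def
proof (intro allI impI)
  let ?T = "insert e T"
  fix a b assume a: "a \<le> card (block ?T sy)" and b: "b \<le> card (block ?T sx)"
    and disj: "\<forall>x\<in>seg (block ?T sx) (L ?T) b.
      \<forall>y\<in>block ?T sy - seg (block ?T sy) (L ?T) a. x i \<noteq> y i \<and> x j \<noteq> y j"
  note lin = fin_block[OF T(2)] linear_block[OF insert_not_empty T(2)]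
  have lay: "layered e T c (seg (block ?T c) (L ?T) k)" for c k
  proof (rule layeredI[OF T seg_subset])
    fix x y assume "x \<in> seg (block ?T c) (L ?T) k" "y \<in> block ?T c" "L ?T y x"
    then show "y \<in> seg (block ?T c) (L ?T) k"
      using initial_seg[OF lin, of c k] unfolding initial_def by blast
  qed
  have "weight ?T (seg (block ?T sy) (L ?T) a) + weight ?T (seg (block ?T sx) (L ?T) b) \<le>
    best ?T sy (card (seg (block ?T sy) (L ?T) a) + min (card (seg (block ?T sx) (L ?T) b))
      (card (block ?T sy) - card (seg (block ?T sy) (L ?T) a))) +
    best ?T sx (card (seg (block ?T sx) (L ?T) b) - min (card (seg (block ?T sx) (L ?T) b))
      (card (block ?T sy) - card (seg (block ?T sy) (L ?T) a)))"
  proof (rule transfer_layers[OF T ij _ _ e_less tr lay lay])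
    show "card (part e (sx e)) = card (part e (sy e))" using cmp unfolding comparable_def by blast
    show "f e u \<le> f e v" if "u \<in> part e (sx e)" "v \<in> part e (sy e)" "rk e (sx e) u = rk e (sy e) v" for u v
      using cmp that unfolding comparable_def by blast
    show "x i \<noteq> y i \<and> x j \<noteq> y j" if "x \<in> seg (block ?T sx) (L ?T) b"
      "y \<in> block ?T sy - seg (block ?T sy) (L ?T) a" for x y
      using disj that by blast
  qed
  then show "best ?T sy a + best ?T sx b \<le>
      best ?T sy (a + min b (card (block ?T sy) - a)) + best ?T sx (b - min b (card (block ?T sy) - a))"
    unfolding card_seg[OF lin a] card_seg[OF lin b] best_def .
qed

lemma transferable_superset:
  assumes tr: "transferable {i, j} i j sy sx" and T: "{i, j} \<subseteq> T" "T \<subseteq> {1..d}"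
    and cmp: "\<And>e. e \<in> T - {i, j} \<Longrightarrow> comparable e (sx e) (sy e) \<and> e \<le> d - 1"
  shows "transferable T i j sy sx"
proof -
  have "transferable (U \<union> {i, j}) i j sy sx" if "finite U" "U \<subseteq> T - {i, j}" for U
    using that
  proof (induction U rule: finite_induct)
    case (insert e U)
    have "transferable (insert e (U \<union> {i, j})) i j sy sx"
      by (rule transferable_insert) (use insert T cmp[of e] in auto)
    then show ?case by (metis Un_insert_left)
  qed (use tr in simp)
  moreover have "finite (T - {i, j})" using T(2) finite_subset by auto
  moreover have "T - {i, j} \<union> {i, j} = T" using T(1) by blast
  ultimately show ?thesis by (metis order_refl)
qed

section \<open>Sets made of two consecutive blocks\<close>

definition below :: "nat set \<Rightarrow> (nat \<Rightarrow> 'a) set \<Rightarrow> (nat \<Rightarrow> nat) \<Rightarrow> (nat \<Rightarrow> 'a) set" where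
  "below T S t = {y \<in> S. key_less T (key y) t}"

lemma block_key_less: "x \<in> block T c \<Longrightarrow> key_less T (key x) t = key_less T c t"
  "x \<in> block T c \<Longrightarrow> key_less T t (key x) = key_less T t c"
  by (rule key_less_cong; simp add: mem_block_iff)+

lemma initial_below:
  assumes T: "T \<noteq> {}" "T \<subseteq> {1..d}" and S: "S \<subseteq> PiE T V" "block T t \<subseteq> S"
    and N: "initial (block T t) (L T) N"
  shows "initial S (L T) (below T S t \<union> N)"
  unfolding initial_def
proof (intro conjI ballI impI)
  have NB: "N \<subseteq> block T t" using N unfolding initial_def by blast
  show "below T S t \<union> N \<subseteq> S" using NB S unfolding below_def by blast
  fix x y assume x: "x \<in> below T S t \<union> N" and y: "y \<in> S" and yx: "L T y x"
  have xS: "x \<in> S" using x NB S unfolding below_def by blast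
  have xV: "x \<in> PiE T V" and yV: "y \<in> PiE T V" using xS y S by auto
  show "y \<in> below T S t \<union> N"
  proof (cases "\<exists>e\<in>T. key y e \<noteq> key x e")
    case True
    then have less: "key_less T (key y) (key x)" using L_iff_key_less[OF T(2) yV xV] yx by blast
    have "key_less T (key y) t"
    proof (cases "x \<in> N")
      case True
      then show ?thesis using less block_key_less(2)[of x T t] NB by blast
    next
      case False
      then show ?thesis using less x key_less_trans[of T "key y" "key x" t] unfolding below_def by blast
    qed
    then show ?thesis using y unfolding below_def by blast
  next
    case False
    then have eq: "key_less T (key y) t = key_less T (key x) t" by (intro key_less_cong) auto
    show ?thesis
    proof (cases "x \<in> N")
      case True
      then have "y \<in> block T t" using False NB yV by (auto simp: mem_block_iff)
      then show ?thesis using N True yx unfolding initial_def by blast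
    next
      case False
      then show ?thesis using x y eq unfolding below_def by blast
    qed
  qed
qed

lemma below_next_block:
  assumes T: "T \<subseteq> {1..d}" and S: "S \<subseteq> PiE T V" "block T sy \<subseteq> S"
    and less: "key_less T sy sx"
    and gap: "\<And>w. w \<in> S \<Longrightarrow> key_less T sy (key w) \<Longrightarrow> key_less T (key w) sx \<Longrightarrow> False"
  shows "below T S sx = below T S sy \<union> block T sy"
proof
  have fT: "finite T" using finite_subset[OF T] by simp
  show "below T S sx \<subseteq> below T S sy \<union> block T sy"
  proof
    fix y assume "y \<in> below T S sx"
    then have y: "y \<in> S" "key_less T (key y) sx" unfolding below_def by auto
    show "y \<in> below T S sy \<union> block T sy"
    proof (cases "\<exists>e\<in>T. key y e \<noteq> sy e")
      case True
      then have "key_less T (key y) sy" using key_less_total[OF fT, of _ "key y" sy] gap[OF y(1)] y(2) by blast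
      then show ?thesis using y(1) unfolding below_def by blast
    next
      case False
      then show ?thesis using y(1) S(1) by (auto simp: mem_block_iff)
    qed
  qed
  show "below T S sy \<union> block T sy \<subseteq> below T S sx"
    using less S(2) block_key_less(1) key_less_trans[OF _ less] unfolding below_def by blast
qed

text \<open>If points remain in the upper block, then the lower one has been filled, and since no
  block of \<open>S\<close> lies between the two, everything below the upper block is
  present.\<close>

lemma initial_two_blocks:
  fixes a b :: nat
  assumes T: "T \<noteq> {}" "T \<subseteq> {1..d}"
    and S: "S \<subseteq> PiE T V" "block T sy \<subseteq> S" "block T sx \<subseteq> S"
    and less: "key_less T sy sx"
    and gap: "\<And>w. w \<in> S \<Longrightarrow> key_less T sy (key w) \<Longrightarrow> key_less T (key w) sx \<Longrightarrow> False"
    and a: "a \<le> card (block T sy)"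
  defines "s \<equiv> min b (card (block T sy) - a)"
  shows "initial S (L T) (below T S sy \<union> seg (block T sy) (L T) (a + s) \<union> seg (block T sx) (L T) (b - s))"
proof -
  note lin = fin_block[OF T(2)] linear_block[OF T]
  show ?thesis
  proof (cases "b - s = 0")
    case True
    then show ?thesis using initial_below[OF T S(1,2) initial_seg[OF lin]] by simp
  next
    case False
    then have "a + s = card (block T sy)" using a unfolding s_def by auto
    then have "below T S sy \<union> seg (block T sy) (L T) (a + s) = below T S sx"
      using seg_card[OF lin] below_next_block[OF T(2) S(1,2) less gap] by simp
    then show ?thesis using initial_below[OF T S(1,3) initial_seg[OF lin]] by simp
  qed
qed

lemma fin_below: "T \<subseteq> {1..d} \<Longrightarrow> S \<subseteq> PiE T V \<Longrightarrow> finite (below T S t)"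
  by (rule finite_subset[OF _ fin_PiE[of T]]) (auto simp: below_def)

lemma sum_three_parts:
  fixes h :: "(nat \<Rightarrow> 'a) \<Rightarrow> nat"
  assumes T: "T \<subseteq> {1..d}" and S: "S \<subseteq> PiE T V" and less: "key_less T sy sx"
    and M: "M \<subseteq> block T sy" and N: "N \<subseteq> block T sx"
  shows "sum h (below T S sy \<union> M \<union> N) = sum h (below T S sy) + sum h M + sum h N"
proof -
  have irr: "\<not> key_less T s s" for s using key_less_irrefl by blast
  have "False" if "x \<in> block T sy" "x \<in> block T sx" for x
    using that block_key_less(1)[of x T sy sx] block_key_less(1)[of x T sx sx] less irr by blast
  then have "M \<inter> N = {}" using M N by blast
  moreover have "below T S sy \<inter> M = {}"
    using M block_key_less(1)[of _ T sy sy] irr unfolding below_def by blast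
  moreover have "below T S sy \<inter> N = {}"
    using N block_key_less(1)[of _ T sx sy] key_less_trans[OF less, of sy] irr unfolding below_def by blast
  moreover have "finite M" "finite N"
    using finite_subset[OF M fin_block[OF T]] finite_subset[OF N fin_block[OF T]] by auto
  moreover note fin_below[OF T S, of sy]
  ultimately show ?thesis by (simp add: sum.union_disjoint Int_Un_distrib2)
qed

lemma weight_two_blocks:
  assumes T: "T \<subseteq> {1..d}" and S: "S \<subseteq> PiE T V" and less: "key_less T sy sx"
    and M: "M \<subseteq> block T sy" and N: "N \<subseteq> block T sx"
  shows "weight T (below T S sy \<union> M \<union> N) = weight T (below T S sy) + weight T M + weight T N"
    and "card (below T S sy \<union> M \<union> N) = card (below T S sy) + card M + card N"
  unfolding weight_def by (rule sum_three_parts[OF assms])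
    (use sum_three_parts[OF assms, of "\<lambda>_. 1"] in simp)

text \<open>Both the configuration before the move and the one after it are completed by all points
  below the lower block. The second becomes initial and the first closed under lowering a
  coordinate; \<open>pair_optimal\<close> compares the two, and the common part cancels.\<close>

lemma transferable_pair:
  assumes ij: "1 \<le> i" "i < j" "j \<le> d" and less: "key_less {i, j} sy sx"
    and gap: "\<And>w. w \<in> PiE {i, j} V \<Longrightarrow> key_less {i, j} sy (key w) \<Longrightarrow> key_less {i, j} (key w) sx \<Longrightarrow> False"
  shows "transferable {i, j} i j sy sx"
  unfolding transferable_def Let_def
proof (intro allI impI)
  let ?T = "{i, j}" and ?Y = "block {i, j} sy" and ?X = "block {i, j} sx"
  fix a b assume a: "a \<le> card ?Y" and b: "b \<le> card ?X"
    and disj: "\<forall>x\<in>seg ?X (L ?T) b. \<forall>y\<in>?Y - seg ?Y (L ?T) a. x i \<noteq> y i \<and> x j \<noteq> y j"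
  have T: "?T \<noteq> {}" "?T \<subseteq> {1..d}" using ij by auto
  note lin = fin_block[OF T(2)] linear_block[OF T]
  define s where "s = min b (card ?Y - a)"
  define Lo where "Lo = below ?T (PiE ?T V) sy"
  define W where "W = Lo \<union> seg ?Y (L ?T) a \<union> seg ?X (L ?T) b"
  define W' where "W' = Lo \<union> seg ?Y (L ?T) (a + s) \<union> seg ?X (L ?T) (b - s)"
  have as: "a + s \<le> card ?Y" and bs: "b - s \<le> card ?X" using a b unfolding s_def by auto
  have W': "initial (PiE ?T V) (L ?T) W'"
    unfolding W'_def Lo_def s_def
    by (rule initial_two_blocks[OF T subset_refl block_subset block_subset less gap a])
  have low: "initial (PiE ?T V) (L ?T) (Lo \<union> seg ?Y (L ?T) a)"
    unfolding Lo_def by (rule initial_below[OF T subset_refl block_subset initial_seg[OF lin]])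
  have nextb: "below ?T (PiE ?T V) sx = Lo \<union> ?Y"
    unfolding Lo_def by (rule below_next_block[OF T(2) subset_refl block_subset less gap])
  have up: "initial (PiE ?T V) (L ?T) (Lo \<union> ?Y \<union> seg ?X (L ?T) b)"
    using initial_below[OF T subset_refl block_subset initial_seg[OF lin], of sx b] unfolding nextb .
  have "down_closed ?T (PiE ?T V) W"
    unfolding down_closed_def
  proof (intro conjI ballI impI)
    show WV: "W \<subseteq> PiE ?T V"
      using low up unfolding W_def initial_def by blast
    fix x k u assume x: "x \<in> W" and k: "k \<in> ?T" and u: "u \<in> V k" and lt: "ord k u < ord k (x k)"
      and mem: "x(k := u) \<in> PiE ?T V"
    have Lx: "L ?T (x(k := u)) x" using L_coord[OF T(2) subsetD[OF WV x], of k u] k u lt by blast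
    show "x(k := u) \<in> W"
    proof (cases "x \<in> Lo \<union> seg ?Y (L ?T) a")
      case True
      then show ?thesis using low mem Lx unfolding initial_def W_def by blast
    next
      case False
      then have xX: "x \<in> seg ?X (L ?T) b" using x unfolding W_def by blast
      then have "x(k := u) \<in> Lo \<union> ?Y \<union> seg ?X (L ?T) b"
        using up mem Lx unfolding initial_def by blast
      \<comment> \<open>Lowering one of the two coordinates keeps the other, whereas a missing point
        of the lower block would differ from \<open>x\<close> in both.\<close>
      moreover have "x(k := u) \<in> seg ?Y (L ?T) a" if "x(k := u) \<in> ?Y"
      proof (rule ccontr)
        assume "x(k := u) \<notin> seg ?Y (L ?T) a"
        then have "x i \<noteq> (x(k := u)) i \<and> x j \<noteq> (x(k := u)) j" using disj xX that by blast
        then show False using k ij(2) by auto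
      qed
      ultimately show ?thesis unfolding W_def by blast
    qed
  qed
  note two = weight_two_blocks[OF T(2) subset_refl less seg_subset seg_subset, folded Lo_def]
  have "card W = card W'"
    unfolding W_def W'_def two(2) card_seg[OF lin a] card_seg[OF lin b] card_seg[OF lin as] card_seg[OF lin bs]
    unfolding s_def by simp
  then have "weight ?T W \<le> weight ?T W'"
    by (rule pair_optimal[OF ij \<open>down_closed ?T (PiE ?T V) W\<close> W'])
  then show "best ?T sy a + best ?T sx b \<le>
      best ?T sy (a + min b (card ?Y - a)) + best ?T sx (b - min b (card ?Y - a))"
    unfolding W_def W'_def two(1) best_def s_def by simp
qed

end

section \<open>Weight comparison in a single slice\<close>

locale regular_block_system = optimal_block_system +
  assumes regular: "e \<in> {2..d - 1} \<Longrightarrow> u \<in> V e \<Longrightarrow> v \<in> V e \<Longrightarrow>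
      (\<And>w. w \<in> V e \<Longrightarrow> st e u \<le> st e w) \<Longrightarrow> (\<And>w. w \<in> V e \<Longrightarrow> st e w \<le> st e v) \<Longrightarrow>
      comparable e (st e u) (st e v)"
begin

text \<open>The block of the greatest vertex \<open>x0\<close> of \<open>A\<close> in the slice is
  the last one meeting \<open>A\<close>. If all earlier blocks of the slice are full, the filling
  rearranges \<open>A\<close> inside that block only and \<open>block_optimal\<close> suffices.
  Otherwise exactly one earlier block is deficient, and points have to cross to it.\<close>

lemma weight_slice_le:
  assumes A: "strongly_closed A"
  shows "weight {1..d} (A \<inter> slice c) \<le> weight {1..d} (slice_fill A \<inter> slice c)"
proof (cases "A \<inter> slice c = {}")
  case True
  then show ?thesis by (simp add: weight_def)
next
  case nonempty: False
  let ?D = "{1..d}"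
  have D: "?D \<noteq> {}" "?D \<subseteq> {1..d}" using d3 by auto
  have scA: "y \<in> A" if "x \<in> A" "y \<in> PiE ?D V" "L ?D y x" "e \<in> ?D" "y e = x e" for x y e
    using A that unfolding strongly_closed_def by blast
  have AV: "A \<subseteq> PiE ?D V" using A unfolding strongly_closed_def by blast
  have slV: "x \<in> slice c \<Longrightarrow> x \<in> PiE ?D V" for x using slice_subset by blast
  have sl1: "x \<in> slice c \<Longrightarrow> key x 1 = c" for x unfolding slice_def key_def by blast
  have slI: "x \<in> PiE ?D V \<Longrightarrow> key x 1 = c \<Longrightarrow> x \<in> slice c" for x unfolding slice_def key_def by blast
  have finA: "finite (A \<inter> slice c)" using fin_slice by blast
  have "strict_linear_on (A \<inter> slice c) (L ?D)"
    using strict_linear_on_subset[OF linear_slice] by blast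
  then obtain x0 where x0: "x0 \<in> A" "x0 \<in> slice c"
    and x0_max: "\<And>x. x \<in> A \<Longrightarrow> x \<in> slice c \<Longrightarrow> x \<noteq> x0 \<Longrightarrow> L ?D x x0"
    using strict_linear_on_max[OF finA nonempty] by blast
  define sx where "sx = key x0"
  let ?X = "block ?D sx"
  have fD: "finite ?D" by simp
  note lin = fin_block[OF D(2)] linear_block[OF D]
  have not_above: "\<not> key_less ?D sx (key x)" if x: "x \<in> A" "x \<in> slice c" for x
  proof
    assume "key_less ?D sx (key x)"
    moreover from this have "x \<noteq> x0" using key_less_irrefl unfolding sx_def by blast
    ultimately show False
      using L_key'[OF D(2) slV[OF x0(2)] slV[OF x(2)]] x0_max[OF x]
        asym[OF D slV[OF x(2)] slV[OF x0(2)]] unfolding sx_def by blast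
  qed
  have blk_slice: "block ?D t \<subseteq> slice c" if "t 1 = c" for t
    using that slI one_le_d by (auto simp: mem_block_iff)
  have X_slice: "?X \<subseteq> slice c" using blk_slice sl1[OF x0(2)] unfolding sx_def by blast
  have upd: "x(e := v) \<in> slice c" if "x \<in> slice c" "e \<in> ?D" "e \<noteq> 1" "v \<in> V e" for x e v
    using update_PiE[OF slV[OF that(1)] that(2,4)] that(1,3) unfolding slice_def by simp
  have no_gap0: False if y: "y \<in> slice c" "y \<notin> A" and w: "w \<in> slice c"
    and yw: "key_less ?D (key y) (key w)" and wx: "key_less ?D (key w) sx"
    and e: "e \<in> ?D" "e \<noteq> 1" "key w e = key y e \<or> key w e = sx e" for y w e
  proof -
    \<comment> \<open>Within its block, \<open>w\<close> can be moved to a point \<open>v\<close> sharing a coordinate with \<open>x0\<close> and another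
      one with \<open>y\<close>; then \<open>x0 \<in> A\<close> forces \<open>v \<in> A\<close>, and \<open>v \<in> A\<close> forces \<open>y \<in> A\<close>.\<close>
    define e1 e2 where "e1 = (if key w e = key y e then 1 else e)"
      and "e2 = (if key w e = key y e then e else 1)"
    define v where "v = w(e1 := x0 e1, e2 := y e2)"
    have e12: "e1 \<in> ?D" "e2 \<in> ?D" "e1 \<noteq> e2" using e one_le_d unfolding e1_def e2_def by auto
    have vV: "v \<in> PiE ?D V"
      unfolding v_def by (intro update_PiE slV w e12 PiE_mem[OF slV])
        (use x0(2) y(1) e12 PiE_mem[OF slV] in auto)
    have kv: "key v k = key w k" for k
      using e(3) sl1[OF x0(2)] sl1[OF y(1)] sl1[OF w]
      unfolding v_def e1_def e2_def key_def sx_def by auto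
    have "L ?D v x0"
      by (rule L_key'[OF D(2) vV slV[OF x0(2)]]) (use wx kv in \<open>simp add: sx_def key_less_def\<close>)
    then have "v \<in> A" using scA[OF x0(1) vV _ e12(1)] e12(3) unfolding v_def by simp
    moreover have "L ?D y v"
      by (rule L_key'[OF D(2) slV[OF y(1)] vV]) (use yw kv in \<open>simp add: key_less_def\<close>)
    ultimately have "y \<in> A" using scA[OF _ slV[OF y(1)] _ e12(2)] unfolding v_def by simp
    then show False using y(2) by blast
  qed
  \<comment> \<open>This reduces to \<open>no_gap0\<close>. If at the first coordinate
    \<open>k\<close> where the keys of \<open>y\<close> and \<open>x0\<close> differ
    \<open>w\<close> agrees with neither, then replacing only coordinate \<open>k\<close> of
    \<open>y\<close> by that of \<open>w\<close> gives a vertex that still lies strictly between and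
    agrees with \<open>y\<close> at a third coordinate.\<close>
  have no_gap: False if y: "y \<in> slice c" "y \<notin> A" and w: "w \<in> slice c"
    and yw: "key_less ?D (key y) (key w)" and wx: "key_less ?D (key w) sx" for y w
  proof -
    have "key_less ?D (key y) sx" by (rule key_less_trans[OF yw wx])
    then obtain k where k: "k \<in> ?D" "\<And>e. e \<in> ?D \<Longrightarrow> e < k \<Longrightarrow> key y e = sx e" "key y k < sx k"
      unfolding key_less_def by blast
    have k1: "k \<noteq> 1" using k(3) sl1[OF y(1)] sl1[OF x0(2)] unfolding sx_def by auto
    show False
    proof (cases "key w k = key y k \<or> key w k = sx k")
      case True
      then show False using no_gap0[OF y w yw wx k(1) k1] by blast
    next
      case False
      \<comment> \<open>Before \<open>k\<close> the keys of \<open>y\<close> and \<open>x0\<close>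
        coincide, so a key squeezed between them lexicographically coincides with them too.\<close>
      have weq: "key w e = key y e" if "e \<in> ?D" "e < k" for e
      proof (rule ccontr)
        assume ne: "key w e \<noteq> key y e"
        obtain l where l: "l \<in> ?D" "\<And>e. e \<in> ?D \<Longrightarrow> e < l \<Longrightarrow> key y e = key w e" "key y l < key w l"
          using yw unfolding key_less_def by blast
        obtain m where m: "m \<in> ?D" "\<And>e. e \<in> ?D \<Longrightarrow> e < m \<Longrightarrow> key w e = sx e" "key w m < sx m"
          using wx unfolding key_less_def by blast
        have "l \<le> e" using ne l(2) that(1) by (metis not_le)
        moreover have "m \<le> e" using ne m(2) that k(2) by (metis not_le)
        ultimately have lk: "l < k" "m < k" using that(2) by auto
        consider "l < m" | "m < l" | "m = l" by linarith
        then show False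
        proof cases
          case 1 then show False using l k(2)[OF l(1) lk(1)] m(2)[OF l(1)] by simp
        next
          case 2 then show False using m k(2)[OF m(1) lk(2)] l(2)[OF m(1)] by simp
        next
          case 3 then show False using m(3) l(3) k(2)[OF m(1) lk(2)] by simp
        qed
      qed
      have wk: "key y k < key w k" "key w k < sx k"
      proof -
        have "\<not> key w k < key y k"
        proof
          assume "key w k < key y k"
          then have "key_less ?D (key w) (key y)" using key_lessI[OF k(1)] weq by blast
          then show False using key_less_trans[OF yw] key_less_irrefl by blast
        qed
        moreover have "\<not> sx k < key w k"
        proof
          assume "sx k < key w k"
          then have "key_less ?D sx (key w)" using key_lessI[OF k(1), of sx] weq k(2) by metis
          then show False using key_less_trans[OF wx] key_less_irrefl by blast
        qed
        ultimately show "key y k < key w k" "key w k < sx k" using False by auto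
      qed
      obtain e where e: "e \<in> ?D" "e \<noteq> 1" "e \<noteq> k" using third_coordinate[of 1 k] by blast
      define v where "v = y(k := w k)"
      have v: "v \<in> slice c"
        unfolding v_def by (rule upd[OF y(1) k(1) k1 PiE_mem[OF slV[OF w] k(1)]])
      have "key_less ?D (key y) (key v)"
        by (rule key_lessI[OF k(1)]) (use wk in \<open>auto simp: v_def key_def\<close>)
      moreover have "key_less ?D (key v) sx"
        by (rule key_lessI[OF k(1)]) (use wk k(2) in \<open>auto simp: v_def key_def\<close>)
      moreover have "key v e = key y e" using e(3) by (simp add: v_def key_def)
      ultimately show False using no_gap0[OF y v _ _ e(1,2)] by blast
    qed
  qed
  show ?thesis
  proof (cases "below ?D (slice c) sx \<subseteq> A")
    case True
    have split: "A \<inter> slice c = below ?D (slice c) sx \<union> (A \<inter> ?X)"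
    proof
      show "A \<inter> slice c \<subseteq> below ?D (slice c) sx \<union> (A \<inter> ?X)"
      proof
        fix x assume x: "x \<in> A \<inter> slice c"
        show "x \<in> below ?D (slice c) sx \<union> (A \<inter> ?X)"
        proof (cases "\<exists>e\<in>?D. key x e \<noteq> sx e")
          case True
          then show ?thesis
            using key_less_total[OF fD, of _ "key x" sx] not_above[of x] x unfolding below_def by blast
        next
          case False
          then show ?thesis using x slV by (auto simp: mem_block_iff)
        qed
      qed
    qed (use True X_slice in \<open>auto simp: below_def\<close>)
    define n where "n = card (A \<inter> ?X)"
    have n: "n \<le> card ?X" unfolding n_def by (rule card_mono[OF lin(1)]) blast
    have disj: "below ?D (slice c) sx \<inter> N = {}" if "N \<subseteq> ?X" for N
    proof -
      have "\<not> key_less ?D sx sx" using key_less_irrefl by blast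
      then show ?thesis using that block_key_less(1)[of _ ?D sx sx] unfolding below_def by blast
    qed
    have fb: "finite (below ?D (slice c) sx)" by (rule fin_below[OF D(2) slice_subset])
    have fN: "finite N" if "N \<subseteq> ?X" for N using finite_subset[OF that lin(1)] .
    have sum2: "sum h (below ?D (slice c) sx \<union> N) = sum h (below ?D (slice c) sx) + sum h N"
      if "N \<subseteq> ?X" for N and h :: "(nat \<Rightarrow> 'a) \<Rightarrow> nat"
      by (rule sum.union_disjoint[OF fb fN[OF that] disj[OF that]])
    have AX: "A \<inter> ?X \<subseteq> ?X" by blast
    have "slice_fill A \<inter> slice c = below ?D (slice c) sx \<union> seg ?X (L ?D) n"
    proof (rule initial_eqI[OF fin_slice linear_slice initial_slice_fill])
      show "initial (slice c) (L ?D) (below ?D (slice c) sx \<union> seg ?X (L ?D) n)"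
        by (rule initial_below[OF D slice_subset X_slice initial_seg[OF lin]])
      show "card (slice_fill A \<inter> slice c) = card (below ?D (slice c) sx \<union> seg ?X (L ?D) n)"
        unfolding card_slice_fill_Int split
        using sum2[OF AX, of "\<lambda>_. 1"] sum2[OF seg_subset, of "\<lambda>_. 1" "L ?D" n]
          card_seg[OF lin n] by (simp add: n_def)
    qed
    moreover have "down_closed ?D ?X (A \<inter> ?X)"
      unfolding down_closed_def
    proof (intro conjI ballI impI)
      fix x e u assume x: "x \<in> A \<inter> ?X" and e: "e \<in> ?D" "u \<in> V e" "ord e u < ord e (x e)"
        and mem: "x(e := u) \<in> ?X"
      obtain e' where "e' \<in> ?D" "e' \<noteq> e" using third_coordinate[of e e] by blast
      moreover have "L ?D (x(e := u)) x"
        using L_coord[OF D(2), of x e u] e x AV by blast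
      moreover have "x(e := u) \<in> PiE ?D V" using mem block_subset by blast
      ultimately have "x(e := u) \<in> A" using scA[of x "x(e := u)" e'] x by simp
      then show "x(e := u) \<in> A \<inter> ?X" using mem by blast
    qed blast
    then have "weight ?D (A \<inter> ?X) \<le> weight ?D (seg ?X (L ?D) n)"
      by (rule block_optimal[OF D _ initial_seg[OF lin]]) (simp only: card_seg[OF lin n], simp only: n_def)
    ultimately show ?thesis
      unfolding split weight_def using sum2[OF AX] sum2[OF seg_subset] by simp
  next
    case False
    then obtain y0 where y0: "y0 \<in> slice c" "y0 \<notin> A" "key_less ?D (key y0) sx"
      unfolding below_def by blast
    define sy where "sy = key y0"
    let ?Y = "block ?D sy"
    have less: "key_less ?D sy sx" using y0(3) unfolding sy_def .
    have gap: False if "w \<in> slice c" "key_less ?D sy (key w)" "key_less ?D (key w) sx" for w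
      using no_gap[OF y0(1,2)] that unfolding sy_def by blast
    have Y_slice: "?Y \<subseteq> slice c" using blk_slice sl1[OF y0(1)] unfolding sy_def by blast
    have low: "below ?D (slice c) sy \<subseteq> A"
    proof
      fix y assume "y \<in> below ?D (slice c) sy"
      then show "y \<in> A" using no_gap[of y y0] y0 unfolding below_def sy_def by blast
    qed
    have split: "A \<inter> slice c = below ?D (slice c) sy \<union> (A \<inter> ?Y) \<union> (A \<inter> ?X)"
    proof
      show "A \<inter> slice c \<subseteq> below ?D (slice c) sy \<union> (A \<inter> ?Y) \<union> (A \<inter> ?X)"
      proof
        fix x assume x: "x \<in> A \<inter> slice c"
        show "x \<in> below ?D (slice c) sy \<union> (A \<inter> ?Y) \<union> (A \<inter> ?X)"
        proof (cases "\<exists>e\<in>?D. key x e \<noteq> sx e")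
          case True
          then have "x \<in> below ?D (slice c) sx"
            using key_less_total[OF fD, of _ "key x" sx] not_above[of x] x unfolding below_def by blast
          moreover have "below ?D (slice c) sx = below ?D (slice c) sy \<union> ?Y"
            by (rule below_next_block[OF D(2) slice_subset Y_slice less gap])
          ultimately show ?thesis using x by blast
        next
          case False
          then show ?thesis using x slV by (auto simp: mem_block_iff)
        qed
      qed
    qed (use low X_slice Y_slice in \<open>auto simp: below_def\<close>)
    obtain k where k: "k \<in> ?D" "\<And>e. e \<in> ?D \<Longrightarrow> e < k \<Longrightarrow> sy e = sx e" "sy k < sx k"
      using less unfolding key_less_def by blast
    have k1: "k \<noteq> 1" using k(3) sl1[OF y0(1)] sl1[OF x0(2)] unfolding sx_def sy_def by auto
    \<comment> \<open>This fact and the next two test \<open>gap\<close> on vertices obtained from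
      \<open>y0\<close> or \<open>x0\<close> by changing one coordinate. That coordinate is never
      \<open>1\<close>, so the vertex stays in the slice.\<close>
    have succ: False if "v \<in> V k" "sy k < st k v" "st k v < sx k" for v
    proof (rule gap[OF upd[OF y0(1) k(1) k1 that(1)]])
      show "key_less ?D sy (key (y0(k := v)))"
        by (rule key_lessI[OF k(1)]) (use that in \<open>auto simp: sy_def key_def\<close>)
      show "key_less ?D (key (y0(k := v))) sx"
        by (rule key_lessI[OF k(1)]) (use that k(2) in \<open>auto simp: sy_def key_def\<close>)
    qed
    have last: "st e v \<le> sy e" if e: "e \<in> ?D" "k < e" "v \<in> V e" for e v
    proof (rule ccontr)
      assume v: "\<not> st e v \<le> sy e"
      have "e \<noteq> 1" using k(1) e(2) by auto
      show False
      proof (rule gap[OF upd[OF y0(1) e(1) \<open>e \<noteq> 1\<close> e(3)]])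
        show "key_less ?D sy (key (y0(e := v)))"
          by (rule key_lessI[OF e(1)]) (use v in \<open>auto simp: sy_def key_def\<close>)
        show "key_less ?D (key (y0(e := v))) sx"
          by (rule key_lessI[OF k(1)]) (use k(2,3) e(2) in \<open>auto simp: sy_def key_def\<close>)
      qed
    qed
    have first: "sx e \<le> st e v" if e: "e \<in> ?D" "k < e" "v \<in> V e" for e v
    proof (rule ccontr)
      assume v: "\<not> sx e \<le> st e v"
      have "e \<noteq> 1" using k(1) e(2) by auto
      show False
      proof (rule gap[OF upd[OF x0(2) e(1) \<open>e \<noteq> 1\<close> e(3)]])
        show "key_less ?D sy (key (x0(e := v)))"
          by (rule key_lessI[OF k(1)]) (use k(2,3) e(2) in \<open>auto simp: sx_def key_def\<close>)
        show "key_less ?D (key (x0(e := v))) sx"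
          by (rule key_lessI[OF e(1)]) (use v in \<open>auto simp: sx_def key_def\<close>)
      qed
    qed
    \<comment> \<open>If the parts change only at \<open>d\<close>, coordinate \<open>1\<close>
      completes the pair: it is common to the slice, so the two blocks remain consecutive in the
      product of the two factors.\<close>
    define i where "i = (if k = d then 1 else k)"
    have ij: "1 \<le> i" "i < d" using k(1) k1 d3 unfolding i_def by auto
    have sy1: "sy 1 = sx 1" using sl1 x0(2) y0(1) unfolding sx_def sy_def by simp
    \<comment> \<open>Before \<open>k\<close> the two parts coincide. After \<open>k\<close> the
      upper block has the first and the lower block the last part, and \<open>d\<close> is excluded,
      so regularity applies.\<close>
    have cmp: "comparable e (sx e) (sy e) \<and> e \<le> d - 1" if e: "e \<in> ?D - {i, d}" for e
    proof
      show "e \<le> d - 1" using e by auto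
      show "comparable e (sx e) (sy e)"
      proof (cases "e < k")
        case True
        then show ?thesis using comparable_refl k(2) e by simp
      next
        case False
        have "e \<noteq> k" using e unfolding i_def by (auto split: if_splits)
        then have ke: "k < e" using False by simp
        have eD: "e \<in> ?D" and e2: "e \<in> {2..d - 1}" using e ke k(1) by auto
        have "x0 e \<in> V e" "y0 e \<in> V e" using PiE_mem[OF slV eD] x0(2) y0(1) by auto
        then have "comparable e (st e (x0 e)) (st e (y0 e))"
          by (rule regular[OF e2])
            (use first[OF eD ke] last[OF eD ke] in \<open>auto simp: sx_def sy_def key_def\<close>)
        then show ?thesis unfolding sx_def sy_def key_def .
      qed
    qed
    have "transferable {i, d} i d sy sx"
    proof (rule transferable_pair[OF ij order_refl])
      show "key_less {i, d} sy sx"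
        unfolding key_less_pair[OF ij(2)] using k(3) sy1 unfolding i_def by auto
      fix w assume w: "w \<in> PiE {i, d} V" "key_less {i, d} sy (key w)" "key_less {i, d} (key w) sx"
      note less2 = w(2,3)[unfolded key_less_pair[OF ij(2)] key_def]
      have wV: "w i \<in> V i" "w d \<in> V d" using w(1) by auto
      show False
      proof (cases "k = d")
        case True
        then have "i = 1" unfolding i_def by simp
        then show False
          using less2 sy1 succ[of "w d"] wV True by auto
      next
        case False
        then have i: "i = k" and kd: "k < d" using k(1) unfolding i_def by auto
        have "st d (w d) \<le> sy d" "sx d \<le> st d (w d)"
          using last[of d "w d"] first[of d "w d"] kd wV(2) d3 by auto
        then show False
          using less2 succ[of "w k"] wV(1) unfolding i by auto
      qed
    qed
    \<comment> \<open>One coordinate outside the pair is held back. The final step along it is made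
      with the traces of \<open>A\<close> themselves, which are layered by strong closure.\<close>
    obtain e where e: "e \<in> ?D" "e \<noteq> i" "e \<noteq> d" using third_coordinate[of i d] by blast
    define T where "T = ?D - {e}"
    have idT: "i \<in> T" "d \<in> T" using e ij unfolding T_def by auto
    then have T: "T \<noteq> {}" "insert e T \<subseteq> {1..d}" "e \<notin> T" "i \<in> T" "d \<in> T" and TD: "insert e T = ?D"
      using e unfolding T_def by blast+
    have tr: "transferable T i d sy sx"
      by (rule transferable_superset[OF \<open>transferable {i, d} i d sy sx\<close>])
        (use T cmp in \<open>auto simp: T_def\<close>)
    have lay: "layered e T t (A \<inter> block ?D t)" for t
    proof (rule layeredI[OF T(1-3)], unfold TD)
      fix x y assume x: "x \<in> A \<inter> block ?D t" and y: "y \<in> block ?D t" "L ?D y x"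
        and "y e = x e \<or> (\<forall>k\<in>T. y k = x k)"
      then obtain k' where "k' \<in> ?D" "y k' = x k'" using e(1) T(4) unfolding T_def by blast
      then have "y \<in> A" using scA[of x y k'] x y block_subset by blast
      then show "y \<in> A \<inter> block ?D t" using y by blast
    qed blast
    define m n where "m = card (A \<inter> ?Y)" and "n = card (A \<inter> ?X)"
    define s where "s = min n (card ?Y - m)"
    have m: "m \<le> card ?Y" and n: "n \<le> card ?X"
      unfolding m_def n_def by (rule card_mono[OF lin(1)]; blast)+
    have ms: "m + s \<le> card ?Y" and ns: "n - s \<le> card ?X" and sn: "s \<le> n" using m n unfolding s_def by auto
    have w_le: "weight ?D (A \<inter> ?Y) + weight ?D (A \<inter> ?X) \<le> best ?D sy (m + s) + best ?D sx (n - s)"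
      unfolding m_def n_def s_def
    proof (rule transfer_layers[OF T _ _ _ tr lay lay, unfolded TD])
      show "card (part e (sx e)) = card (part e (sy e))" "e \<le> d - 1"
        using cmp[of e] e unfolding comparable_def by auto
      show "f e u \<le> f e v" if "u \<in> part e (sx e)" "v \<in> part e (sy e)" "rk e (sx e) u = rk e (sy e) v" for u v
        using cmp[of e] e that unfolding comparable_def by auto
      \<comment> \<open>All of the lower block precedes all of the upper one, so strong closure
        forbids any common coordinate, in particular \<open>i\<close> and \<open>d\<close>.\<close>
      fix x y assume x: "x \<in> A \<inter> ?X" and y: "y \<in> ?Y - A \<inter> ?Y"
      have V: "x \<in> PiE ?D V" "y \<in> PiE ?D V" using x y block_subset by auto
      have "key_less ?D (key y) (key x)"
        using less block_key_less(1)[of y ?D sy] block_key_less(2)[of x ?D sx] x y by blast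
      then have "L ?D y x" by (rule L_key'[OF D(2) V(2,1)])
      then have "x k \<noteq> y k" if "k \<in> ?D" for k using scA[of x y k] V x y that by auto
      then show "x i \<noteq> y i \<and> x d \<noteq> y d" using ij by auto
    qed
    note two = weight_two_blocks[OF D(2) slice_subset[of c] less]
    have "slice_fill A \<inter> slice c =
        below ?D (slice c) sy \<union> seg ?Y (L ?D) (m + s) \<union> seg ?X (L ?D) (n - s)"
    proof (rule initial_eqI[OF fin_slice linear_slice initial_slice_fill])
      show "initial (slice c) (L ?D) (below ?D (slice c) sy \<union> seg ?Y (L ?D) (m + s) \<union> seg ?X (L ?D) (n - s))"
        unfolding s_def by (rule initial_two_blocks[OF D slice_subset Y_slice X_slice less gap m])
      show "card (slice_fill A \<inter> slice c) =
          card (below ?D (slice c) sy \<union> seg ?Y (L ?D) (m + s) \<union> seg ?X (L ?D) (n - s))"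
        unfolding card_slice_fill_Int split two(2)[OF seg_subset seg_subset]
          two(2)[OF Int_lower2 Int_lower2] card_seg[OF lin ms] card_seg[OF lin ns]
        using sn by (simp add: m_def n_def)
    qed
    then show ?thesis
      unfolding split using two(1)[OF seg_subset seg_subset] two(1)[OF Int_lower2 Int_lower2] w_le
      unfolding best_def by simp
  qed
qed

lemma weight_slice_fill:
  assumes "strongly_closed A"
  shows "weight {1..d} A \<le> weight {1..d} (slice_fill A)"
proof -
  have "A \<subseteq> PiE {1..d} V" using assms unfolding strongly_closed_def by blast
  then show ?thesis
    using weight_slice_le[OF assms] sum_slices[of A] sum_slices[OF slice_fill_subset[of A]]
    unfolding weight_def by (simp add: sum_mono)
qed

end

section \<open>Block-lexicographic orders and edge counts of products\<close>

lemma optimal_initial: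
  assumes fin: "finite (verts H)" and lin: "strict_linear_on (verts H) lt"
    and opt: "optimal H (ranking (verts H) lt)" and N: "initial (verts H) lt N"
    and M: "M \<subseteq> verts H" "card M = card N"
  shows "card (I_edges H M M) \<le> card (I_edges H N N)"
proof -
  have "interval H (ranking (verts H) lt) 1 (card N) = seg (verts H) lt (card N)"
    unfolding interval_def ranking_def seg_def by auto
  then have "interval H (ranking (verts H) lt) 1 (card N) = N"
    using initial_eq_seg[OF fin lin N] by simp
  moreover have "card N \<le> card (verts H)"
    using N fin unfolding initial_def by (simp add: card_mono)
  ultimately have eq: "card (I_edges H N N) = I_max H (card N)"
    using opt unfolding optimal_def by metis
  have "finite {S. S \<subseteq> verts H \<and> card S = card N}"
    using fin by simp
  then have "card (I_edges H M M) \<le> I_max H (card N)"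
    unfolding I_max_def using M by (intro Max_ge) auto
  then show ?thesis using eq by simp
qed

lemma I_edges_singleton:
  "card (I_edges H A {v}) = card {u \<in> A. {u, v} \<in> edges H}"
proof -
  have "I_edges H A {v} = (\<lambda>u. {u, v}) ` {u \<in> A. {u, v} \<in> edges H}"
    unfolding I_edges_def by auto
  moreover have "inj_on (\<lambda>u. {u, v}) {u \<in> A. {u, v} \<in> edges H}"
    by (auto simp: inj_on_def doubleton_eq_iff)
  ultimately show ?thesis by (simp add: card_image)
qed

text \<open>In an optimal order two consecutive initial segments both attain the maximum, so the
  difference of the maxima counts the edges from the added vertex back to its predecessors. At rank
  \<open>1\<close> the value \<open>0\<close> is set by definition and agrees with there being no
  predecessor.\<close>

lemma delta_eq_back_degree:
  assumes H: "simple_graph H" and opt: "optimal H \<rho>" and v: "v \<in> verts H"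
  shows "delta H (\<rho> v) = int (card {u \<in> verts H. {u, v} \<in> edges H \<and> \<rho> u < \<rho> v})"
proof -
  have bij: "bij_betw \<rho> (verts H) {1..card (verts H)}"
    using opt unfolding optimal_def total_order_def by blast
  have rng: "1 \<le> \<rho> u" "\<rho> u \<le> card (verts H)" if "u \<in> verts H" for u
    using bij_betwE[OF bij] that by auto
  show ?thesis
  proof (cases "\<rho> v = 1")
    case True
    then have "{u \<in> verts H. {u, v} \<in> edges H \<and> \<rho> u < \<rho> v} = {}" using rng(1) by fastforce
    then have "card {u \<in> verts H. {u, v} \<in> edges H \<and> \<rho> u < \<rho> v} = 0" by (simp only: card.empty)
    then show ?thesis using True unfolding delta_def by simp
  next
    case False
    define W where "W = {u \<in> verts H. \<rho> u < \<rho> v}"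
    have vW: "v \<notin> W" unfolding W_def by simp
    have I1: "interval H \<rho> 1 (\<rho> v - 1) = W"
      using rng[OF v] rng False unfolding W_def interval_def by force
    have "u = v" if "u \<in> verts H" "\<rho> u = \<rho> v" for u
      using bij that v unfolding bij_betw_def inj_on_def by blast
    then have I2: "interval H \<rho> 1 (\<rho> v) = insert v W"
      using rng v unfolding W_def interval_def by (auto simp: le_less)
    have no_loop: "{v} \<notin> edges H"
      using H unfolding simple_graph_def by (metis doubleton_eq_iff insert_absorb2)
    have "edges H \<subseteq> Pow (verts H)" using H unfolding simple_graph_def by auto
    then have finE: "finite (edges H)"
      using H finite_subset unfolding simple_graph_def by blast
    define K where "K = (\<lambda>u. {u, v}) ` {u \<in> W. {u, v} \<in> edges H}"
    have cK: "card K = card {u \<in> verts H. {u, v} \<in> edges H \<and> \<rho> u < \<rho> v}"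
    proof -
      have "{u \<in> W. {u, v} \<in> edges H} = {u \<in> verts H. {u, v} \<in> edges H \<and> \<rho> u < \<rho> v}"
        unfolding W_def by blast
      moreover have "inj_on (\<lambda>u. {u, v}) {u \<in> W. {u, v} \<in> edges H}"
        by (auto simp: inj_on_def doubleton_eq_iff)
      ultimately show ?thesis unfolding K_def by (simp add: card_image)
    qed
    have "I_edges H (insert v W) (insert v W) = I_edges H W W \<union> K"
    proof
      show "I_edges H (insert v W) (insert v W) \<subseteq> I_edges H W W \<union> K"
      proof
        fix E assume "E \<in> I_edges H (insert v W) (insert v W)"
        then obtain a b where E: "E \<in> edges H" "a \<in> insert v W" "b \<in> insert v W" "E = {a, b}"
          unfolding I_edges_def by blast
        consider "a \<in> W" "b \<in> W" | "a = v" "b \<in> W" | "a \<in> W" "b = v" | "a = v" "b = v" using E by blast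
        then show "E \<in> I_edges H W W \<union> K"
        proof cases
          case 1 then show ?thesis using E unfolding I_edges_def by blast
        next
          case 2
          then have "E = {b, v}" using E(4) by blast
          then show ?thesis using 2 E(1) unfolding K_def by blast
        next
          case 3 then show ?thesis using E unfolding K_def by blast
        next
          case 4 then show ?thesis using E no_loop by simp
        qed
      qed
      show "I_edges H W W \<union> K \<subseteq> I_edges H (insert v W) (insert v W)"
        unfolding I_edges_def K_def by blast
    qed
    moreover have "I_edges H W W \<inter> K = {}"
    proof -
      have "v \<notin> E" if "E \<in> I_edges H W W" for E using that vW unfolding I_edges_def by auto
      moreover have "v \<in> E" if "E \<in> K" for E using that unfolding K_def by auto
      ultimately show ?thesis by blast
    qed
    moreover have "I_edges H W W \<subseteq> edges H" "K \<subseteq> edges H"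
      unfolding I_edges_def K_def by auto
    then have "finite (I_edges H W W)" "finite K"
      using finite_subset[OF _ finE] by auto
    ultimately have "card (I_edges H (insert v W) (insert v W)) = card (I_edges H W W) + card K"
      by (simp add: card_Un_disjoint)
    moreover have "card (I_edges H (insert v W) (insert v W)) = I_max H (\<rho> v)"
      using opt rng[OF v] I2 unfolding optimal_def by metis
    moreover have "card (I_edges H W W) = I_max H (\<rho> v - 1)"
      using opt rng[OF v] I1 unfolding optimal_def by (metis diff_le_self le_trans)
    ultimately show ?thesis using cK False unfolding delta_def by simp
  qed
qed

lemma I_edges_induced: "M \<subseteq> U \<Longrightarrow> I_edges (induced H U) M M = I_edges H M M"
  unfolding I_edges_def induced_def by auto

lemma simple_graph_induced: "simple_graph H \<Longrightarrow> U \<subseteq> verts H \<Longrightarrow> simple_graph (induced H U)"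
  unfolding simple_graph_def induced_def graph.simps
  by (intro conjI) (blast intro: finite_subset, (clarify, metis insert_subset))

lemma delta_seq_nth: "r \<in> {1..card (verts H)} \<Longrightarrow> delta_seq H ! (r - 1) = delta H r"
  unfolding delta_seq_def by (auto simp del: upt_Suc)

lemma length_delta_seq: "length (delta_seq H) = card (verts H)"
  unfolding delta_seq_def by simp

section \<open>Lexicographic comparison of tuples\<close>

lemma lex_less_irrefl: "\<not> lex_less n x x"
  unfolding lex_less_def by auto

lemma lex_less_trans:
  fixes x y z :: "nat \<Rightarrow> nat"
  assumes "lex_less n x y" "lex_less n y z"
  shows "lex_less n x z"
proof -
  obtain i where i: "i < n" "\<And>j. j \<in> {1..i} \<Longrightarrow> x j = y j" "x (i + 1) < y (i + 1)"
    using assms(1) unfolding lex_less_def by blast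
  obtain k where k: "k < n" "\<And>j. j \<in> {1..k} \<Longrightarrow> y j = z j" "y (k + 1) < z (k + 1)"
    using assms(2) unfolding lex_less_def by blast
  have "x (min i k + 1) < z (min i k + 1)"
  proof (cases i k rule: linorder_cases)
    case less
    then have "y (i + 1) = z (i + 1)" by (intro k(2)) simp
    then show ?thesis using i(3) less by simp
  next
    case greater
    then have "x (k + 1) = y (k + 1)" by (intro i(2)) simp
    then show ?thesis using k(3) greater by simp
  qed (use i(3) k(3) in simp)
  moreover have "x j = z j" if "j \<in> {1..min i k}" for j
    using i(2)[of j] k(2)[of j] that by simp
  moreover have "min i k < n" using i(1) by simp
  ultimately show ?thesis unfolding lex_less_def by blast
qed

lemma lex_less_total:
  fixes x y :: "nat \<Rightarrow> nat"
  assumes "j \<in> {1..n}" "x j \<noteq> y j"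
  shows "lex_less n x y \<or> lex_less n y x"
proof -
  define J where "J = {j \<in> {1..n}. x j \<noteq> y j}"
  have J: "finite J" "J \<noteq> {}" using assms unfolding J_def by auto
  define m where "m = Min J"
  have "m \<in> J" unfolding m_def by (rule Min_in[OF J])
  then have m: "m \<in> {1..n}" "x m \<noteq> y m" unfolding J_def by auto
  have eq: "x k = y k" if "k \<in> {1..m - 1}" for k
  proof (rule ccontr)
    assume "x k \<noteq> y k"
    then have "k \<in> J" using that m(1) unfolding J_def by auto
    then have "m \<le> k" unfolding m_def by (rule Min_le[OF J(1)])
    then show False using that by auto
  qed
  have m1: "m - 1 < n" "m - 1 + 1 = m" using m(1) by auto
  show ?thesis
  proof (cases "x m < y m")
    case True
    then have "lex_less n x y"
      unfolding lex_less_def using m1 eq by (intro exI[of _ "m - 1"]) auto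
    then show ?thesis ..
  next
    case False
    then have "lex_less n y x"
      unfolding lex_less_def using m1 eq m(2) by (intro exI[of _ "m - 1"]) auto
    then show ?thesis ..
  qed
qed

lemma lex_less_one_coordinate:
  assumes "j \<in> {1..n}" "x j < y j" "\<And>k. k \<in> {1..n} \<Longrightarrow> k \<noteq> j \<Longrightarrow> x k = y k"
  shows "lex_less n x y"
  unfolding lex_less_def
proof (intro exI[of _ "j - 1"] conjI ballI)
  show "x k = y k" if "k \<in> {1..j - 1}" for k using assms(1) assms(3)[of k] that by auto
qed (use assms in auto)

lemma bij_betw_sorted_nth:
  assumes "finite S" "p permutes {1..card S}"
  shows "bij_betw (\<lambda>j. sorted_list_of_set S ! (p j - 1)) {1..card S} S"
proof -
  have pred: "bij_betw (\<lambda>j. j - 1) {1..card S} {..<card S}"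
    by (rule bij_betw_byWitness[where f' = Suc]) auto
  have nth: "bij_betw (\<lambda>j. sorted_list_of_set S ! j) {..<card S} S"
    by (rule bij_betw_nth) (use assms(1) in auto)
  from bij_betw_trans[OF bij_betw_trans[OF permutes_imp_bij[OF assms(2)] pred] nth]
  show ?thesis by (simp add: comp_def)
qed

lemma bij_betw_surjD: "bij_betw q A B \<Longrightarrow> e \<in> B \<Longrightarrow> \<exists>j\<in>A. q j = e"
  by (metis bij_betw_imp_surj_on imageE)

lemma bij_betw_injD: "bij_betw q A B \<Longrightarrow> j \<in> A \<Longrightarrow> k \<in> A \<Longrightarrow> k \<noteq> j \<Longrightarrow> q k \<noteq> q j"
  by (metis bij_betw_inv_into_left)

text \<open>The sorted enumeration of \<open>S\<close> is strictly increasing, so being earlier in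
  the tuple and being a smaller coordinate mean the same. Positions in tuples start at 1, positions
  in lists at 0.\<close>

lemma lex_less_tuple_iff:
  assumes S: "finite S"
  shows "lex_less (card S) (tuple S h) (tuple S h') \<longleftrightarrow> key_less S h h'"
proof
  let ?l = "sorted_list_of_set S"
  have len: "length ?l = card S" by simp
  have set: "set ?l = S" using S by simp
  have mono: "?l ! i < ?l ! j \<longleftrightarrow> i < j" if "i < card S" "j < card S" for i j
    using strict_sorted_iff[of ?l] sorted_wrt_nth_less[of "(<)" ?l] that len S
    by (metis linorder_neqE_nat not_less_iff_gr_or_eq strict_sorted_list_of_set)
  {
    assume "lex_less (card S) (tuple S h) (tuple S h')"
    then obtain i where i: "i < card S" "\<And>j. j \<in> {1..i} \<Longrightarrow> h (?l ! (j - 1)) = h' (?l ! (j - 1))"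
      "h (?l ! i) < h' (?l ! i)"
      unfolding lex_less_def tuple_def by auto
    show "key_less S h h'"
    proof (rule key_lessI[of "?l ! i"])
      show "?l ! i \<in> S" using nth_mem[of i ?l] i(1) len set by simp
      fix e assume e: "e \<in> S" "e < ?l ! i"
      then obtain j where j: "j < card S" "e = ?l ! j" using set len by (metis in_set_conv_nth)
      then have "j < i" using mono[OF j(1) i(1)] e by simp
      then show "h e = h' e" using i(2)[of "j + 1"] j(2) by simp
    qed (rule i(3))
  next
    assume "key_less S h h'"
    then obtain k where k: "k \<in> S" "\<And>e. e \<in> S \<Longrightarrow> e < k \<Longrightarrow> h e = h' e" "h k < h' k"
      unfolding key_less_def by blast
    obtain i where i: "i < card S" "k = ?l ! i" using set len k(1) by (metis in_set_conv_nth)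
    have "h (?l ! (j - 1)) = h' (?l ! (j - 1))" if "j \<in> {1..i}" for j
    proof (rule k(2))
      have "j - 1 < card S" using that i(1) by auto
      then show "?l ! (j - 1) \<in> S" using nth_mem[of "j - 1" ?l] len set by simp
      show "?l ! (j - 1) < k" unfolding i(2) mono[OF \<open>j - 1 < card S\<close> i(1)] using that by auto
    qed
    then show "lex_less (card S) (tuple S h) (tuple S h')"
      unfolding lex_less_def tuple_def using i k(3) by auto
  }
qed

lemma partition_on_the:
  assumes "partition_on X Q" "x \<in> X"
  shows "(THE Z. Z \<in> Q \<and> x \<in> Z) \<in> Q" "x \<in> (THE Z. Z \<in> Q \<and> x \<in> Z)"
proof -
  have "\<exists>!Z. Z \<in> Q \<and> x \<in> Z"
    using assms unfolding partition_on_def disjoint_def by blast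
  from theI'[OF this] show "(THE Z. Z \<in> Q \<and> x \<in> Z) \<in> Q" "x \<in> (THE Z. Z \<in> Q \<and> x \<in> Z)"
    by auto
qed

lemma partition_on_unique:
  assumes "partition_on X Q" "Z \<in> Q" "x \<in> Z"
  shows "(THE Z. Z \<in> Q \<and> x \<in> Z) = Z"
  using assms unfolding partition_on_def disjoint_def by (intro the_equality) blast+

section \<open>Block-lexicographic orders as a block system\<close>

locale graph_family =
  fixes d :: nat
    and G :: "nat \<Rightarrow> 'a graph"
    and \<O> :: "nat \<Rightarrow> 'a \<Rightarrow> nat"
    and P :: "nat \<Rightarrow> 'a set set"
    and \<pi> :: "'a perm_assignment"
  assumes d3: "3 \<le> d"
    and simple: "\<And>i. i \<in> {1..d} \<Longrightarrow> simple_graph (G i)"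
    and opt: "\<And>i. i \<in> {1..d} \<Longrightarrow> optimal (G i) (\<O> i)"
    and iso: "\<And>i. i \<in> {1..d} \<Longrightarrow> isoperimetric_partition (G i) (\<O> i) (P i)"
    and dom: "domination_collection d G \<O> P \<pi>"
begin

abbreviation V :: "nat \<Rightarrow> 'a set" where "V e \<equiv> verts (G e)"

definition part_of :: "nat \<Rightarrow> 'a \<Rightarrow> 'a set" where
  "part_of e v = (THE Z. Z \<in> P e \<and> v \<in> Z)"

text \<open>A numerical name for the part of \<open>v\<close>: constant on parts, different on
  different parts and nondecreasing along the order.\<close>

definition start_rank :: "nat \<Rightarrow> 'a \<Rightarrow> nat" where
  "start_rank e v = \<O> e (start (\<O> e) (part_of e v))"

definition back_degree :: "nat \<Rightarrow> 'a \<Rightarrow> nat" where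
  "back_degree e v = card {u \<in> V e. {u, v} \<in> edges (G e) \<and> \<O> e u < \<O> e v}"

lemma finite_V: "e \<in> {1..d} \<Longrightarrow> finite (V e)"
  using simple unfolding simple_graph_def by blast

lemma bij_order: "e \<in> {1..d} \<Longrightarrow> bij_betw (\<O> e) (V e) {1..card (V e)}"
  using opt unfolding optimal_def total_order_def by blast

lemma inj_order: "e \<in> {1..d} \<Longrightarrow> inj_on (\<O> e) (V e)"
  using bij_order bij_betw_def by blast

lemma partition: "e \<in> {1..d} \<Longrightarrow> partition_on (V e) (P e)"
  using iso unfolding isoperimetric_partition_def by blast

lemma part_of_mem: "e \<in> {1..d} \<Longrightarrow> v \<in> V e \<Longrightarrow> part_of e v \<in> P e"
  and mem_part_of: "e \<in> {1..d} \<Longrightarrow> v \<in> V e \<Longrightarrow> v \<in> part_of e v"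
  unfolding part_of_def using partition_on_the[OF partition] by auto

lemma part_of_eq: "e \<in> {1..d} \<Longrightarrow> Z \<in> P e \<Longrightarrow> v \<in> Z \<Longrightarrow> part_of e v = Z"
  unfolding part_of_def using partition_on_unique[OF partition] by auto

lemma part_subset_V: "e \<in> {1..d} \<Longrightarrow> Z \<in> P e \<Longrightarrow> Z \<subseteq> V e"
  using partition unfolding partition_on_def by blast

lemma start_mem:
  assumes "e \<in> {1..d}" "Z \<in> P e"
  shows "start (\<O> e) Z \<in> Z" "w \<in> Z \<Longrightarrow> \<O> e (start (\<O> e) Z) \<le> \<O> e w"
proof -
  have Z: "finite Z" "Z \<noteq> {}"
    using finite_subset[OF part_subset_V[OF assms] finite_V[OF assms(1)]]
      partition[OF assms(1)] assms(2) unfolding partition_on_def by auto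
  show "start (\<O> e) Z \<in> Z" unfolding start_def by (rule arg_min_if_finite(1)[OF Z])
  show "w \<in> Z \<Longrightarrow> \<O> e (start (\<O> e) Z) \<le> \<O> e w"
    unfolding start_def by (rule arg_min_least[OF Z])
qed

lemma start_rank_eq_iff:
  assumes e: "e \<in> {1..d}" and u: "u \<in> V e" and v: "v \<in> V e"
  shows "start_rank e u = start_rank e v \<longleftrightarrow> part_of e u = part_of e v"
proof
  assume eq: "start_rank e u = start_rank e v"
  have s: "start (\<O> e) (part_of e w) \<in> part_of e w" if "w \<in> V e" for w
    using start_mem(1)[OF e part_of_mem[OF e that]] .
  then have "start (\<O> e) (part_of e w) \<in> V e" if "w \<in> V e" for w
    using part_subset_V[OF e part_of_mem[OF e that]] that by blast
  then have "start (\<O> e) (part_of e u) = start (\<O> e) (part_of e v)"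
    using eq inj_order[OF e] u v unfolding start_rank_def inj_on_def by blast
  then show "part_of e u = part_of e v"
    using s[OF u] s[OF v] part_of_eq[OF e part_of_mem[OF e u]] part_of_eq[OF e part_of_mem[OF e v]]
    by metis
qed (simp add: start_rank_def)

lemma part_interval:
  assumes "e \<in> {1..d}" "Z \<in> P e" "u \<in> Z" "w \<in> Z" "v \<in> V e" "\<O> e u \<le> \<O> e v" "\<O> e v \<le> \<O> e w"
  shows "v \<in> Z"
proof -
  obtain a b where "Z = interval (G e) (\<O> e) a b"
    using iso[OF assms(1)] assms(2) unfolding isoperimetric_partition_def by blast
  then show ?thesis using assms unfolding interval_def by auto
qed

text \<open>Parts are intervals. If the start of the part of \<open>u\<close> came after that of
  \<open>v\<close>, it would lie between the latter start and \<open>v\<close> itself, hence in the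
  part of \<open>v\<close>, and the two parts would coincide.\<close>

lemma start_rank_mono:
  assumes e: "e \<in> {1..d}" and u: "u \<in> V e" and v: "v \<in> V e" and le: "\<O> e u \<le> \<O> e v"
  shows "start_rank e u \<le> start_rank e v"
proof (rule ccontr)
  assume less: "\<not> start_rank e u \<le> start_rank e v"
  note pu = part_of_mem[OF e u] and pv = part_of_mem[OF e v]
  have su: "start (\<O> e) (part_of e u) \<in> V e"
    using start_mem(1)[OF e pu] part_subset_V[OF e pu] by blast
  have "start_rank e u \<le> \<O> e u"
    unfolding start_rank_def using start_mem(2)[OF e pu mem_part_of[OF e u]] .
  then have "start (\<O> e) (part_of e u) \<in> part_of e v"
    using part_interval[OF e pv start_mem(1)[OF e pv] mem_part_of[OF e v] su] less le
    unfolding start_rank_def by linarith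
  then have "part_of e u = part_of e v"
    using start_mem(1)[OF e pu] part_of_eq[OF e pu] part_of_eq[OF e pv] by metis
  then show False using less unfolding start_rank_def by simp
qed

lemma restrict_order_less_iff:
  assumes "e \<in> {1..d}" "Z \<subseteq> V e" "u \<in> Z" "v \<in> Z"
  shows "restrict_order (\<O> e) Z u < restrict_order (\<O> e) Z v \<longleftrightarrow> \<O> e u < \<O> e v"
proof -
  have "strict_linear_on Z (\<lambda>u v. \<O> e u < \<O> e v)"
    using inj_order[OF assms(1)] assms(2) unfolding strict_linear_on_def inj_on_def
    by (metis less_irrefl less_trans linorder_neqE_nat subsetD)
  then show ?thesis
    unfolding restrict_order_def ranking_def
    using card_below_less_iff[OF finite_subset[OF assms(2) finite_V[OF assms(1)]] _ assms(3,4)] by simp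
qed

lemma restrict_order_inj:
  assumes "e \<in> {1..d}" "Z \<subseteq> V e" "u \<in> Z" "v \<in> Z" "restrict_order (\<O> e) Z u = restrict_order (\<O> e) Z v"
  shows "u = v"
proof -
  have "\<not> \<O> e u < \<O> e v" "\<not> \<O> e v < \<O> e u"
    using restrict_order_less_iff[OF assms(1,2,3,4)] restrict_order_less_iff[OF assms(1,2,4,3)] assms(5)
    by auto
  then have "\<O> e u = \<O> e v" by simp
  then show ?thesis using inj_order[OF assms(1)] assms(2-4) unfolding inj_on_def by blast
qed

lemma block_of_apply: "e \<in> S \<Longrightarrow> block_of P S x e = part_of e (x e)"
  unfolding block_of_def part_of_def by simp

lemma block_of_PiE: "S \<subseteq> {1..d} \<Longrightarrow> x \<in> PiE S V \<Longrightarrow> block_of P S x \<in> PiE S P"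
  unfolding block_of_def part_of_def[symmetric] by (intro restrict_PiE_iff[THEN iffD2] ballI part_of_mem) auto

lemma mem_block_of: "S \<subseteq> {1..d} \<Longrightarrow> x \<in> PiE S V \<Longrightarrow> x \<in> PiE S (block_of P S x)"
  by (intro PiE_I) (auto simp: block_of_apply PiE_iff extensional_def intro!: mem_part_of)

lemma block_of_eq_iff:
  assumes "S \<subseteq> {1..d}" "x \<in> PiE S V" "y \<in> PiE S V"
  shows "block_of P S x = block_of P S y \<longleftrightarrow> (\<forall>e\<in>S. start_rank e (x e) = start_rank e (y e))"
proof -
  have "start_rank e (x e) = start_rank e (y e) \<longleftrightarrow> part_of e (x e) = part_of e (y e)" if "e \<in> S" for e
    by (rule start_rank_eq_iff[OF subsetD[OF assms(1) that] PiE_mem[OF assms(2) that] PiE_mem[OF assms(3) that]])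
  then have "(\<forall>e\<in>S. start_rank e (x e) = start_rank e (y e)) \<longleftrightarrow> (\<forall>e\<in>S. part_of e (x e) = part_of e (y e))"
    by blast
  moreover have "block_of P S x = block_of P S y \<longleftrightarrow> (\<forall>e\<in>S. part_of e (x e) = part_of e (y e))"
    unfolding block_of_def part_of_def[symmetric] fun_eq_iff restrict_apply by auto
  ultimately show ?thesis by simp
qed

lemma block_subset_V: "S \<subseteq> {1..d} \<Longrightarrow> Z \<in> PiE S P \<Longrightarrow> PiE S Z \<subseteq> PiE S V"
  by (intro PiE_mono part_subset_V) (auto simp: PiE_iff)

lemma factor_subset_V: "S \<subseteq> {1..d} \<Longrightarrow> Z \<in> PiE S P \<Longrightarrow> e \<in> S \<Longrightarrow> Z e \<subseteq> V e"
  by (rule part_subset_V) (auto dest: PiE_mem)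

lemma BL_less_iff:
  assumes S: "S \<subseteq> {1..d}" and x: "x \<in> PiE S V" and y: "y \<in> PiE S V"
  shows "BL_less \<O> P \<pi> S x y \<longleftrightarrow>
    (if \<forall>e\<in>S. start_rank e (x e) = start_rank e (y e) then block_less \<O> \<pi> S (block_of P S x) x y
     else key_less S (\<lambda>e. start_rank e (x e)) (\<lambda>e. start_rank e (y e)))"
proof -
  have fS: "finite S" using S finite_subset by auto
  have "key_less S (\<lambda>e. \<O> e (block_start \<O> S (block_of P S x) e)) (\<lambda>e. \<O> e (block_start \<O> S (block_of P S y) e))
      = key_less S (\<lambda>e. start_rank e (x e)) (\<lambda>e. start_rank e (y e))"
    by (rule key_less_cong) (simp_all add: block_start_def block_of_apply start_rank_def)
  then show ?thesis
    unfolding BL_less_def block_of_eq_iff[OF assms] lex_less_tuple_iff[OF fS] by (simp only:)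
qed

text \<open>The permutation lists the coordinates of a block in the order \<open>q 1, q 2, \<dots>\<close> of decreasing
  priority.\<close>

lemma block_less_lex:
  assumes S: "S \<noteq> {}" "S \<subseteq> {1..d}" and Z: "Z \<in> PiE S P"
  obtains q where "bij_betw q {1..card S} S"
    "\<And>x y. block_less \<O> \<pi> S Z x y \<longleftrightarrow>
      lex_less (card S) (\<lambda>j. restrict_order (\<O> (q j)) (Z (q j)) (x (q j)))
        (\<lambda>j. restrict_order (\<O> (q j)) (Z (q j)) (y (q j)))"
proof -
  define q where "q j = sorted_list_of_set S ! (\<pi> S Z j - 1)" for j
  have p: "\<pi> S Z permutes {1..card S}" using dom S Z unfolding domination_collection_def by blast
  have fS: "finite S" using S finite_subset by auto
  have q: "bij_betw q {1..card S} S"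
    unfolding q_def[abs_def] by (rule bij_betw_sorted_nth[OF fS p])
  have "block_less \<O> \<pi> S Z x y \<longleftrightarrow>
      lex_less (card S) (\<lambda>j. restrict_order (\<O> (q j)) (Z (q j)) (x (q j)))
        (\<lambda>j. restrict_order (\<O> (q j)) (Z (q j)) (y (q j)))" for x y
    unfolding block_less_def dom_less_def tuple_def comp_def q_def ..
  from that[OF q this] show thesis .
qed

lemma linear_block_less:
  assumes S: "S \<noteq> {}" "S \<subseteq> {1..d}" and Z: "Z \<in> PiE S P"
  shows "strict_linear_on (PiE S Z) (block_less \<O> \<pi> S Z)"
proof -
  obtain q where q: "bij_betw q {1..card S} S" and lex: "\<And>x y. block_less \<O> \<pi> S Z x y \<longleftrightarrow>
      lex_less (card S) (\<lambda>j. restrict_order (\<O> (q j)) (Z (q j)) (x (q j)))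
        (\<lambda>j. restrict_order (\<O> (q j)) (Z (q j)) (y (q j)))"
    using block_less_lex[OF assms] by blast
  have total: "block_less \<O> \<pi> S Z x y \<or> block_less \<O> \<pi> S Z y x"
    if x: "x \<in> PiE S Z" and y: "y \<in> PiE S Z" and ne: "x \<noteq> y" for x y
  proof -
    obtain e where e: "e \<in> S" "x e \<noteq> y e" using ne PiE_ext[OF x y] by blast
    obtain j where j: "j \<in> {1..card S}" "q j = e" using bij_betw_surjD[OF q e(1)] by blast
    have "restrict_order (\<O> e) (Z e) (x e) \<noteq> restrict_order (\<O> e) (Z e) (y e)"
      using restrict_order_inj[OF subsetD[OF S(2) e(1)] factor_subset_V[OF S(2) Z e(1)]
          PiE_mem[OF x e(1)] PiE_mem[OF y e(1)]] e(2) by blast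
    then show ?thesis unfolding lex using j by (intro lex_less_total[of j]) auto
  qed
  show ?thesis
    unfolding strict_linear_on_def
  proof (intro conjI ballI impI)
    show "\<not> block_less \<O> \<pi> S Z x x" for x unfolding lex by (rule lex_less_irrefl)
    show "block_less \<O> \<pi> S Z x z" if "block_less \<O> \<pi> S Z x y" "block_less \<O> \<pi> S Z y z" for x y z
      using that unfolding lex by (rule lex_less_trans)
  qed (rule total)
qed

lemma linear_BL_less:
  assumes S: "S \<noteq> {}" "S \<subseteq> {1..d}"
  shows "strict_linear_on (PiE S V) (BL_less \<O> P \<pi> S)"
proof -
  have fS: "finite S" using S finite_subset by auto
  let ?k = "\<lambda>x e. start_rank e (x e)"
  note iff = BL_less_iff[OF S(2)]
  have lin: "strict_linear_on (PiE S (block_of P S x)) (block_less \<O> \<pi> S (block_of P S x))"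
    if "x \<in> PiE S V" for x
    by (rule linear_block_less[OF S block_of_PiE[OF S(2) that]])
  have same: "y \<in> PiE S (block_of P S x) \<and> block_of P S y = block_of P S x"
    if "x \<in> PiE S V" "y \<in> PiE S V" "\<forall>e\<in>S. ?k x e = ?k y e" for x y
    using that block_of_eq_iff[OF S(2)] mem_block_of[OF S(2)] by metis
  show ?thesis
    unfolding strict_linear_on_def
  proof (intro conjI ballI impI)
    fix x assume x: "x \<in> PiE S V"
    show "\<not> BL_less \<O> P \<pi> S x x"
      unfolding iff[OF x x] using lin[OF x] mem_block_of[OF S(2) x] unfolding strict_linear_on_def by simp
  next
    fix x y assume x: "x \<in> PiE S V" and y: "y \<in> PiE S V" and ne: "x \<noteq> y"
    show "BL_less \<O> P \<pi> S x y \<or> BL_less \<O> P \<pi> S y x"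
    proof (cases "\<forall>e\<in>S. ?k x e = ?k y e")
      case True
      then show ?thesis
        unfolding iff[OF x y] iff[OF y x]
        using lin[OF x] mem_block_of[OF S(2) x] same[OF x y True] ne unfolding strict_linear_on_def by auto
    next
      case False
      then show ?thesis unfolding iff[OF x y] iff[OF y x] using key_less_total[OF fS, of _ "?k x" "?k y"] by auto
    qed
  next
    fix x y z assume x: "x \<in> PiE S V" and y: "y \<in> PiE S V" and z: "z \<in> PiE S V"
      and xy: "BL_less \<O> P \<pi> S x y" and yz: "BL_less \<O> P \<pi> S y z"
    have cross: "key_less S (?k u) (?k v)"
      if "u \<in> PiE S V" "v \<in> PiE S V" "BL_less \<O> P \<pi> S u v" "\<not> (\<forall>e\<in>S. ?k u e = ?k v e)" for u v
      using that(3) unfolding iff[OF that(1,2)] if_not_P[OF that(4)] .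
    have crossI: "BL_less \<O> P \<pi> S x z" if "key_less S (?k x) (?k z)"
    proof -
      have "\<not> (\<forall>e\<in>S. ?k x e = ?k z e)" using that key_less_irrefl[of S "?k x" "?k z"] by blast
      then show ?thesis using that unfolding iff[OF x z] by (simp only: if_False)
    qed
    show "BL_less \<O> P \<pi> S x z"
    proof (cases "\<forall>e\<in>S. ?k x e = ?k y e")
      case xy_same: True
      show ?thesis
      proof (cases "\<forall>e\<in>S. ?k y e = ?k z e")
        case True
        define Z where "Z = block_of P S x"
        have xz: "\<forall>e\<in>S. ?k x e = ?k z e" using True xy_same by simp
        have mem: "x \<in> PiE S Z" "y \<in> PiE S Z" "z \<in> PiE S Z"
          using mem_block_of[OF S(2) x] same[OF x y xy_same] same[OF x z xz] unfolding Z_def by auto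
        have "block_less \<O> \<pi> S Z x y"
          using xy unfolding iff[OF x y] if_P[OF xy_same] Z_def .
        moreover have "block_less \<O> \<pi> S Z y z"
          using yz same[OF x y xy_same] unfolding iff[OF y z] if_P[OF True] Z_def by simp
        ultimately have "block_less \<O> \<pi> S Z x z"
          using lin[OF x] mem unfolding strict_linear_on_def Z_def by blast
        then show ?thesis unfolding iff[OF x z] if_P[OF xz] Z_def .
      next
        case False
        have "key_less S (?k x) (?k z) = key_less S (?k y) (?k z)"
          by (rule key_less_cong) (use xy_same in auto)
        then show ?thesis using crossI cross[OF y z yz False] by blast
      qed
    next
      case xy_diff: False
      note xy' = cross[OF x y xy xy_diff]
      show ?thesis
      proof (cases "\<forall>e\<in>S. ?k y e = ?k z e")
        case True
        have "key_less S (?k x) (?k y) = key_less S (?k x) (?k z)"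
          by (rule key_less_cong) (use True in auto)
        then show ?thesis using crossI xy' by blast
      next
        case False
        show ?thesis by (rule crossI[OF key_less_trans[OF xy' cross[OF y z yz False]]])
      qed
    qed
  qed
qed

text \<open>In a common block this is the consistency of the domination collection. Otherwise the
  first coordinate at which the parts differ belongs to \<open>S\<close>, because \<open>x\<close>
  and \<open>y\<close> agree elsewhere, and it remains the first one after restriction.\<close>

lemma BL_less_restrict:
  assumes S: "S \<noteq> {}" "S \<subseteq> T" and T: "T \<subseteq> {1..d}" and x: "x \<in> PiE T V" and y: "y \<in> PiE T V"
    and agree: "\<And>e. e \<in> T - S \<Longrightarrow> x e = y e" and less: "BL_less \<O> P \<pi> T x y"
  shows "BL_less \<O> P \<pi> S (restrict x S) (restrict y S)"
proof (cases "S = T")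
  case True
  then show ?thesis using less x y by (simp add: PiE_restrict)
next
  case False
  then have ST: "S \<subset> T" using S by blast
  have SD: "S \<subseteq> {1..d}" using S T by blast
  have xs: "restrict x S \<in> PiE S V" "restrict y S \<in> PiE S V" using x y S by auto
  note iffT = BL_less_iff[OF T x y]
  note iffS = BL_less_iff[OF SD xs]
  show ?thesis
  proof (cases "\<forall>e\<in>T. start_rank e (x e) = start_rank e (y e)")
    case True
    define Z where "Z = block_of P T x"
    have Z: "Z \<in> PiE T P" unfolding Z_def by (rule block_of_PiE[OF T x])
    have mem: "x \<in> PiE T Z" "y \<in> PiE T Z"
      using mem_block_of[OF T x] mem_block_of[OF T y] True block_of_eq_iff[OF T x y] unfolding Z_def by auto
    have "block_less \<O> \<pi> T Z x y" using less True unfolding iffT Z_def by simp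
    moreover have "consistent T (PiE T Z) (block_less \<O> \<pi> T Z) S (block_less \<O> \<pi> S (restrict Z S))"
      using dom S(1) ST T Z unfolding domination_collection_def by blast
    ultimately have "block_less \<O> \<pi> S (restrict Z S) (restrict x S) (restrict y S)"
      using mem agree unfolding consistent_def by blast
    moreover have "restrict Z S = block_of P S (restrict x S)"
      using S unfolding Z_def block_of_def by (auto simp: fun_eq_iff)
    ultimately show ?thesis unfolding iffS using True S(2) by auto
  next
    case False
    then obtain k where k: "k \<in> T" "\<And>e. e \<in> T \<Longrightarrow> e < k \<Longrightarrow> start_rank e (x e) = start_rank e (y e)"
        "start_rank k (x k) < start_rank k (y k)"
      using less unfolding iffT if_not_P[OF False] key_less_def by blast
    have kS: "k \<in> S" using k(1,3) agree[of k] by (metis DiffI less_irrefl)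
    then have "key_less S (\<lambda>e. start_rank e (restrict x S e)) (\<lambda>e. start_rank e (restrict y S e))"
      by (rule key_lessI) (use k S kS in auto)
    then show ?thesis unfolding iffS using k(3) kS by auto
  qed
qed

text \<open>Either the part changes, and then to an earlier one, or the ranked tuples inside the
  block differ at a single place, so the priority of that coordinate is irrelevant.\<close>

lemma BL_less_coordinate:
  assumes T: "T \<subseteq> {1..d}" and x: "x \<in> PiE T V" and e: "e \<in> T" and u: "u \<in> V e"
    and less: "\<O> e u < \<O> e (x e)"
  shows "BL_less \<O> P \<pi> T (x(e := u)) x"
proof -
  have y: "x(e := u) \<in> PiE T V" using x e u by (auto simp: PiE_iff extensional_def)
  have eD: "e \<in> {1..d}" using T e by blast
  have xe: "x e \<in> V e" using x e by auto
  note iff = BL_less_iff[OF T y x]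
  show ?thesis
  proof (cases "start_rank e u = start_rank e (x e)")
    case True
    define Z where "Z = block_of P T (x(e := u))"
    have Z: "Z \<in> PiE T P" unfolding Z_def by (rule block_of_PiE[OF T y])
    have Ze: "Z e = part_of e (x e)"
      unfolding Z_def block_of_apply[OF e] using True start_rank_eq_iff[OF eD u xe] by simp
    have T0: "T \<noteq> {}" using e by blast
    obtain q where q: "bij_betw q {1..card T} T" and lex: "\<And>x y. block_less \<O> \<pi> T Z x y \<longleftrightarrow>
        lex_less (card T) (\<lambda>j. restrict_order (\<O> (q j)) (Z (q j)) (x (q j)))
          (\<lambda>j. restrict_order (\<O> (q j)) (Z (q j)) (y (q j)))"
      using block_less_lex[OF T0 T Z] by blast
    obtain j where j: "j \<in> {1..card T}" "q j = e" using bij_betw_surjD[OF q e] by blast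
    have "u \<in> part_of e (x e)" using True start_rank_eq_iff[OF eD u xe] mem_part_of[OF eD u] by simp
    then have "restrict_order (\<O> e) (Z e) u < restrict_order (\<O> e) (Z e) (x e)"
      unfolding Ze
      using restrict_order_less_iff[OF eD part_subset_V[OF eD part_of_mem[OF eD xe]]]
        mem_part_of[OF eD xe] less by blast
    moreover have "q k \<noteq> e" if "k \<in> {1..card T}" "k \<noteq> j" for k
      using bij_betw_injD[OF q j(1) that] j(2) by simp
    ultimately have "block_less \<O> \<pi> T Z (x(e := u)) x"
      unfolding lex by (intro lex_less_one_coordinate[OF j(1)]) (auto simp: j(2))
    then show ?thesis unfolding iff Z_def using True by auto
  next
    case False
    then have "start_rank e u < start_rank e (x e)"
      using start_rank_mono[OF eD u xe] less by simp
    then have "key_less T (\<lambda>k. start_rank k ((x(e := u)) k)) (\<lambda>k. start_rank k (x k))"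
      by (intro key_lessI[OF e]) auto
    then show ?thesis unfolding iff using False e by auto
  qed
qed

text \<open>The coordinate is \<open>q 1\<close>, the one that the permutation of the block of
  \<open>z\<close> compares first.\<close>

lemma BL_less_first:
  assumes z: "z \<in> PiE {1..d} V"
  shows "\<exists>k\<in>{1..d}. \<forall>x\<in>PiE {1..d} V. \<forall>y\<in>PiE {1..d} V.
     (\<forall>e\<in>{1..d}. start_rank e (x e) = start_rank e (z e) \<and> start_rank e (y e) = start_rank e (z e)) \<longrightarrow>
     \<O> k (x k) < \<O> k (y k) \<longrightarrow> BL_less \<O> P \<pi> {1..d} x y"
proof -
  let ?D = "{1..d}"
  have D: "?D \<noteq> {}" "?D \<subseteq> {1..d}" using d3 by auto
  define Z where "Z = block_of P ?D z"
  have Z: "Z \<in> PiE ?D P" unfolding Z_def by (rule block_of_PiE[OF D(2) z])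
  obtain q where q: "bij_betw q {1..card ?D} ?D" and lex: "\<And>x y. block_less \<O> \<pi> ?D Z x y \<longleftrightarrow>
        lex_less (card ?D) (\<lambda>j. restrict_order (\<O> (q j)) (Z (q j)) (x (q j)))
          (\<lambda>j. restrict_order (\<O> (q j)) (Z (q j)) (y (q j)))"
    using block_less_lex[OF D Z] by blast
  have k: "q 1 \<in> ?D" using bij_betwE[OF q] d3 by auto
  show ?thesis
  proof (intro bexI[OF _ k] ballI impI)
    fix x y assume x: "x \<in> PiE ?D V" and y: "y \<in> PiE ?D V"
      and same: "\<forall>e\<in>?D. start_rank e (x e) = start_rank e (z e) \<and> start_rank e (y e) = start_rank e (z e)"
      and less: "\<O> (q 1) (x (q 1)) < \<O> (q 1) (y (q 1))"
    have bx: "block_of P ?D x = Z" and byy: "block_of P ?D y = Z"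
      unfolding Z_def using block_of_eq_iff[OF D(2) x z] block_of_eq_iff[OF D(2) y z] same by auto
    have "x (q 1) \<in> Z (q 1)" "y (q 1) \<in> Z (q 1)"
      using PiE_mem[OF mem_block_of[OF D(2) x] k] PiE_mem[OF mem_block_of[OF D(2) y] k]
      unfolding bx byy by auto
    moreover have "Z (q 1) \<subseteq> V (q 1)" by (rule factor_subset_V[OF D(2) Z k])
    ultimately have "restrict_order (\<O> (q 1)) (Z (q 1)) (x (q 1)) < restrict_order (\<O> (q 1)) (Z (q 1)) (y (q 1))"
      using restrict_order_less_iff[OF k] less by blast
    then have "block_less \<O> \<pi> ?D Z x y"
      unfolding lex lex_less_def using d3 by (intro exI[of _ 0]) auto
    then show "BL_less \<O> P \<pi> ?D x y" unfolding BL_less_iff[OF D(2) x y] bx using same by simp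
  qed
qed

sublocale block_system d V \<O> start_rank "BL_less \<O> P \<pi>" back_degree
proof
  show "BL_less \<O> P \<pi> T x y"
    if "T \<subseteq> {1..d}" "x \<in> PiE T V" "y \<in> PiE T V"
      "key_less T (\<lambda>e. start_rank e (x e)) (\<lambda>e. start_rank e (y e))" for T x y
    using that key_less_irrefl[of T "\<lambda>e. start_rank e (x e)" "\<lambda>e. start_rank e (y e)"]
    unfolding BL_less_iff[OF that(1-3)] by auto
qed (fact d3 finite_V inj_order linear_BL_less BL_less_restrict BL_less_coordinate BL_less_first)+

section \<open>Edges of a product counted as weights\<close>

lemma part_eq_part_of:
  assumes e: "e \<in> {1..d}" and v: "v \<in> V e"
  shows "part e (start_rank e v) = part_of e v"
proof
  show "part e (start_rank e v) \<subseteq> part_of e v"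
    using start_rank_eq_iff[OF e _ v] mem_part_of[OF e] unfolding part_def by auto
  show "part_of e v \<subseteq> part e (start_rank e v)"
  proof
    fix u assume u: "u \<in> part_of e v"
    then have "u \<in> V e" "part_of e u = part_of e v"
      using part_subset_V[OF e part_of_mem[OF e v]] part_of_eq[OF e part_of_mem[OF e v]] by auto
    then show "u \<in> part e (start_rank e v)"
      using start_rank_eq_iff[OF e _ v] unfolding part_def by auto
  qed
qed

text \<open>The ends of an edge differ in one coordinate \<open>e\<close>. The edge is charged to
  the end whose coordinate \<open>e\<close> is later, and is encoded by that end, \<open>e\<close>,
  and the earlier value \<open>u\<close>.\<close>

lemma card_edges_box:
  assumes T: "T \<subseteq> {1..d}" and M: "M \<subseteq> PiE T V"
  shows "card (I_edges (box_product G T) M M) =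
    (\<Sum>v\<in>M. \<Sum>e\<in>T. card {u \<in> V e. {u, v e} \<in> edges (G e) \<and> \<O> e u < \<O> e (v e) \<and> v(e := u) \<in> M})"
proof -
  define N where "N v e = {u \<in> V e. {u, v e} \<in> edges (G e) \<and> \<O> e u < \<O> e (v e) \<and> v(e := u) \<in> M}" for v e
  define Q where "Q = Sigma M (\<lambda>v. Sigma T (N v))"
  define h where "h = (\<lambda>(v, e, u). {v(e := u), v} :: (nat \<Rightarrow> 'a) set)"
  have finM: "finite M" using finite_subset[OF M fin_PiE[OF T]] .
  have finT: "finite T" using finite_subset[OF T] by simp
  have finN: "finite (N v e)" if "e \<in> T" for v e
    using finite_V[of e] that T unfolding N_def by auto
  have "bij_betw h Q (I_edges (box_product G T) M M)"
    unfolding bij_betw_def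
  proof
    show "inj_on h Q"
    proof (rule inj_onI)
      fix p p' assume p: "p \<in> Q" "p' \<in> Q" "h p = h p'"
      obtain v e u v' e' u' where eq: "p = (v, e, u)" "p' = (v', e', u')" by (metis prod_cases3)
      have less: "\<O> e u < \<O> e (v e)" "\<O> e' u' < \<O> e' (v' e')"
        using p unfolding Q_def N_def eq by auto
      have "{v(e := u), v} = {v'(e' := u'), v'}" using p(3) unfolding h_def eq by simp
      \<comment> \<open>In the second case the two triples would give the same edge opposite upper
        ends, which the strict inequalities in \<open>less\<close> exclude.\<close>
      then consider "v(e := u) = v'(e' := u')" "v = v'" | "v(e := u) = v'" "v = v'(e' := u')"
        by (auto simp: doubleton_eq_iff)
      then show "p = p'"
      proof cases
        case 1
        have "e = e'"
        proof (rule ccontr)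
          assume "e \<noteq> e'"
          then have "u = v e" using fun_cong[OF 1(1), of e] 1(2) by simp
          then show False using less by simp
        qed
        moreover from this have "u = u'" using fun_cong[OF 1(1), of e] by simp
        ultimately show ?thesis using 1(2) unfolding eq by simp
      next
        case 2
        show ?thesis
        proof (cases "e = e'")
          case True
          then have "v' e = u" "v e = u'" using fun_cong[OF 2(1), of e] fun_cong[OF 2(2), of e] by auto
          then show ?thesis using less True by simp
        next
          case False
          then have "v e = u" using fun_cong[OF 2(1), of e] fun_cong[OF 2(2), of e] by simp
          then show ?thesis using less by simp
        qed
      qed
    qed
    show "h ` Q = I_edges (box_product G T) M M"
    proof
      show "h ` Q \<subseteq> I_edges (box_product G T) M M"
      proof
        fix E assume "E \<in> h ` Q"
        then obtain v e u where q: "v \<in> M" "e \<in> T" "u \<in> N v e" "E = {v(e := u), v}"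
          unfolding Q_def h_def by auto
        have u: "{u, v e} \<in> edges (G e)" "u \<noteq> v e" "v(e := u) \<in> M" using q(3) unfolding N_def by auto
        have "E \<in> edges (box_product G T)"
          unfolding box_product_def graph.simps mem_Collect_eq
          using q(1,2,4) u M
          by (intro exI[of _ "v(e := u)"] exI[of _ v] conjI bexI[of _ e]) auto
        then show "E \<in> I_edges (box_product G T) M M" using q u unfolding I_edges_def by blast
      qed
      show "I_edges (box_product G T) M M \<subseteq> h ` Q"
      proof
        fix E assume "E \<in> I_edges (box_product G T) M M"
        then obtain a b where E: "E \<in> edges (box_product G T)" "a \<in> M" "b \<in> M" "E = {a, b}"
          unfolding I_edges_def by blast
        then obtain x y i where xy: "E = {x, y}" "x \<in> PiE T V" "y \<in> PiE T V" "i \<in> T" "x i \<noteq> y i"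
            "{x i, y i} \<in> edges (G i)" "\<forall>j\<in>T - {i}. x j = y j"
          unfolding box_product_def by auto
        have xM: "x \<in> M" "y \<in> M" using E xy(1) by (auto simp: doubleton_eq_iff)
        have upd: "y(i := x i) = x" "x(i := y i) = y"
        proof -
          have "x j = y j" if "j \<noteq> i" for j
          proof (cases "j \<in> T")
            case False
            then show ?thesis using PiE_arb[OF xy(2)] PiE_arb[OF xy(3)] by simp
          qed (use xy(7) that in blast)
          then show "y(i := x i) = x" "x(i := y i) = y" by (auto simp: fun_eq_iff)
        qed
        have iD: "i \<in> {1..d}" using xy(4) T by blast
        have Vi: "x i \<in> V i" "y i \<in> V i" using PiE_mem[OF xy(2,4)] PiE_mem[OF xy(3,4)] .
        then have "\<O> i (x i) \<noteq> \<O> i (y i)" using inj_order[OF iD] xy(5) unfolding inj_on_def by blast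
        then consider "\<O> i (x i) < \<O> i (y i)" | "\<O> i (y i) < \<O> i (x i)" by linarith
        then show "E \<in> h ` Q"
        proof cases
          case 1
          then have "(y, i, x i) \<in> Q" unfolding Q_def N_def using xM xy(4,6) Vi upd by simp
          moreover have "E = h (y, i, x i)" unfolding h_def using xy(1) upd by simp
          ultimately show ?thesis by blast
        next
          case 2
          then have "(x, i, y i) \<in> Q"
            unfolding Q_def N_def using xM xy(4,6) Vi upd by (simp add: insert_commute)
          moreover have "E = h (x, i, y i)" unfolding h_def using xy(1) upd by (simp add: insert_commute)
          ultimately show ?thesis by blast
        qed
      qed
    qed
  qed
  then have "card (I_edges (box_product G T) M M) = card Q" by (simp add: bij_betw_same_card)
  also have "\<dots> = (\<Sum>v\<in>M. card (Sigma T (N v)))"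
    unfolding Q_def using finM finT finN by (intro card_SigmaI) auto
  also have "\<dots> = (\<Sum>v\<in>M. \<Sum>e\<in>T. card (N v e))"
    using finT finN by (intro sum.cong refl card_SigmaI) auto
  finally show ?thesis unfolding N_def .
qed

text \<open>Closure under lowering a coordinate makes the condition \<open>v(e := u) \<in> M\<close>
  in the edge count automatic, leaving the back degrees.\<close>

lemma card_edges_down_closed:
  assumes T: "T \<subseteq> {1..d}" and M: "down_closed T (PiE T V) M"
  shows "card (I_edges (box_product G T) M M) = weight T M"
proof -
  have MV: "M \<subseteq> PiE T V" using M unfolding down_closed_def by blast
  show ?thesis
    unfolding card_edges_box[OF T MV] weight_def back_degree_def
  proof (intro sum.cong refl arg_cong[where f = card] Collect_cong conj_cong)
    fix v e u assume v: "v \<in> M" and e: "e \<in> T"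
    show "(\<O> e u < \<O> e (v e) \<and> v(e := u) \<in> M) = (\<O> e u < \<O> e (v e))" if "u \<in> V e"
      using M v e that update_PiE[OF subsetD[OF MV v] e that] unfolding down_closed_def by blast
  qed
qed

section \<open>Degrees inside a part and towards earlier parts\<close>

definition inner_degree :: "nat \<Rightarrow> nat \<Rightarrow> 'a \<Rightarrow> nat" where
  "inner_degree e c v = card {u \<in> part e c. {u, v} \<in> edges (G e) \<and> \<O> e u < \<O> e v}"

definition outer_degree :: "nat \<Rightarrow> 'a \<Rightarrow> nat" where
  "outer_degree e v =
     card {u \<in> V e. {u, v} \<in> edges (G e) \<and> \<O> e u < \<O> e v \<and> u \<notin> part e (start_rank e v)}"

lemma back_degree_split:
  assumes e: "e \<in> {1..d}"
  shows "back_degree e v = outer_degree e v + inner_degree e (start_rank e v) v"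
proof -
  let ?B = "{u \<in> V e. {u, v} \<in> edges (G e) \<and> \<O> e u < \<O> e v}"
  let ?Z = "part e (start_rank e v)"
  have "finite ?B" using finite_V[OF e] by simp
  then have "card ?B = card (?B - ?Z) + card (?B \<inter> ?Z)"
    using card_Int_Diff[of ?B ?Z] by linarith
  moreover have "?B - ?Z = {u \<in> V e. {u, v} \<in> edges (G e) \<and> \<O> e u < \<O> e v \<and> u \<notin> ?Z}" by blast
  moreover have "?B \<inter> ?Z = {u \<in> ?Z. {u, v} \<in> edges (G e) \<and> \<O> e u < \<O> e v}"
    using part_subset[of e "start_rank e v"] by blast
  ultimately show ?thesis unfolding back_degree_def outer_degree_def inner_degree_def by simp
qed

text \<open>The defining condition of an isoperimetric partition: every vertex of the part starting
  at rank \<open>a\<close> has \<open>delta (G e) a\<close> neighbours before the part.\<close>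

lemma outer_degree_eq:
  assumes e: "e \<in> {1..d}" and u: "u \<in> V e" and v: "v \<in> V e" and same: "start_rank e u = start_rank e v"
  shows "outer_degree e u = outer_degree e v"
proof -
  define Z where "Z = part_of e u"
  have Zv: "part_of e v = Z" using start_rank_eq_iff[OF e u v] same unfolding Z_def by simp
  have ZP: "Z \<in> P e" unfolding Z_def by (rule part_of_mem[OF e u])
  obtain a b where ab: "Z = interval (G e) (\<O> e) a b"
    and deg: "\<forall>w\<in>Z. int (card (I_edges (G e) (interval (G e) (\<O> e) 1 (a - 1)) {w})) = delta (G e) a"
    using iso[OF e] ZP unfolding isoperimetric_partition_def by blast
  have "outer_degree e w = nat (delta (G e) a)" if w: "w \<in> Z" "w \<in> V e" "part_of e w = Z" for w
  proof -
    have ge1: "1 \<le> \<O> e x" if "x \<in> V e" for x using bij_betwE[OF bij_order[OF e]] that by auto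
    have "{x \<in> V e. {x, w} \<in> edges (G e) \<and> \<O> e x < \<O> e w \<and> x \<notin> Z} =
        {x \<in> interval (G e) (\<O> e) 1 (a - 1). {x, w} \<in> edges (G e)}"
      using w(1) ge1 unfolding ab interval_def by fastforce
    then have "int (outer_degree e w) = delta (G e) a"
      using deg w(1) unfolding outer_degree_def part_eq_part_of[OF e w(2)] w(3) I_edges_singleton by simp
    then show ?thesis by simp
  qed
  then show ?thesis using mem_part_of[OF e u] mem_part_of[OF e v] u v Zv unfolding Z_def by metis
qed

text \<open>Edges inside the block see only the inner degrees. The outer degrees are constant on the
  block, so they add the same amount for each point of \<open>M\<close>, and comparing edges is
  comparing weights for sets of equal size. \<open>w\<close> is any point of the block at which the
  constant is read off.\<close>

lemma card_edges_down_closed_block: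
  assumes T: "T \<subseteq> {1..d}" and M: "down_closed T (block T c) M" and w: "w \<in> block T c"
  shows "card (I_edges (box_product G T) M M) + card M * (\<Sum>e\<in>T. outer_degree e (w e)) = weight T M"
proof -
  have MB: "M \<subseteq> block T c" using M unfolding down_closed_def by blast
  then have MV: "M \<subseteq> PiE T V" using block_subset by blast
  have wV: "w \<in> PiE T V" using w block_subset by blast
  have edges: "card (I_edges (box_product G T) M M) = (\<Sum>v\<in>M. \<Sum>e\<in>T. inner_degree e (c e) (v e))"
    unfolding card_edges_box[OF T MV] inner_degree_def
  proof (intro sum.cong refl arg_cong[where f = card] Collect_cong)
    fix v e u assume v: "v \<in> M" and e: "e \<in> T"
    have vB: "v \<in> block T c" using MB v by blast
    have mem: "v(e := u) \<in> block T c \<longleftrightarrow> u \<in> part e (c e)" if "u \<in> V e"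
    proof
      assume "v(e := u) \<in> block T c"
      then have "(v(e := u)) e \<in> part e (c e)" using e unfolding block_def by (meson PiE_mem)
      then show "u \<in> part e (c e)" by simp
    next
      assume "u \<in> part e (c e)"
      moreover have "v(e := u) \<in> PiE T V"
        using vB by (intro update_PiE e that) (simp add: mem_block_iff)
      ultimately show "v(e := u) \<in> block T c"
        using vB by (simp add: mem_block_iff key_def part_def)
    qed
    have "v(e := u) \<in> M \<longleftrightarrow> u \<in> part e (c e)" if "u \<in> V e" "\<O> e u < \<O> e (v e)"
      using mem[OF that(1)] M v e that MB unfolding down_closed_def by blast
    then show "(u \<in> V e \<and> {u, v e} \<in> edges (G e) \<and> \<O> e u < \<O> e (v e) \<and> v(e := u) \<in> M) =
        (u \<in> part e (c e) \<and> {u, v e} \<in> edges (G e) \<and> \<O> e u < \<O> e (v e))"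
      using part_subset[of e "c e"] by blast
  qed
  have "weight T M = (\<Sum>v\<in>M. \<Sum>e\<in>T. outer_degree e (w e) + inner_degree e (c e) (v e))"
    unfolding weight_def
  proof (intro sum.cong refl)
    fix v e assume v: "v \<in> M" and e: "e \<in> T"
    have eD: "e \<in> {1..d}" using e T by blast
    have k: "start_rank e (v e) = c e" "start_rank e (w e) = c e"
      using subsetD[OF MB v] w e unfolding mem_block_iff key_def by blast+
    have "v e \<in> V e" "w e \<in> V e" using PiE_mem[OF subsetD[OF MV v] e] PiE_mem[OF wV e] .
    then have "outer_degree e (v e) = outer_degree e (w e)"
      using outer_degree_eq[OF eD, of "v e" "w e"] k by presburger
    then show "back_degree e (v e) = outer_degree e (w e) + inner_degree e (c e) (v e)"
      using back_degree_split[OF eD, of "v e"] k by simp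
  qed
  then show ?thesis unfolding edges by (simp add: sum.distrib)
qed

text \<open>The restriction of the order to a part is optimal for the induced subgraph, so the back
  degrees inside the part are its \<open>delta\<close> sequence.\<close>

lemma inner_degree_eq_delta:
  assumes e: "e \<in> {1..d}" and v: "v \<in> V e"
  shows "int (inner_degree e (start_rank e v) v) =
    delta (induced (G e) (part_of e v)) (restrict_order (\<O> e) (part_of e v) v)"
proof -
  define Z where "Z = part_of e v"
  have ZP: "Z \<in> P e" and vZ: "v \<in> Z" unfolding Z_def using part_of_mem[OF e v] mem_part_of[OF e v] .
  have ZV: "Z \<subseteq> V e" by (rule part_subset_V[OF e ZP])
  have opt: "optimal (induced (G e) Z) (restrict_order (\<O> e) Z)"
    using iso[OF e] ZP unfolding isoperimetric_partition_def by blast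
  have vs: "verts (induced (G e) Z) = Z" unfolding induced_def by simp
  have "{u \<in> Z. {u, v} \<in> edges (induced (G e) Z) \<and> restrict_order (\<O> e) Z u < restrict_order (\<O> e) Z v}
      = {u \<in> Z. {u, v} \<in> edges (G e) \<and> \<O> e u < \<O> e v}"
    using restrict_order_less_iff[OF e ZV _ vZ] vZ unfolding induced_def by auto
  then show ?thesis
    using delta_eq_back_degree[OF simple_graph_induced[OF simple[OF e] ZV] opt, of v] vZ
    unfolding vs inner_degree_def part_eq_part_of[OF e v] Z_def[symmetric] by simp
qed

lemma restrict_order_range:
  assumes e: "e \<in> {1..d}" and v: "v \<in> V e"
  shows "restrict_order (\<O> e) (part_of e v) v \<in> {1..card (part_of e v)}"
proof -
  have "optimal (induced (G e) (part_of e v)) (restrict_order (\<O> e) (part_of e v))"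
    using iso[OF e] part_of_mem[OF e v] unfolding isoperimetric_partition_def by blast
  then have "bij_betw (restrict_order (\<O> e) (part_of e v)) (part_of e v) {1..card (part_of e v)}"
    unfolding optimal_def total_order_def induced_def by simp
  then show ?thesis using mem_part_of[OF e v] bij_betwE by blast
qed

section \<open>Both notions of compression in the block system\<close>

lemma strongly_compressed_iff:
  assumes A: "A \<subseteq> PiE {1..d} V"
  shows "strongly_compressed d G \<O> P \<pi> A \<longleftrightarrow> strongly_closed A"
proof -
  have comp: "compression d G S (BL_order G \<O> P \<pi> S) A =
      {v \<in> PiE {1..d} V. ranking (PiE S V) (BL_less \<O> P \<pi> S) (restrict v S) \<le> card (A \<inter> fibre S v)}"
    (is "?L = ?R") for S
  proof
    \<comment> \<open>A section is determined by the coordinates outside \<open>S\<close>, so it is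
      the fibre of any of its points.\<close>
    have sec: "section_at d G S x = fibre S v" if "v \<in> section_at d G S x" for x v
      using that unfolding section_at_def fibre_def box_product_def by auto
    show "?L \<subseteq> ?R"
    proof
      fix v assume "v \<in> ?L"
      then obtain x where x: "v \<in> section_at d G S x"
        "BL_order G \<O> P \<pi> S (restrict v S) \<le> card (A \<inter> section_at d G S x)"
        unfolding compression_def by blast
      then show "v \<in> ?R"
        using sec[OF x(1)] by (simp add: BL_order_def box_product_def section_at_def)
    qed
    show "?R \<subseteq> ?L"
    proof
      fix v assume v: "v \<in> ?R"
      define x where "x = restrict v ({1..d} - S)"
      have xV: "x \<in> verts (box_product G ({1..d} - S))"
        using v unfolding x_def box_product_def by auto
      have vx: "v \<in> section_at d G S x"
        using v unfolding section_at_def x_def box_product_def by auto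
      then have "BL_order G \<O> P \<pi> S (restrict v S) \<le> card (A \<inter> section_at d G S x)"
        using v unfolding sec[OF vx] by (simp add: BL_order_def box_product_def)
      then show "v \<in> ?L" using xV vx unfolding compression_def by blast
    qed
  qed
  have eq: "compression d G S (BL_order G \<O> P \<pi> S) A = A \<longleftrightarrow> (\<forall>v\<in>PiE {1..d} V. v \<in> A \<longleftrightarrow>
      ranking (PiE S V) (BL_less \<O> P \<pi> S) (restrict v S) \<le> card (A \<inter> fibre S v))" for S
    unfolding comp using A by blast
  show ?thesis unfolding strongly_compressed_def strongly_closed_iff[OF A] eq ..
qed

text \<open>In a slice the filled set is initial, and a point of it in the block \<open>Z\<close>
  lies above all points of every earlier block of that slice.\<close>

lemma slice_compressed_slice_fill: "slice_compressed d \<O> P \<pi> (slice_fill A)"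
  unfolding slice_compressed_def Let_def
proof (intro ballI impI)
  let ?D = "{1..d}" and ?B = "slice_fill A" and ?s = "block_start \<O> {1..d}"
  have D: "?D \<noteq> {}" "?D \<subseteq> {1..d}" using d3 by auto
  fix q Z Y
  assume Z: "Z \<in> slice_blocks d \<O> P q" and Y: "Y \<in> slice_blocks d \<O> P q"
    and meets: "?B \<inter> PiE ?D Z \<noteq> {} \<and> (\<forall>Y\<in>slice_blocks d \<O> P q.
      BL_less \<O> P \<pi> ?D (?s Z) (?s Y) \<longrightarrow> ?B \<inter> PiE ?D Y = {})"
    and before: "BL_less \<O> P \<pi> ?D (?s Y) (?s Z)"
  have ZP: "Z \<in> PiE ?D P" and YP: "Y \<in> PiE ?D P" and st1: "?s Y 1 = ?s Z 1"
    using Z Y unfolding slice_blocks_def by auto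
  have rank: "start_rank e (x e) = \<O> e (start (\<O> e) (X e))"
    if "X \<in> PiE ?D P" "x \<in> PiE ?D X" "e \<in> ?D" for X x e
    unfolding start_rank_def using part_of_eq[OF that(3) PiE_mem[OF that(1,3)] PiE_mem[OF that(2,3)]] by simp
  have start_in: "?s X \<in> PiE ?D X" if "X \<in> PiE ?D P" for X
    unfolding block_start_def using start_mem(1) that by (auto simp: PiE_iff)
  obtain z where z: "z \<in> ?B" "z \<in> PiE ?D Z" using meets by blast
  have sV: "?s X \<in> PiE ?D V" if "X \<in> PiE ?D P" for X
    using start_in[OF that] block_subset_V[OF D(2) that] by blast
  show "PiE ?D Y \<subseteq> ?B"
  proof
    fix y assume y: "y \<in> PiE ?D Y"
    have V: "y \<in> PiE ?D V" "z \<in> PiE ?D V"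
      using y z block_subset_V[OF D(2) YP] block_subset_V[OF D(2) ZP] by auto
    have ry: "start_rank e (y e) = start_rank e (?s Y e)" and rz: "start_rank e (z e) = start_rank e (?s Z e)"
      if "e \<in> ?D" for e
      using rank[OF YP _ that] rank[OF ZP _ that] y z(2) start_in[OF YP] start_in[OF ZP] by auto
    \<comment> \<open>\<open>before\<close> applies the full order to the starts. Being different,
      they belong to different blocks, so the comparison is one of keys and extends to all points of
      the two blocks.\<close>
    have "\<exists>e\<in>?D. start_rank e (?s Y e) \<noteq> start_rank e (?s Z e)"
    proof (rule ccontr)
      assume "\<not> ?thesis"
      then have "\<O> e (start (\<O> e) (Y e)) = \<O> e (start (\<O> e) (Z e))" if "e \<in> ?D" for e
        using rank[OF YP start_in[OF YP] that] rank[OF ZP start_in[OF ZP] that] that by auto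
      then have "start (\<O> e) (Y e) = start (\<O> e) (Z e)" if "e \<in> ?D" for e
        using inj_order[OF that] PiE_mem[OF sV[OF YP] that] PiE_mem[OF sV[OF ZP] that] that
        unfolding inj_on_def block_start_def by simp
      then have "?s Y = ?s Z" unfolding block_start_def by (auto simp: fun_eq_iff)
      then show False using before linear_BL_less[OF D] sV[OF ZP] unfolding strict_linear_on_def by auto
    qed
    then have "key_less ?D (\<lambda>e. start_rank e (?s Y e)) (\<lambda>e. start_rank e (?s Z e))"
      using before unfolding BL_less_iff[OF D(2) sV[OF YP] sV[OF ZP]] by (metis (no_types, lifting))
    then have "key_less ?D (key y) (key z)"
      using key_less_cong[of ?D "key y" "\<lambda>e. start_rank e (?s Y e)" "key z" "\<lambda>e. start_rank e (?s Z e)"]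
        ry rz unfolding key_def by blast
    then have "BL_less \<O> P \<pi> ?D y z" by (rule L_key'[OF D(2) V])
    moreover have "start_rank 1 (y 1) = start_rank 1 (z 1)"
      using ry[OF one_le_d] rz[OF one_le_d] st1 by simp
    ultimately show "y \<in> ?B"
      using initial_slice_fill[of "start_rank 1 (z 1)" A] V z(1) unfolding initial_def slice_def by blast
  qed
qed

end

section \<open>The standing assumptions give a regular block system\<close>

locale standing = graph_family +
  assumes regular_parts: "i \<in> {2..d - 1} \<Longrightarrow> regular_partition (G i) (\<O> i) (P i)"
    and nondecreasing: "i \<in> {1..d - 1} \<Longrightarrow> nondecreasing_partition (G i) (P i)"
    and pairs: "1 \<le> i \<Longrightarrow> i < j \<Longrightarrow> j \<le> d \<Longrightarrow>
        optimal (box_product G {i, j}) (BL_order G \<O> P \<pi> {i, j})"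
begin

lemma inner_degree_mono:
  assumes e: "e \<in> {1..d - 1}" and u: "u \<in> V e" and v: "v \<in> V e"
    and same: "start_rank e u = start_rank e v" and le: "\<O> e u \<le> \<O> e v"
  shows "inner_degree e (start_rank e u) u \<le> inner_degree e (start_rank e v) v"
proof -
  have eD: "e \<in> {1..d}" using e by auto
  define Z where "Z = part_of e v"
  have Zu: "part_of e u = Z" using start_rank_eq_iff[OF eD u v] same unfolding Z_def by simp
  have ZP: "Z \<in> P e" unfolding Z_def by (rule part_of_mem[OF eD v])
  define r where "r = restrict_order (\<O> e) Z u"
  define q where "q = restrict_order (\<O> e) Z v"
  have r: "r \<in> {1..card Z}" and q: "q \<in> {1..card Z}"
    using restrict_order_range[OF eD u] restrict_order_range[OF eD v] Zu unfolding r_def q_def Z_def by auto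
  have "u \<in> Z" "v \<in> Z" using mem_part_of[OF eD u] mem_part_of[OF eD v] Zu unfolding Z_def by auto
  then have "\<not> q < r"
    using restrict_order_less_iff[OF eD part_subset_V[OF eD ZP]] le unfolding r_def q_def by simp
  moreover have "sorted (delta_seq (induced (G e) Z))"
    using nondecreasing[OF e] ZP unfolding nondecreasing_partition_def by blast
  moreover have cv: "card (verts (induced (G e) Z)) = card Z" unfolding induced_def by simp
  ultimately have "delta_seq (induced (G e) Z) ! (r - 1) \<le> delta_seq (induced (G e) Z) ! (q - 1)"
    using q by (intro sorted_nth_mono) (auto simp: length_delta_seq)
  then have "delta (induced (G e) Z) r \<le> delta (induced (G e) Z) q"
    using delta_seq_nth[of r "induced (G e) Z"] delta_seq_nth[of q "induced (G e) Z"] r q cv by simp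
  then have "int (inner_degree e (start_rank e u) u) \<le> int (inner_degree e (start_rank e v) v)"
    unfolding inner_degree_eq_delta[OF eD u] inner_degree_eq_delta[OF eD v] Zu Z_def[symmetric]
      r_def[symmetric] q_def[symmetric] .
  then show ?thesis by simp
qed

sublocale optimal_block_system d V \<O> start_rank "BL_less \<O> P \<pi>" back_degree
proof
  fix T c M N
  assume T: "T \<noteq> {}" "T \<subseteq> {1..d}" and M: "down_closed T (block T c) M"
    and N: "initial (block T c) (BL_less \<O> P \<pi> T) N" and card: "card M = card N"
  show "weight T M \<le> weight T N"
  \<comment> \<open>The key \<open>c\<close> is arbitrary and need not name an actual block.\<close>
  proof (cases "block T c = {}")
    case True
    then show ?thesis using M unfolding down_closed_def weight_def by simp
  next
    case False
    then obtain w where w: "w \<in> block T c" by blast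
    then have wV: "w \<in> PiE T V" using block_subset by blast
    define Z where "Z = block_of P T w"
    have Z: "Z \<in> PiE T P" unfolding Z_def by (rule block_of_PiE[OF T(2) wV])
    have "Z e = part e (c e)" if e: "e \<in> T" for e
    proof -
      have "c e = start_rank e (w e)" using w e by (simp add: mem_block_iff key_def)
      then show ?thesis
        unfolding Z_def block_of_apply[OF e]
        using part_eq_part_of[OF subsetD[OF T(2) e] PiE_mem[OF wV e]] by simp
    qed
    then have blk: "block T c = PiE T Z" unfolding block_def by (auto intro!: PiE_cong)
    have BL: "BL_less \<O> P \<pi> T x y = block_less \<O> \<pi> T Z x y"
      if "x \<in> block T c" "y \<in> block T c" for x y
    proof -
      have V: "x \<in> PiE T V" "y \<in> PiE T V" using that block_subset by auto
      have same: "\<forall>e\<in>T. start_rank e (x e) = start_rank e (y e)"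
        and same': "\<forall>e\<in>T. start_rank e (x e) = start_rank e (w e)"
        using that w by (auto simp: mem_block_iff key_def)
      then have "block_of P T x = Z" unfolding Z_def using block_of_eq_iff[OF T(2) V(1) wV] by simp
      then show ?thesis unfolding BL_less_iff[OF T(2) V] if_P[OF same] by simp
    qed
    let ?H = "induced (box_product G T) (PiE T Z)"
    have vs: "verts ?H = PiE T Z" unfolding induced_def by simp
    have MB: "M \<subseteq> PiE T Z" and NB: "N \<subseteq> PiE T Z"
      using M N unfolding down_closed_def initial_def blk by auto
    have "card (I_edges ?H M M) \<le> card (I_edges ?H N N)"
    proof (rule optimal_initial)
      show "finite (verts ?H)"
        unfolding vs using finite_subset[OF block_subset fin_PiE[OF T(2)], of c] blk by simp
      show "strict_linear_on (verts ?H) (block_less \<O> \<pi> T Z)"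
        unfolding vs by (rule linear_block_less[OF T Z])
      show "optimal ?H (ranking (verts ?H) (block_less \<O> \<pi> T Z))"
        using dom T Z unfolding domination_collection_def vs by blast
      show "initial (verts ?H) (block_less \<O> \<pi> T Z) N"
        using N BL unfolding vs initial_def blk by (metis subsetD)
    qed (use MB card in \<open>auto simp: vs\<close>)
    then have "card (I_edges (box_product G T) M M) \<le> card (I_edges (box_product G T) N N)"
      using I_edges_induced MB NB by metis
    moreover have "down_closed T (block T c) N"
      by (rule down_closed_initial[OF T(2) block_subset N])
    ultimately show ?thesis
      using card_edges_down_closed_block[OF T(2) M w] card_edges_down_closed_block[OF T(2) _ w, of N] card
      by (metis add_le_cancel_right)
  qed
next
  fix i j M N
  assume ij: "1 \<le> i" "i < j" "j \<le> d" and M: "down_closed {i, j} (PiE {i, j} V) M"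
    and N: "initial (PiE {i, j} V) (BL_less \<O> P \<pi> {i, j}) N" and card: "card M = card N"
  have T: "{i, j} \<noteq> {}" "{i, j} \<subseteq> {1..d}" using ij by auto
  have vs: "verts (box_product G {i, j}) = PiE {i, j} V" unfolding box_product_def by simp
  have "card (I_edges (box_product G {i, j}) M M) \<le> card (I_edges (box_product G {i, j}) N N)"
  proof (rule optimal_initial)
    show "optimal (box_product G {i, j}) (ranking (verts (box_product G {i, j})) (BL_less \<O> P \<pi> {i, j}))"
      using pairs[OF ij] unfolding BL_order_def .
    show "finite (verts (box_product G {i, j}))" unfolding vs by (rule fin_PiE[OF T(2)])
    show "strict_linear_on (verts (box_product G {i, j})) (BL_less \<O> P \<pi> {i, j})"
      unfolding vs by (rule linear_BL_less[OF T])
    show "M \<subseteq> verts (box_product G {i, j})" using M unfolding vs down_closed_def by blast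
  qed (use N card in \<open>auto simp: vs\<close>)
  then show "weight {i, j} M \<le> weight {i, j} N"
    using card_edges_down_closed[OF T(2) M]
      card_edges_down_closed[OF T(2) down_closed_initial[OF T(2) subset_refl N]] by simp
next
  fix e u v
  assume e: "e \<in> {1..d - 1}" and uv: "u \<in> V e" "v \<in> V e" "start_rank e u = start_rank e v" "\<O> e u \<le> \<O> e v"
  have eD: "e \<in> {1..d}" using e by auto
  show "back_degree e u \<le> back_degree e v"
    unfolding back_degree_split[OF eD]
    using inner_degree_mono[OF e uv] outer_degree_eq[OF eD uv(1-3)] by simp
qed

text \<open>A vertex of the first part has no neighbours in earlier parts, so its back degree is its
  inner degree. Equality of the \<open>delta\<close> sequences makes this the inner degree of the
  vertex of the same rank in the last part, whose outer degree can only add to it.\<close>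

sublocale regular_block_system d V \<O> start_rank "BL_less \<O> P \<pi>" back_degree
proof
  fix e u v
  assume e: "e \<in> {2..d - 1}" and u: "u \<in> V e" and v: "v \<in> V e"
    and first: "\<And>w. w \<in> V e \<Longrightarrow> start_rank e u \<le> start_rank e w"
    and last: "\<And>w. w \<in> V e \<Longrightarrow> start_rank e w \<le> start_rank e v"
  have eD: "e \<in> {1..d}" using e by auto
  define F where "F = part_of e u"
  define K where "K = part_of e v"
  have FP: "F \<in> P e" and KP: "K \<in> P e" unfolding F_def K_def using part_of_mem[OF eD] u v by auto
  have start_of: "\<exists>w\<in>V e. start_rank e w = \<O> e (start (\<O> e) Z)" if "Z \<in> P e" for Z
    using start_mem(1)[OF eD that] part_subset_V[OF eD that] part_of_eq[OF eD that]
    unfolding start_rank_def by (intro bexI[of _ "start (\<O> e) Z"]) auto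
  have "is_first_part (\<O> e) (P e) F"
    unfolding is_first_part_def
  proof (intro conjI ballI FP)
    show "\<O> e (start (\<O> e) F) \<le> \<O> e (start (\<O> e) Z)" if "Z \<in> P e" for Z
      using start_of[OF that] first unfolding F_def start_rank_def[of e u, symmetric] by metis
  qed
  moreover have "is_last_part (\<O> e) (P e) K"
    unfolding is_last_part_def
  proof (intro conjI ballI KP)
    show "\<O> e (start (\<O> e) Z) \<le> \<O> e (start (\<O> e) K)" if "Z \<in> P e" for Z
      using start_of[OF that] last unfolding K_def start_rank_def[of e v, symmetric] by metis
  qed
  ultimately have seq: "delta_seq (induced (G e) F) = delta_seq (induced (G e) K)"
    using regular_parts[OF e] unfolding regular_partition_def by blast
  have vs: "verts (induced (G e) Z) = Z" for Z unfolding induced_def by simp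
  have cFK: "card F = card K" using arg_cong[OF seq, of length] by (simp add: length_delta_seq vs)
  have pF: "part e (start_rank e u) = F" and pK: "part e (start_rank e v) = K"
    unfolding F_def K_def using part_eq_part_of[OF eD] u v by auto
  show "comparable e (start_rank e u) (start_rank e v)"
    unfolding comparable_def pF pK
  proof (intro conjI cFK ballI impI)
    fix x y assume x: "x \<in> F" and y: "y \<in> K" and "rk e (start_rank e u) x = rk e (start_rank e v) y"
    then have rk: "restrict_order (\<O> e) F x = restrict_order (\<O> e) K y"
      unfolding rk_def pF pK restrict_order_def by simp
    have xV: "x \<in> V e" and yV: "y \<in> V e" using x y part_subset_V[OF eD] FP KP by auto
    have px: "part_of e x = F" and py: "part_of e y = K" using part_of_eq[OF eD] FP KP x y by auto
    define r where "r = restrict_order (\<O> e) F x"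
    have r: "r \<in> {1..card F}" using restrict_order_range[OF eD xV] unfolding px r_def .
    have "delta (induced (G e) F) r = delta (induced (G e) K) r"
      using delta_seq_nth[of r "induced (G e) F"] delta_seq_nth[of r "induced (G e) K"] seq r cFK
      by (simp add: vs)
    then have "int (inner_degree e (start_rank e x) x) = int (inner_degree e (start_rank e y) y)"
      unfolding inner_degree_eq_delta[OF eD xV] inner_degree_eq_delta[OF eD yV] px py
      using rk unfolding r_def by simp
    moreover have "outer_degree e x = 0"
    proof -
      have "w \<in> part e (start_rank e x)" if "w \<in> V e" "\<O> e w < \<O> e x" for w
      proof -
        have "start_rank e w \<le> start_rank e x" using start_rank_mono[OF eD that(1) xV] that(2) by simp
        moreover have "start_rank e x = start_rank e u" using start_rank_eq_iff[OF eD xV u] px F_def by simp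
        ultimately show ?thesis using first[OF that(1)] that(1) unfolding part_def by simp
      qed
      then have "{w \<in> V e. {w, x} \<in> edges (G e) \<and> \<O> e w < \<O> e x \<and> w \<notin> part e (start_rank e x)} = {}"
        by blast
      then show ?thesis unfolding outer_degree_def by (simp only: card.empty)
    qed
    ultimately show "back_degree e x \<le> back_degree e y"
      unfolding back_degree_split[OF eD] by simp
  qed
qed

end

theorem theorem10:
  fixes d :: nat
    and G :: "nat \<Rightarrow> 'a graph"
    and \<O> :: "nat \<Rightarrow> 'a \<Rightarrow> nat"
    and P :: "nat \<Rightarrow> 'a set set"
    and \<pi> :: "'a perm_assignment"
    and A :: "(nat \<Rightarrow> 'a) set"
  assumes "d \<ge> 3"
    and "\<And>i. i \<in> {1..d} \<Longrightarrow> simple_graph (G i)"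
    and "\<And>i. i \<in> {1..d} \<Longrightarrow> optimal (G i) (\<O> i)"
    and "\<And>i. i \<in> {1..d} \<Longrightarrow> isoperimetric_partition (G i) (\<O> i) (P i)"
    and "regular_domination_collection d G \<O> P \<pi>"
    and "\<And>i. i \<in> {1..d - 1} \<Longrightarrow> nondecreasing_partition (G i) (P i)"
    and "\<And>i j. 1 \<le> i \<Longrightarrow> i < j \<Longrightarrow> j \<le> d \<Longrightarrow>
           optimal (box_product G {i, j}) (BL_order G \<O> P \<pi> {i, j})"
    and "A \<subseteq> verts (box_product G {1..d})"
    and "strongly_compressed d G \<O> P \<pi> A"
  shows "\<exists>B \<subseteq> verts (box_product G {1..d}).
           strongly_compressed d G \<O> P \<pi> B \<and> slice_compressed d \<O> P \<pi> B \<and>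
           card B = card A \<and>
           card (I_edges (box_product G {1..d}) A A) \<le> card (I_edges (box_product G {1..d}) B B)"
proof -
  interpret standing d G \<O> P \<pi>
    by unfold_locales (use assms in \<open>auto simp: regular_domination_collection_def\<close>)
  have vs: "verts (box_product G {1..d}) = PiE {1..d} V" unfolding box_product_def by simp
  have AV: "A \<subseteq> PiE {1..d} V" using assms(8) unfolding vs .
  have A: "strongly_closed A" using assms(9) strongly_compressed_iff[OF AV] by blast
  define B where "B = slice_fill A"
  have BV: "B \<subseteq> PiE {1..d} V" unfolding B_def by (rule slice_fill_subset)
  have B: "strongly_closed B" unfolding B_def by (rule strongly_closed_slice_fill[OF A])
  have "card (I_edges (box_product G {1..d}) A A) \<le> card (I_edges (box_product G {1..d}) B B)"
    unfolding card_edges_down_closed[OF subset_refl down_closed_strongly_closed[OF A]]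
      card_edges_down_closed[OF subset_refl down_closed_strongly_closed[OF B]]
    unfolding B_def by (rule weight_slice_fill[OF A])
  moreover have "strongly_compressed d G \<O> P \<pi> B" using strongly_compressed_iff[OF BV] B by blast
  moreover have "slice_compressed d \<O> P \<pi> B" unfolding B_def by (rule slice_compressed_slice_fill)
  moreover have "card B = card A" unfolding B_def by (rule card_slice_fill[OF AV])
  ultimately show ?thesis using BV unfolding vs by blast
qed

end
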